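(* Let $X$ be a countable CW-complex and $\gamma:\coprod S^1\rightarrow X$ a map from a finite disjoint union of circles. For every real class $\alpha\in H_2(X,\gamma;\mathbb{R})$, \[ \|\alpha\|_1=\sup\left\{\frac{\langle u,\alpha\rangle}{\|u\|_\infty}\;\middle|\; u\in H^2_b(X;\mathbb{R})\smallsetminus\{0\}\right\}. \]
   Context: $X_\gamma$ is the mapping cylinder $(X\sqcup(\coprod S^1\times[0,1]))/((u,0)\sim\gamma(u))$, with $\coprod S^1$ identified with $\coprod S^1\times\{1\}$, and $H_*(X,\gamma;\mathbb{R}):=H_*(X_\gamma,\coprod S^1;\mathbb{R})$ (singular homology). The relative Gromov seminorm $\|\alpha\|_1$ is the infimum of $\|a\|_1$ over relative singular cycles $a$ representing $\alpha$, where $\|\sum_\sigma\lambda_\sigma\sigma\|_1=\sum_\sigma|\lambda_\sigma|$ and relative chains carry the quotient seminorm. $H^*_b$ denotes bounded cohomology with real coefficients (cohomology of singular cochains bounded on singular simplices), with the $\ell^\infty$-seminorm $\|u\|_\infty=\inf$ of $\sup|\psi(\sigma)|$ over bounded cocycles $\psi$ representing $u$. Since $H^*_b(\coprod S^1;\mathbb{R})=0$, the long exact sequence of the pair gives an isomorphism $H^2_b(X_\gamma,\coprod S^1;\mathbb{R})\cong H^2_b(X_\gamma;\mathbb{R})\cong H^2_b(X;\mathbb{R})$; the pairing $\langle\cdot,\cdot\rangle:H^2_b(X;\mathbb{R})\times H_2(X,\gamma;\mathbb{R})\to\mathbb{R}$ is the Kronecker product of relative bounded cohomology with relative homology, transported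 through this isomorphism. *)

theory Defs
  imports "HOL-Analysis.Analysis" "HOL-Homology.Homology"
begin

text \<open>Closed ball, open ball and sphere of radius 1 in the subspace of nat => real
 used by HOL-Analysis' Euclidean_space n (coordinates >= n are zero).\<close>

definition cballE :: "nat \<Rightarrow> (nat \<Rightarrow> real) set" where
  "cballE n = {x. (\<forall>i\<ge>n. x i = 0) \<and> (\<Sum>i<n. (x i)^2) \<le> 1}"
definition ballE :: "nat \<Rightarrow> (nat \<Rightarrow> real) set" where
  "ballE n = {x. (\<forall>i\<ge>n. x i = 0) \<and> (\<Sum>i<n. (x i)^2) < 1}"
definition sphereE :: "nat \<Rightarrow> (nat \<Rightarrow> real) set" where
  "sphereE n = {x. (\<forall>i\<ge>n. x i = 0) \<and> (\<Sum>i<n. (x i)^2) = 1}"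

definition countable_cw_complex :: "'a topology \<Rightarrow> bool" where
  "countable_cw_complex X \<longleftrightarrow> Hausdorff_space X \<and>
    (\<exists>(I::nat set) (n::nat \<Rightarrow> nat) (\<Phi>::nat \<Rightarrow> (nat \<Rightarrow> real) \<Rightarrow> 'a).
      (\<forall>i\<in>I. continuous_map (subtopology (Euclidean_space (n i)) (cballE (n i))) X (\<Phi> i)) \<and>
      (\<forall>i\<in>I. homeomorphic_map (subtopology (Euclidean_space (n i)) (ballE (n i)))
                 (subtopology X (\<Phi> i ` ballE (n i))) (\<Phi> i)) \<and>
      (\<forall>i\<in>I. \<forall>j\<in>I. i \<noteq> j \<longrightarrow> \<Phi> i ` ballE (n i) \<inter> \<Phi> j ` ballE (n j) = {}) \<and>
      (\<Union>i\<in>I. \<Phi> i ` ballE (n i)) = topspace X \<and>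
      (\<forall>i\<in>I. \<exists>J\<subseteq>I. finite J \<and> (\<forall>j\<in>J. n j < n i) \<and>
                 \<Phi> i ` sphereE (n i) \<subseteq> (\<Union>j\<in>J. \<Phi> j ` ballE (n j))) \<and>
      (\<forall>C. C \<subseteq> topspace X \<longrightarrow>
          (closedin X C \<longleftrightarrow>
            (\<forall>i\<in>I. closedin (subtopology (Euclidean_space (n i)) (cballE (n i)))
                              {x \<in> cballE (n i). \<Phi> i x \<in> C}))))"

definition circles :: "nat \<Rightarrow> (nat \<times> (nat \<Rightarrow> real)) topology" where
  "circles k = sum_topology (\<lambda>i. nsphere 1) {..<k}"

definition cyl_proj :: "(nat \<times> (nat \<Rightarrow> real) \<Rightarrow> 'a) \<Rightarrow> (nat \<times> (nat \<Rightarrow> real)) \<times> real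
      \<Rightarrow> 'a + (nat \<times> (nat \<Rightarrow> real)) \<times> real" where
  "cyl_proj \<gamma> = (\<lambda>(u,t). if t = 0 then Inl (\<gamma> u) else Inr (u,t))"

text \<open>X_gamma = (X + (circles x [0,1])) / ((u,0) ~ gamma u), with quotient topology;
 a point (u,t), t>0, is represented by Inr (u,t), and points of X by Inl.\<close>

definition mapping_cylinder :: "'a topology \<Rightarrow> nat \<Rightarrow> (nat \<times> (nat \<Rightarrow> real) \<Rightarrow> 'a)
      \<Rightarrow> ('a + (nat \<times> (nat \<Rightarrow> real)) \<times> real) topology" where
  "mapping_cylinder X k \<gamma> = topology (\<lambda>U.
      U \<subseteq> Inl ` topspace X \<union> Inr ` (topspace (circles k) \<times> {0<..1}) \<and>
      openin X {x. Inl x \<in> U} \<and>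
      openin (prod_topology (circles k) (top_of_set {0..1}))
             {w \<in> topspace (circles k) \<times> {0..1}. cyl_proj \<gamma> w \<in> U})"

definition cyl_end :: "nat \<Rightarrow> ('a + (nat \<times> (nat \<Rightarrow> real)) \<times> real) set" where
  "cyl_end k = Inr ` (topspace (circles k) \<times> {1})"

type_synonym 'b ssimplex = "(nat \<Rightarrow> real) \<Rightarrow> 'b"

definition rchain :: "nat \<Rightarrow> 'b topology \<Rightarrow> ('b ssimplex \<Rightarrow> real) \<Rightarrow> bool" where
  "rchain p Y c \<longleftrightarrow> finite {\<sigma>. c \<sigma> \<noteq> 0} \<and> (\<forall>\<sigma>. c \<sigma> \<noteq> 0 \<longrightarrow> singular_simplex p Y \<sigma>)"

definition rbd :: "nat \<Rightarrow> ('b ssimplex \<Rightarrow> real) \<Rightarrow> ('b ssimplex \<Rightarrow> real)" where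
  "rbd p c = (\<lambda>\<tau>. \<Sum>\<sigma>\<in>{\<sigma>. c \<sigma> \<noteq> 0}.
                 \<Sum>k\<in>{k. k \<le> p \<and> singular_face p k \<sigma> = \<tau>}. (-1)^k * c \<sigma>)"

definition rrelcycle :: "nat \<Rightarrow> 'b topology \<Rightarrow> 'b set \<Rightarrow> ('b ssimplex \<Rightarrow> real) \<Rightarrow> bool" where
  "rrelcycle p Y A c \<longleftrightarrow> rchain p Y c \<and> rchain (p - 1) (subtopology Y A) (rbd p c)"

definition rhomologous :: "nat \<Rightarrow> 'b topology \<Rightarrow> 'b set
      \<Rightarrow> ('b ssimplex \<Rightarrow> real) \<Rightarrow> ('b ssimplex \<Rightarrow> real) \<Rightarrow> bool" where
  "rhomologous p Y A c c' \<longleftrightarrow> (\<exists>b a. rchain (Suc p) Y b \<and> rchain p (subtopology Y A) a \<and>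
       (\<forall>\<sigma>. c \<sigma> - c' \<sigma> = rbd (Suc p) b \<sigma> + a \<sigma>))"

definition l1norm :: "('b ssimplex \<Rightarrow> real) \<Rightarrow> real" where
  "l1norm c = (\<Sum>\<sigma>\<in>{\<sigma>. c \<sigma> \<noteq> 0}. \<bar>c \<sigma>\<bar>)"

definition gromov_norm :: "nat \<Rightarrow> 'b topology \<Rightarrow> 'b set \<Rightarrow> ('b ssimplex \<Rightarrow> real) \<Rightarrow> real" where
  "gromov_norm p Y A z = Inf {l1norm c | c. rrelcycle p Y A c \<and> rhomologous p Y A c z}"

text \<open>A p-cochain is a real function on singular simplices; only its values on singular
 p-simplices of the space matter.\<close>

definition cobd :: "nat \<Rightarrow> ('b ssimplex \<Rightarrow> real) \<Rightarrow> ('b ssimplex \<Rightarrow> real)" where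
  "cobd p \<phi> = (\<lambda>\<sigma>. \<Sum>k\<le>Suc p. (-1)^k * \<phi> (singular_face (Suc p) k \<sigma>))"

definition bounded_cochain :: "nat \<Rightarrow> 'b topology \<Rightarrow> ('b ssimplex \<Rightarrow> real) \<Rightarrow> bool" where
  "bounded_cochain p Y \<phi> \<longleftrightarrow> (\<exists>B. \<forall>\<sigma>. singular_simplex p Y \<sigma> \<longrightarrow> \<bar>\<phi> \<sigma>\<bar> \<le> B)"

definition bcocycle :: "nat \<Rightarrow> 'b topology \<Rightarrow> 'b set \<Rightarrow> ('b ssimplex \<Rightarrow> real) \<Rightarrow> bool" where
  "bcocycle p Y A \<psi> \<longleftrightarrow> bounded_cochain p Y \<psi> \<and>
      (\<forall>\<sigma>. singular_simplex p (subtopology Y A) \<sigma> \<longrightarrow> \<psi> \<sigma> = 0) \<and>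
      (\<forall>\<sigma>. singular_simplex (Suc p) Y \<sigma> \<longrightarrow> cobd p \<psi> \<sigma> = 0)"

definition bcohomologous :: "nat \<Rightarrow> 'b topology \<Rightarrow> 'b set
      \<Rightarrow> ('b ssimplex \<Rightarrow> real) \<Rightarrow> ('b ssimplex \<Rightarrow> real) \<Rightarrow> bool" where
  "bcohomologous p Y A \<psi> \<psi>' \<longleftrightarrow> (\<exists>\<phi>. bounded_cochain (p - 1) Y \<phi> \<and>
      (\<forall>\<sigma>. singular_simplex (p - 1) (subtopology Y A) \<sigma> \<longrightarrow> \<phi> \<sigma> = 0) \<and>
      (\<forall>\<sigma>. singular_simplex p Y \<sigma> \<longrightarrow> \<psi> \<sigma> - \<psi>' \<sigma> = cobd (p - 1) \<phi> \<sigma>))"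

definition binfnorm :: "nat \<Rightarrow> 'b topology \<Rightarrow> ('b ssimplex \<Rightarrow> real) \<Rightarrow> real" where
  "binfnorm p Y \<psi> = Inf {(SUP \<sigma>\<in>singular_simplex_set p Y. \<bar>\<psi>' \<sigma>\<bar>) | \<psi>'.
        bcocycle p Y {} \<psi>' \<and> bcohomologous p Y {} \<psi> \<psi>'}"

definition pullback :: "nat \<Rightarrow> ('c \<Rightarrow> 'b) \<Rightarrow> ('b ssimplex \<Rightarrow> real) \<Rightarrow> ('c ssimplex \<Rightarrow> real)" where
  "pullback p f \<psi> = (\<lambda>\<sigma>. \<psi> (simplex_map p f \<sigma>))"

definition kronecker :: "('b ssimplex \<Rightarrow> real) \<Rightarrow> ('b ssimplex \<Rightarrow> real) \<Rightarrow> real" where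
  "kronecker z \<psi> = (\<Sum>\<sigma>\<in>{\<sigma>. z \<sigma> \<noteq> 0}. z \<sigma> * \<psi> \<sigma>)"

text \<open>Pairing of the class of a bounded cocycle psi on X with the relative class of z in
 (Y,A), transported through H_b(Y,A) = H_b(Y) = H_b(X), the second isomorphism
 induced by the inclusion iota : X -> Y: pick a relative bounded cocycle psi' on (Y,A)
 whose restriction to X is cohomologous to psi, and evaluate it on z.\<close>
definition transported_pairing :: "nat \<Rightarrow> 'b topology \<Rightarrow> 'b set \<Rightarrow> ('c \<Rightarrow> 'b) \<Rightarrow> 'c topology
      \<Rightarrow> ('c ssimplex \<Rightarrow> real) \<Rightarrow> ('b ssimplex \<Rightarrow> real) \<Rightarrow> real" where
  "transported_pairing p Y A \<iota> X \<psi> z = (THE r. \<exists>\<psi>'. bcocycle p Y A \<psi>' \<and>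
       bcohomologous p X {} (pullback p \<iota> \<psi>') \<psi> \<and> r = kronecker z \<psi>')"

end

theory Submission
  imports Defs "HOL-Analysis.Finite_Function_Topology" "HOL-Complex_Analysis.Great_Picard"
begin

text \<open>
  Write \<open>(Y, A)\<close> for the mapping cylinder and its free end. By Hahn--Banach the seminorm of a
  relative class is attained by a relative cocycle on \<open>(Y, A)\<close> bounded by \<open>1\<close>, and restricting it to
  \<open>X\<close> bounds the norm from above by the supremum. Conversely, let \<open>\<psi>\<close> be a relative cocycle that
  differs from a cocycle bounded by \<open>C\<close> by the coboundary of a bounded cochain \<open>\<phi>\<close>; the claim is
  \<open>\<bar>\<langle>\<psi>, z\<rangle>\<bar> \<le> C \<parallel>z\<parallel>\<close>. Every vertex of \<open>z\<close> on a boundary circle is slid around its circle a number of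
  times chosen independently and uniformly in \<open>{0..<N}\<close>, and each simplex inside a circle is
  straightened on the way. This does not change \<open>\<langle>\<psi>, z\<rangle>\<close> and does not increase the norm, while an edge
  of the boundary becomes an average of straight loops whose winding numbers are distributed almost
  independently of the edge. After antisymmetrising under reversal of simplices these averages
  cancel in the limit \<open>N \<rightarrow> \<infinity>\<close>, so \<open>\<phi>\<close> does not contribute. The same straightening, and
  averaging over the integers, gives bounded primitives on the circles, hence the isomorphism
  between relative and absolute bounded cohomology in degree two.
\<close>

section \<open>Real chains and cochains\<close>

lemma kronecker_eq_sum:
  assumes "finite S" "{\<sigma>. c \<sigma> \<noteq> 0} \<subseteq> S"
  shows "kronecker c f = (\<Sum>\<sigma>\<in>S. c \<sigma> * f \<sigma>)"
  unfolding kronecker_def using assms by (intro sum.mono_neutral_left) auto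

lemma kronecker_cong:
  assumes "\<And>\<sigma>. c \<sigma> \<noteq> 0 \<Longrightarrow> f \<sigma> = g \<sigma>"
  shows "kronecker c f = kronecker c g"
  unfolding kronecker_def using assms by (intro sum.cong) auto

lemma kronecker_zero_right: "kronecker c (\<lambda>_. 0) = 0"
  by (simp add: kronecker_def)

lemma kronecker_add_right: "kronecker c (\<lambda>\<sigma>. f \<sigma> + g \<sigma>) = kronecker c f + kronecker c g"
  by (simp add: kronecker_def sum.distrib algebra_simps)

lemma kronecker_diff_right: "kronecker c (\<lambda>\<sigma>. f \<sigma> - g \<sigma>) = kronecker c f - kronecker c g"
  by (simp add: kronecker_def sum_subtractf algebra_simps)

lemma kronecker_add_left:
  assumes "finite {\<sigma>. c \<sigma> \<noteq> 0}" "finite {\<sigma>. d \<sigma> \<noteq> 0}"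
  shows "kronecker (\<lambda>\<sigma>. c \<sigma> + d \<sigma>) f = kronecker c f + kronecker d f"
proof -
  let ?S = "{\<sigma>. c \<sigma> \<noteq> 0} \<union> {\<sigma>. d \<sigma> \<noteq> 0}"
  have S: "finite ?S" using assms by simp
  have "kronecker (\<lambda>\<sigma>. c \<sigma> + d \<sigma>) f = (\<Sum>\<sigma>\<in>?S. (c \<sigma> + d \<sigma>) * f \<sigma>)"
    by (rule kronecker_eq_sum [OF S]) auto
  also have "\<dots> = (\<Sum>\<sigma>\<in>?S. c \<sigma> * f \<sigma>) + (\<Sum>\<sigma>\<in>?S. d \<sigma> * f \<sigma>)"
    by (simp only: distrib_right sum.distrib)
  also have "\<dots> = kronecker c f + kronecker d f"
    using kronecker_eq_sum [OF S, of c f] kronecker_eq_sum [OF S, of d f] by simp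
  finally show ?thesis .
qed

lemma kronecker_indicator:
  assumes "finite {\<sigma>. c \<sigma> \<noteq> 0}"
  shows "kronecker c (\<lambda>\<tau>. if \<tau> = \<sigma> then 1 else 0) = c \<sigma>"
  using kronecker_eq_sum [of "insert \<sigma> {\<sigma>. c \<sigma> \<noteq> 0}" c "\<lambda>\<tau>. if \<tau> = \<sigma> then 1 else 0", OF _ subset_insertI] assms
  by (simp add: if_distrib [of "\<lambda>x. _ * x"] cong: if_cong)

lemma abs_kronecker_le:
  assumes "\<And>\<sigma>. c \<sigma> \<noteq> 0 \<Longrightarrow> \<bar>f \<sigma>\<bar> \<le> C"
  shows "\<bar>kronecker c f\<bar> \<le> C * l1norm c"
proof -
  have "\<bar>kronecker c f\<bar> \<le> (\<Sum>\<sigma> | c \<sigma> \<noteq> 0. \<bar>c \<sigma> * f \<sigma>\<bar>)"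
    unfolding kronecker_def by (rule sum_abs)
  also have "\<dots> \<le> (\<Sum>\<sigma> | c \<sigma> \<noteq> 0. C * \<bar>c \<sigma>\<bar>)"
    using assms by (intro sum_mono) (auto simp: abs_mult mult.commute intro!: mult_right_mono)
  finally show ?thesis by (simp add: l1norm_def sum_distrib_left)
qed

lemma tendsto_kronecker:
  assumes "\<And>\<sigma>. c \<sigma> \<noteq> 0 \<Longrightarrow> ((\<lambda>n. f n \<sigma>) \<longlongrightarrow> g \<sigma>) F"
  shows "((\<lambda>n. kronecker c (f n)) \<longlongrightarrow> kronecker c g) F"
  unfolding kronecker_def using assms by (intro tendsto_sum tendsto_mult_left) auto

lemma rbd_support:
  "{\<tau>. rbd p c \<tau> \<noteq> 0} \<subseteq> (\<Union>\<sigma>\<in>{\<sigma>. c \<sigma> \<noteq> 0}. (\<lambda>k. singular_face p k \<sigma>) ` {..p})"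
proof
  fix \<tau> assume "\<tau> \<in> {\<tau>. rbd p c \<tau> \<noteq> 0}"
  then have "(\<Sum>\<sigma>\<in>{\<sigma>. c \<sigma> \<noteq> 0}. \<Sum>k | k \<le> p \<and> singular_face p k \<sigma> = \<tau>. (-1)^k * c \<sigma>) \<noteq> 0"
    by (simp add: rbd_def)
  then obtain \<sigma> where "\<sigma> \<in> {\<sigma>. c \<sigma> \<noteq> 0}"
    "(\<Sum>k | k \<le> p \<and> singular_face p k \<sigma> = \<tau>. (-1)^k * c \<sigma>) \<noteq> 0"
    by (rule sum.not_neutral_contains_not_neutral)
  moreover from this(2) obtain k where "k \<in> {k. k \<le> p \<and> singular_face p k \<sigma> = \<tau>}"
    by (rule sum.not_neutral_contains_not_neutral)
  ultimately show "\<tau> \<in> (\<Union>\<sigma>\<in>{\<sigma>. c \<sigma> \<noteq> 0}. (\<lambda>k. singular_face p k \<sigma>) ` {..p})" by auto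
qed

lemma finite_rbd_support: "finite {\<sigma>. c \<sigma> \<noteq> 0} \<Longrightarrow> finite {\<tau>. rbd p c \<tau> \<noteq> 0}"
  by (rule finite_subset [OF rbd_support]) auto

lemma singular_simplex_face:
  "\<lbrakk>singular_simplex (Suc p) Y \<sigma>; k \<le> Suc p\<rbrakk> \<Longrightarrow> singular_simplex p Y (singular_face (Suc p) k \<sigma>)"
  using singular_simplex_singular_face [of "Suc p" Y \<sigma> k] by simp

lemma rchain_rbd:
  assumes "rchain (Suc p) Y c"
  shows "rchain p Y (rbd (Suc p) c)"
proof -
  have "singular_simplex p Y \<tau>" if "rbd (Suc p) c \<tau> \<noteq> 0" for \<tau>
    using rbd_support [of "Suc p" c] that assms singular_simplex_face
    by (fastforce simp: rchain_def)
  then show ?thesis using assms by (auto simp: rchain_def intro!: finite_rbd_support)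
qed

lemma kronecker_rbd:
  assumes fin: "finite {\<sigma>. c \<sigma> \<noteq> 0}"
  shows "kronecker (rbd (Suc p) c) f = kronecker c (cobd p f)"
proof -
  let ?S = "{\<sigma>. c \<sigma> \<noteq> 0}"
  let ?T = "\<Union>\<sigma>\<in>?S. (\<lambda>k. singular_face (Suc p) k \<sigma>) ` {..Suc p}"
  have T: "finite ?T" using fin by auto
  have "kronecker (rbd (Suc p) c) f = (\<Sum>\<tau>\<in>?T. rbd (Suc p) c \<tau> * f \<tau>)"
    by (rule kronecker_eq_sum [OF T rbd_support])
  also have "\<dots> = (\<Sum>\<tau>\<in>?T. \<Sum>\<sigma>\<in>?S. \<Sum>k | k \<le> Suc p \<and> singular_face (Suc p) k \<sigma> = \<tau>.
                      (-1)^k * c \<sigma> * f (singular_face (Suc p) k \<sigma>))"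
    by (simp add: rbd_def sum_distrib_right)
  also have "\<dots> = (\<Sum>\<sigma>\<in>?S. \<Sum>\<tau>\<in>?T. \<Sum>k | k \<in> {..Suc p} \<and> singular_face (Suc p) k \<sigma> = \<tau>.
                      (-1)^k * c \<sigma> * f (singular_face (Suc p) k \<sigma>))"
    by (subst sum.swap) simp
  also have "\<dots> = (\<Sum>\<sigma>\<in>?S. \<Sum>k\<le>Suc p. (-1)^k * c \<sigma> * f (singular_face (Suc p) k \<sigma>))"
  proof (rule sum.cong [OF refl])
    fix \<sigma> assume "\<sigma> \<in> ?S"
    then show "(\<Sum>\<tau>\<in>?T. \<Sum>k | k \<in> {..Suc p} \<and> singular_face (Suc p) k \<sigma> = \<tau>.
                      (-1)^k * c \<sigma> * f (singular_face (Suc p) k \<sigma>))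
        = (\<Sum>k\<le>Suc p. (-1)^k * c \<sigma> * f (singular_face (Suc p) k \<sigma>))"
      by (intro sum.group T) auto
  qed
  also have "\<dots> = kronecker c (cobd p f)"
    by (simp add: kronecker_def cobd_def sum_distrib_left mult_ac del: sum.atMost_Suc)
  finally show ?thesis .
qed

lemma rbd_eq_kronecker:
  assumes "finite {\<sigma>. c \<sigma> \<noteq> 0}"
  shows "rbd (Suc p) c \<tau> = kronecker c (cobd p (\<lambda>\<rho>. if \<rho> = \<tau> then 1 else 0))"
  using kronecker_indicator [OF finite_rbd_support [OF assms]] kronecker_rbd [OF assms] by metis

lemma simplical_face_simplical_face:
  "j < k \<Longrightarrow> simplical_face k (simplical_face j x) = simplical_face j (simplical_face (k - 1) x)"
proof
  fix i assume "j < k"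
  consider "i < j" | "i = j" | "j < i" "i < k" | "i = k" | "k < i" by linarith
  then show "simplical_face k (simplical_face j x) i = simplical_face j (simplical_face (k - 1) x) i"
    using \<open>j < k\<close> by cases (auto simp: simplical_face_def)
qed

lemma simplical_face_in_simplex:
  "\<lbrakk>x \<in> standard_simplex p; k \<le> Suc p\<rbrakk> \<Longrightarrow> simplical_face k x \<in> standard_simplex (Suc p)"
  using simplical_face_in_standard_simplex [of "Suc p" k x] by simp

lemma singular_face_apply:
  "x \<in> standard_simplex p \<Longrightarrow> singular_face (Suc p) k \<sigma> x = \<sigma> (simplical_face k x)"
  by (simp add: singular_face_def)

lemma singular_face_singular_face:
  assumes "j < k" "k \<le> Suc (Suc p)"
  shows "singular_face (Suc p) j (singular_face (Suc (Suc p)) k \<sigma>)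
       = singular_face (Suc p) (k - 1) (singular_face (Suc (Suc p)) j \<sigma>)"
proof
  fix x
  have "simplical_face j x \<in> standard_simplex (Suc p)" "simplical_face (k - 1) x \<in> standard_simplex (Suc p)"
    if "x \<in> standard_simplex p"
    using assms that by (auto intro: simplical_face_in_simplex)
  then show "singular_face (Suc p) j (singular_face (Suc (Suc p)) k \<sigma>) x
      = singular_face (Suc p) (k - 1) (singular_face (Suc (Suc p)) j \<sigma>) x"
    using simplical_face_simplical_face [OF assms(1), of x]
    by (simp add: singular_face_def restrict_def del: One_nat_def)
qed

lemma cobd_cobd: "cobd (Suc p) (cobd p f) \<sigma> = 0"
proof -
  define F where "F = (\<lambda>(k, j). (-1) ^ (k + j) * f (singular_face (Suc p) j (singular_face (Suc (Suc p)) k \<sigma>)))"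
  define L where "L = {(k, j). k \<le> Suc (Suc p) \<and> j \<le> Suc p \<and> j < k}"
  define R where "R = {(k, j). k \<le> Suc (Suc p) \<and> j \<le> Suc p \<and> k \<le> j}"
  have LR: "{..Suc (Suc p)} \<times> {..Suc p} = L \<union> R" "L \<inter> R = {}" by (auto simp: L_def R_def)
  then have fin: "finite L" "finite R" by (metis finite_Un finite_SigmaI finite_atMost)+
  have "sum F L = (\<Sum>w\<in>R. - F w)"
  proof (rule sum.reindex_bij_witness [where i = "\<lambda>(k, j). (Suc j, k)" and j = "\<lambda>(k, j). (j, k - 1)"])
    fix w assume "w \<in> L"
    then obtain k j where w: "w = (k, j)" "j < k" "k \<le> Suc (Suc p)" by (auto simp: L_def)
    have "(-1 :: real) ^ (j + (k - 1)) = - ((-1) ^ (k + j))"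
      using w(2) by (cases k) (simp_all add: add.commute)
    then show "- F (case w of (k, j) \<Rightarrow> (j, k - 1)) = F w"
      unfolding w(1) F_def prod.case singular_face_singular_face [OF w(2,3)] by simp
  qed (auto simp: L_def R_def)
  moreover have "cobd (Suc p) (cobd p f) \<sigma> = sum F ({..Suc (Suc p)} \<times> {..Suc p})"
    unfolding cobd_def F_def sum.cartesian_product [symmetric]
    by (intro sum.cong refl) (simp add: sum_distrib_left power_add mult.assoc del: sum.atMost_Suc)
  ultimately show ?thesis
    unfolding LR(1) sum.union_disjoint [OF fin LR(2)] by (simp add: sum_negf)
qed

lemma rbd_rbd:
  assumes "finite {\<sigma>. c \<sigma> \<noteq> 0}"
  shows "rbd (Suc p) (rbd (Suc (Suc p)) c) \<tau> = 0"
  unfolding rbd_eq_kronecker [OF finite_rbd_support [OF assms]] kronecker_rbd [OF assms]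
  by (simp add: kronecker_def cobd_cobd)

lemma rchain_zero: "rchain p Y (\<lambda>_. 0)"
  by (simp add: rchain_def)

lemma rchain_scale: "rchain p Y c \<Longrightarrow> rchain p Y (\<lambda>\<sigma>. r * c \<sigma>)"
  by (cases "r = 0") (simp_all add: rchain_def)

lemma rchain_add:
  assumes "rchain p Y c" "rchain p Y d"
  shows "rchain p Y (\<lambda>\<sigma>. c \<sigma> + d \<sigma>)"
proof -
  have "finite ({\<sigma>. c \<sigma> \<noteq> 0} \<union> {\<sigma>. d \<sigma> \<noteq> 0})" using assms by (simp add: rchain_def)
  then have "finite {\<sigma>. c \<sigma> + d \<sigma> \<noteq> 0}" by (rule finite_subset [rotated]) auto
  moreover have "singular_simplex p Y \<sigma>" if "c \<sigma> + d \<sigma> \<noteq> 0" for \<sigma>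
    using assms that unfolding rchain_def by (metis add_0)
  ultimately show ?thesis by (simp add: rchain_def)
qed

lemma rchain_subtopology: "rchain p (subtopology Y A) c \<Longrightarrow> rchain p Y c"
  by (simp add: rchain_def singular_simplex_subtopology)

lemma rbd_zero: "rbd p (\<lambda>_. 0) \<tau> = 0"
  by (simp add: rbd_def)

lemma rbd_add:
  assumes "rchain q Y c" "rchain q Y d"
  shows "rbd (Suc p) (\<lambda>\<sigma>. c \<sigma> + d \<sigma>) \<tau> = rbd (Suc p) c \<tau> + rbd (Suc p) d \<tau>"
proof -
  have fin: "finite {\<sigma>. c \<sigma> \<noteq> 0}" "finite {\<sigma>. d \<sigma> \<noteq> 0}" "finite {\<sigma>. c \<sigma> + d \<sigma> \<noteq> 0}"
    using assms rchain_add [OF assms] by (simp_all add: rchain_def)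
  show ?thesis
    unfolding rbd_eq_kronecker [OF fin(1)] rbd_eq_kronecker [OF fin(2)] rbd_eq_kronecker [OF fin(3)]
    by (rule kronecker_add_left [OF fin(1,2)])
qed

lemma rbd_scale: "rbd p (\<lambda>\<sigma>. r * c \<sigma>) \<tau> = r * rbd p c \<tau>"
  by (cases "r = 0") (simp_all add: rbd_def sum_distrib_left mult_ac)

lemma rhomologous_refl: "rhomologous p Y A c c"
  unfolding rhomologous_def by (intro exI [of _ "\<lambda>_. 0"]) (simp add: rchain_zero rbd_zero)

lemma rrelcycle_homologous:
  assumes z: "rrelcycle (Suc p) Y A z" and h: "rhomologous (Suc p) Y A c z"
  shows "rrelcycle (Suc p) Y A c"
proof -
  obtain b a where b: "rchain (Suc (Suc p)) Y b" and a: "rchain (Suc p) (subtopology Y A) a"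
    and "\<And>\<sigma>. c \<sigma> - z \<sigma> = rbd (Suc (Suc p)) b \<sigma> + a \<sigma>"
    using h by (auto simp: rhomologous_def)
  then have c: "c = (\<lambda>\<sigma>. z \<sigma> + (rbd (Suc (Suc p)) b \<sigma> + a \<sigma>))"
    by (simp add: fun_eq_iff diff_eq_eq add.commute)
  have zc: "rchain (Suc p) Y z" and dz: "rchain p (subtopology Y A) (rbd (Suc p) z)"
    using z by (simp_all add: rrelcycle_def)
  note db = rchain_rbd [OF b] and aY = rchain_subtopology [OF a]
  have "rbd (Suc p) c = (\<lambda>\<tau>. rbd (Suc p) z \<tau> + rbd (Suc p) a \<tau>)"
    using b unfolding c rbd_add [OF zc rchain_add [OF db aY]] rbd_add [OF db aY]
    by (simp add: rbd_rbd rchain_def)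
  moreover have "rchain (Suc p) Y c" unfolding c by (intro rchain_add zc db aY)
  ultimately show ?thesis by (simp add: rrelcycle_def rchain_add dz rchain_rbd [OF a])
qed

definition cochain_bound :: "nat \<Rightarrow> 'b topology \<Rightarrow> ('b ssimplex \<Rightarrow> real) \<Rightarrow> real \<Rightarrow> bool" where
  "cochain_bound p Y \<phi> B \<longleftrightarrow> (\<forall>\<sigma>. singular_simplex p Y \<sigma> \<longrightarrow> \<bar>\<phi> \<sigma>\<bar> \<le> B)"

definition vanishing_cochain :: "nat \<Rightarrow> 'b topology \<Rightarrow> ('b ssimplex \<Rightarrow> real) \<Rightarrow> bool" where
  "vanishing_cochain p Y \<phi> \<longleftrightarrow> (\<forall>\<sigma>. singular_simplex p Y \<sigma> \<longrightarrow> \<phi> \<sigma> = 0)"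

definition cocycle :: "nat \<Rightarrow> 'b topology \<Rightarrow> ('b ssimplex \<Rightarrow> real) \<Rightarrow> bool" where
  "cocycle p Y \<psi> \<longleftrightarrow> vanishing_cochain (Suc p) Y (cobd p \<psi>)"

lemma cochain_boundD: "\<lbrakk>cochain_bound p Y \<phi> B; singular_simplex p Y \<sigma>\<rbrakk> \<Longrightarrow> \<bar>\<phi> \<sigma>\<bar> \<le> B"
  by (simp add: cochain_bound_def)

lemma vanishing_cochainD: "\<lbrakk>vanishing_cochain p Y \<phi>; singular_simplex p Y \<sigma>\<rbrakk> \<Longrightarrow> \<phi> \<sigma> = 0"
  by (simp add: vanishing_cochain_def)

lemma cocycleD: "\<lbrakk>cocycle p Y \<psi>; singular_simplex (Suc p) Y \<sigma>\<rbrakk> \<Longrightarrow> cobd p \<psi> \<sigma> = 0"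
  by (simp add: cocycle_def vanishing_cochain_def)

lemma bounded_cochain_iff: "bounded_cochain p Y \<phi> \<longleftrightarrow> (\<exists>B. cochain_bound p Y \<phi> B)"
  by (simp add: bounded_cochain_def cochain_bound_def)

lemma bcocycle_iff:
  "bcocycle p Y A \<psi> \<longleftrightarrow> bounded_cochain p Y \<psi> \<and> vanishing_cochain p (subtopology Y A) \<psi> \<and> cocycle p Y \<psi>"
  by (simp add: bcocycle_def vanishing_cochain_def cocycle_def)

lemma kronecker_cobd_vanishing:
  assumes z: "rrelcycle (Suc p) Y A z" and f: "vanishing_cochain p (subtopology Y A) f"
  shows "kronecker z (cobd p f) = 0"
proof -
  have "kronecker z (cobd p f) = kronecker (rbd (Suc p) z) f"
    using kronecker_rbd [of z p f] z by (simp add: rrelcycle_def rchain_def)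
  also have "\<dots> = kronecker (rbd (Suc p) z) (\<lambda>_. 0)"
    using z f by (intro kronecker_cong) (auto simp: rrelcycle_def rchain_def vanishing_cochain_def)
  finally show ?thesis by (simp only: kronecker_zero_right)
qed

lemma kronecker_bcocycle_homologous:
  assumes \<psi>: "bcocycle p Y A \<psi>" and z: "rchain p Y z" and h: "rhomologous p Y A c z"
  shows "kronecker c \<psi> = kronecker z \<psi>"
proof -
  obtain b a where b: "rchain (Suc p) Y b" and a: "rchain p (subtopology Y A) a"
    and "\<And>\<sigma>. c \<sigma> - z \<sigma> = rbd (Suc p) b \<sigma> + a \<sigma>"
    using h by (auto simp: rhomologous_def)
  then have c: "c = (\<lambda>\<sigma>. z \<sigma> + (rbd (Suc p) b \<sigma> + a \<sigma>))"
    by (simp add: fun_eq_iff diff_eq_eq add.commute)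
  note chains = z rchain_rbd [OF b] rchain_subtopology [OF a] rchain_add [OF rchain_rbd [OF b] rchain_subtopology [OF a]]
  have "kronecker c \<psi> = kronecker z \<psi> + (kronecker (rbd (Suc p) b) \<psi> + kronecker a \<psi>)"
    using chains unfolding c by (simp add: kronecker_add_left rchain_def)
  moreover have "kronecker (rbd (Suc p) b) \<psi> = kronecker b (\<lambda>_. 0)"
    using b \<psi> by (subst kronecker_rbd) (auto simp: rchain_def bcocycle_def intro!: kronecker_cong)
  moreover have "kronecker a \<psi> = kronecker a (\<lambda>_. 0)"
    using a \<psi> by (intro kronecker_cong) (auto simp: rchain_def bcocycle_def)
  ultimately show ?thesis by (simp only: kronecker_zero_right add_0_right)
qed

lemma cobd_1: "cobd 1 f \<sigma> = f (singular_face 2 0 \<sigma>) - f (singular_face 2 1 \<sigma>) + f (singular_face 2 2 \<sigma>)"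
  by (simp add: cobd_def numeral_2_eq_2)

lemma cobd_2: "cobd 2 f \<sigma> = f (singular_face 3 0 \<sigma>) - f (singular_face 3 1 \<sigma>)
    + f (singular_face 3 2 \<sigma>) - f (singular_face 3 3 \<sigma>)"
  by (simp add: cobd_def numeral_2_eq_2 numeral_3_eq_3)

lemma cobd_add: "cobd p (\<lambda>\<sigma>. f \<sigma> + g \<sigma>) \<sigma> = cobd p f \<sigma> + cobd p g \<sigma>"
  by (simp add: cobd_def sum.distrib distrib_left del: sum.atMost_Suc)

lemma cobd_diff: "cobd p (\<lambda>\<sigma>. f \<sigma> - g \<sigma>) \<sigma> = cobd p f \<sigma> - cobd p g \<sigma>"
  by (simp add: cobd_def sum_subtractf right_diff_distrib del: sum.atMost_Suc)

section \<open>Affine simplices in prisms\<close>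

lemma singular_simplex_iff_top_of_set:
  "singular_simplex p Y \<sigma> \<longleftrightarrow>
     continuous_map (top_of_set (standard_simplex p)) Y \<sigma> \<and> \<sigma> \<in> extensional (standard_simplex p)"
  by (simp add: singular_simplex_def euclidean_product_topology)

lemma continuous_map_compose_on:
  assumes "continuous_map (top_of_set T) Y g" "continuous_on S f" "f \<in> S \<rightarrow> T"
  shows "continuous_map (top_of_set S) Y (\<lambda>x. g (f x))"
  using continuous_map_compose [of "top_of_set S" "top_of_set T" f Y g] assms by (simp add: o_def)

lemmas continuous_on_coordinate = continuous_on_product_then_coordinatewise

lemma standard_simplex_iff:
  "x \<in> standard_simplex p \<longleftrightarrow> (\<forall>i. 0 \<le> x i) \<and> (\<forall>i>p. x i = 0) \<and> (\<Sum>i\<le>p. x i) = 1"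
proof -
  have "x i \<le> 1" if nonneg: "\<forall>i. 0 \<le> x i" and zero: "\<forall>i>p. x i = 0" and sum: "(\<Sum>i\<le>p. x i) = 1" for i
  proof (cases "i \<le> p")
    case True
    then show ?thesis using member_le_sum [of i "{..p}" x] nonneg sum by simp
  qed (use zero in auto)
  then show ?thesis by (auto simp: standard_simplex_def)
qed

definition skip :: "nat \<Rightarrow> nat \<Rightarrow> nat" where
  "skip k j = (if j < k then j else Suc j)"

definition omit :: "nat \<Rightarrow> 'x list \<Rightarrow> 'x list" where
  "omit k xs = take k xs @ drop (Suc k) xs"

lemma omit_Cons [simp]: "omit 0 (x # xs) = xs" "omit (Suc k) (x # xs) = x # omit k xs"
  by (simp_all add: omit_def)

lemma length_omit: "k < length xs \<Longrightarrow> length (omit k xs) = length xs - 1"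
  by (simp add: omit_def)

lemma nth_omit: "k < length xs \<Longrightarrow> j < length xs - 1 \<Longrightarrow> omit k xs ! j = xs ! skip k j"
  by (auto simp: omit_def skip_def nth_append min_def)

lemma omit_omit:
  "\<lbrakk>j < k; k < length xs\<rbrakk> \<Longrightarrow> omit j (omit k xs) = omit (k - 1) (omit j xs)"
  by (rule nth_equalityI) (auto simp: length_omit nth_omit skip_def)

lemma sum_simplical_face:
  fixes a :: "nat \<Rightarrow> real"
  assumes "k \<le> Suc p"
  shows "(\<Sum>j\<le>Suc p. a j * simplical_face k y j) = (\<Sum>j\<le>p. a (skip k j) * y j)"
proof -
  have "(\<Sum>j\<le>Suc p. a j * simplical_face k y j) = (\<Sum>j\<in>{..Suc p} - {k}. a j * simplical_face k y j)"
    using assms by (subst sum.remove [of _ k]) (auto simp: simplical_face_def)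
  also have "\<dots> = (\<Sum>j\<le>p. a (skip k j) * y j)"
    using assms
    by (intro sum.reindex_bij_witness [where i = "skip k" and j = "\<lambda>j. if j < k then j else j - 1"])
      (auto simp: simplical_face_def skip_def)
  finally show ?thesis .
qed

text \<open>An entry \<open>(l, t)\<close> of the list \<open>vs\<close> stands for the point at height \<open>t\<close> over the \<open>l\<close>-th vertex of
  the standard simplex; the list spans an affine simplex in the product of the standard simplex
  with the line, and \<open>prism_simplex\<close> composes it with \<open>G\<close>.\<close>

definition prism_base :: "(nat \<times> real) list \<Rightarrow> (nat \<Rightarrow> real) \<Rightarrow> nat \<Rightarrow> real" where
  "prism_base vs y = (\<lambda>l. \<Sum>j<length vs. of_bool (fst (vs ! j) = l) * y j)"

definition prism_height :: "(nat \<times> real) list \<Rightarrow> (nat \<Rightarrow> real) \<Rightarrow> real" where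
  "prism_height vs y = (\<Sum>j<length vs. snd (vs ! j) * y j)"

definition prism_simplex :: "(nat \<times> real) list \<Rightarrow> ((nat \<Rightarrow> real) \<Rightarrow> real \<Rightarrow> 'b) \<Rightarrow> 'b ssimplex" where
  "prism_simplex vs G = restrict (\<lambda>y. G (prism_base vs y) (prism_height vs y)) (standard_simplex (length vs - 1))"

abbreviation simplex_homotopy :: "nat \<Rightarrow> 'b topology \<Rightarrow> ((nat \<Rightarrow> real) \<Rightarrow> real \<Rightarrow> 'b) \<Rightarrow> bool" where
  "simplex_homotopy p Y G \<equiv> continuous_map (top_of_set (standard_simplex p \<times> {0..1})) Y (case_prod G)"

lemma sum_standard_simplex:
  assumes "y \<in> standard_simplex (length vs - 1)" "vs \<noteq> []"
  shows "(\<Sum>j<length vs. y j) = 1"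
proof -
  have "{..<length vs} = {..length vs - 1}" using assms(2) by (cases vs) auto
  then show ?thesis using assms(1) by (simp add: standard_simplex_def)
qed

lemma prism_base_in_simplex:
  assumes vs: "fst ` set vs \<subseteq> {..q}" "vs \<noteq> []" and y: "y \<in> standard_simplex (length vs - 1)"
  shows "prism_base vs y \<in> standard_simplex q"
proof -
  have fst_le: "fst (vs ! j) \<le> q" if "j < length vs" for j
    using vs(1) nth_mem [OF that] by auto
  have "(\<Sum>i\<le>q. prism_base vs y i) = (\<Sum>j<length vs. \<Sum>i\<le>q. of_bool (fst (vs ! j) = i) * y j)"
    unfolding prism_base_def by (rule sum.swap)
  also have "\<dots> = (\<Sum>j<length vs. y j)"
    using fst_le by (intro sum.cong refl) (simp flip: sum_distrib_right)
  finally have "(\<Sum>i\<le>q. prism_base vs y i) = 1" using sum_standard_simplex [OF y vs(2)] by simp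
  moreover have "prism_base vs y i = 0" if "q < i" for i
    using fst_le that by (fastforce simp: prism_base_def intro!: sum.neutral)
  moreover have "0 \<le> prism_base vs y i" for i
    using y by (auto simp: prism_base_def standard_simplex_iff intro!: sum_nonneg)
  ultimately show ?thesis by (simp add: standard_simplex_iff)
qed

lemma prism_height_in_convex:
  assumes "convex T" "snd ` set vs \<subseteq> T" "vs \<noteq> []" and y: "y \<in> standard_simplex (length vs - 1)"
  shows "prism_height vs y \<in> T"
proof -
  have "(\<Sum>j<length vs. y j *\<^sub>R snd (vs ! j)) \<in> T"
    using assms sum_standard_simplex [OF y assms(3)]
    by (intro convex_sum) (auto simp: standard_simplex_iff)
  then show ?thesis by (simp add: prism_height_def mult.commute)
qed

lemma singular_simplex_prism_simplex:
  assumes G: "continuous_map (top_of_set (standard_simplex q \<times> T)) Y (case_prod G)"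
    and T: "convex T" and vs: "fst ` set vs \<subseteq> {..q}" "snd ` set vs \<subseteq> T" "length vs = Suc p"
  shows "singular_simplex p Y (prism_simplex vs G)"
proof -
  have "continuous_map (top_of_set (standard_simplex p)) Y
          (\<lambda>y. case_prod G (prism_base vs y, prism_height vs y))"
  proof (rule continuous_map_compose_on [OF G])
    show "continuous_on (standard_simplex p) (\<lambda>y. (prism_base vs y, prism_height vs y))"
      unfolding prism_base_def prism_height_def
      by (intro continuous_intros continuous_on_coordinate [OF continuous_on_id])
    have "vs \<noteq> []" "length vs - 1 = p" using vs(3) by auto
    then show "(\<lambda>y. (prism_base vs y, prism_height vs y)) \<in> standard_simplex p \<rightarrow> standard_simplex q \<times> T"
      using prism_base_in_simplex [of vs q] prism_height_in_convex [of T vs] T vs by auto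
  qed
  then show ?thesis
    using vs(3) by (simp add: singular_simplex_iff_top_of_set prism_simplex_def)
qed

lemma prism_simplex_cong:
  assumes "\<And>x t. x \<in> standard_simplex q \<Longrightarrow> t \<in> T \<Longrightarrow> G x t = H x t"
    and "convex T" "fst ` set vs \<subseteq> {..q}" "snd ` set vs \<subseteq> T" "vs \<noteq> []"
  shows "prism_simplex vs G = prism_simplex vs H"
  unfolding prism_simplex_def using assms prism_base_in_simplex [of vs q] prism_height_in_convex [of T vs]
  by (intro restrict_ext) auto

lemma singular_face_prism_simplex:
  assumes "length vs = Suc (Suc p)" "k \<le> Suc p"
  shows "singular_face (Suc p) k (prism_simplex vs G) = prism_simplex (omit k vs) G"
proof -
  have len: "length (omit k vs) = Suc p" using assms by (simp add: length_omit)
  have base: "prism_base vs (simplical_face k y) = prism_base (omit k vs) y" for y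
    unfolding prism_base_def len assms(1) lessThan_Suc_atMost sum_simplical_face [OF assms(2)]
    using assms by (intro ext sum.cong) (auto simp: nth_omit)
  have height: "prism_height vs (simplical_face k y) = prism_height (omit k vs) y" for y
    unfolding prism_height_def len assms(1) lessThan_Suc_atMost sum_simplical_face [OF assms(2)]
    using assms by (intro sum.cong) (auto simp: nth_omit)
  show ?thesis
    using assms len simplical_face_in_simplex [of _ p k]
    by (auto simp: singular_face_def prism_simplex_def restrict_def base height)
qed

lemma prism_simplex_face:
  "prism_simplex vs (\<lambda>x t. G (simplical_face k x) t) = prism_simplex (map (\<lambda>(l, t). (skip k l, t)) vs) G"
proof -
  let ?ws = "map (\<lambda>(l, t). (skip k l, t)) vs"
  have "simplical_face k (prism_base vs y) = prism_base ?ws y" for y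
  proof
    fix l
    consider "l < k" | "l = k" | "k < l" by linarith
    then show "simplical_face k (prism_base vs y) l = prism_base ?ws y l"
      by cases (auto simp: simplical_face_def prism_base_def skip_def split_beta intro!: sum.cong sum.neutral
          sum.neutral [symmetric])
  qed
  moreover have "prism_height vs y = prism_height ?ws y" for y
    by (auto simp: prism_height_def split_beta intro!: sum.cong)
  ultimately show ?thesis by (simp add: prism_simplex_def)
qed

lemma prism_simplex_level:
  "prism_simplex (map (\<lambda>l. (l, t)) [0..<Suc p]) G = restrict (\<lambda>x. G x t) (standard_simplex p)"
proof -
  let ?vs = "map (\<lambda>l. (l, t)) [0..<Suc p]"
  have nth: "?vs ! j = (j, t)" if "j \<le> p" for j
    using nth_map_upt [of j "Suc p" 0 "\<lambda>l. (l, t)"] that by simp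
  have "prism_base ?vs y = y" if y: "y \<in> standard_simplex p" for y
  proof
    fix l
    have "prism_base ?vs y l = (\<Sum>j\<le>p. of_bool (j = l) * y j)"
      unfolding prism_base_def length_map length_upt minus_nat.diff_0 lessThan_Suc_atMost
      using nth by (intro sum.cong) auto
    also have "\<dots> = (if l \<le> p then y l else 0)"
      by (simp add: of_bool_def if_distrib [of "\<lambda>r. r * _"] cong: if_cong)
    also have "\<dots> = y l" using y by (simp add: standard_simplex_iff)
    finally show "prism_base ?vs y l = y l" .
  qed
  moreover have "prism_height ?vs y = t" if y: "y \<in> standard_simplex p" for y
  proof -
    have "prism_height ?vs y = (\<Sum>j\<le>p. t * y j)"
      unfolding prism_height_def length_map length_upt minus_nat.diff_0 lessThan_Suc_atMost
      using nth by (intro sum.cong) auto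
    then show ?thesis using y by (simp add: standard_simplex_iff flip: sum_distrib_left)
  qed
  ultimately show ?thesis by (auto simp: prism_simplex_def)
qed

lemma prism_simplex_level_2:
  "prism_simplex [(0, t), (1, t), (2, t)] G = restrict (\<lambda>x. G x t) (standard_simplex 2)"
  using prism_simplex_level [of t 2 G] by (simp add: numeral_2_eq_2)

lemma cobd_1_prism_simplex:
  "cobd 1 \<phi> (prism_simplex [a, b, c] G)
    = \<phi> (prism_simplex [b, c] G) - \<phi> (prism_simplex [a, c] G) + \<phi> (prism_simplex [a, b] G)"
  unfolding cobd_1 using singular_face_prism_simplex [of "[a, b, c]" 1 _ G] by (simp add: numeral_2_eq_2)

lemma cobd_2_prism_simplex:
  "cobd 2 \<psi> (prism_simplex [a, b, c, d] G) = \<psi> (prism_simplex [b, c, d] G) - \<psi> (prism_simplex [a, c, d] G)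
    + \<psi> (prism_simplex [a, b, d] G) - \<psi> (prism_simplex [a, b, c] G)"
  unfolding cobd_2 using singular_face_prism_simplex [of "[a, b, c, d]" 2 _ G]
  by (simp add: numeral_2_eq_2 numeral_3_eq_3)

definition prism_cochain :: "('b ssimplex \<Rightarrow> real) \<Rightarrow> ((nat \<Rightarrow> real) \<Rightarrow> real \<Rightarrow> 'b) \<Rightarrow> real" where
  "prism_cochain \<psi> E = \<psi> (prism_simplex [(0,0), (0,1), (1,1)] E) - \<psi> (prism_simplex [(0,0), (1,0), (1,1)] E)"

lemma prism_cochain_cong:
  assumes "\<And>x t. x \<in> standard_simplex 1 \<Longrightarrow> t \<in> {0..1} \<Longrightarrow> E x t = F x t"
  shows "prism_cochain \<psi> E = prism_cochain \<psi> F"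
proof -
  have "prism_simplex vs E = prism_simplex vs F"
    if "vs = [(0,0), (0,1), (1,1)] \<or> vs = [(0,0), (1,0), (1,1)]" for vs
    using that assms by (intro prism_simplex_cong [of 1 "{0..1}"]) auto
  then show ?thesis by (simp add: prism_cochain_def)
qed

lemma abs_prism_cochain_le:
  assumes "cochain_bound 2 Y \<psi> B" and E: "simplex_homotopy 1 Y E"
  shows "\<bar>prism_cochain \<psi> E\<bar> \<le> 2 * B"
proof -
  have "singular_simplex 2 Y (prism_simplex vs E)"
    if "vs = [(0,0), (0,1), (1,1)] \<or> vs = [(0,0), (1,0), (1,1)]" for vs
    using that by (intro singular_simplex_prism_simplex [OF E]) auto
  then have "\<bar>\<psi> (prism_simplex [(0,0), (0,1), (1,1)] E)\<bar> \<le> B" "\<bar>\<psi> (prism_simplex [(0,0), (1,0), (1,1)] E)\<bar> \<le> B"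
    using cochain_boundD [OF assms(1)] by blast+
  then show ?thesis by (simp add: prism_cochain_def)
qed

lemma prism_identity:
  assumes \<psi>: "cocycle 2 Y \<psi>" and G: "simplex_homotopy 2 Y G"
  shows "\<psi> (restrict (\<lambda>x. G x 1) (standard_simplex 2)) - \<psi> (restrict (\<lambda>x. G x 0) (standard_simplex 2))
     = prism_cochain \<psi> (\<lambda>x t. G (simplical_face 0 x) t)
     - prism_cochain \<psi> (\<lambda>x t. G (simplical_face 1 x) t)
     + prism_cochain \<psi> (\<lambda>x t. G (simplical_face 2 x) t)"
proof -
  have "cobd 2 \<psi> (prism_simplex vs G) = 0" if "set vs \<subseteq> {0,1,2} \<times> {0,1}" "length vs = 4" for vs
    using that by (intro cocycleD [OF \<psi>] singular_simplex_prism_simplex [OF G]) auto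
  from this [of "[(0,0), (0,1), (1,1), (2,1)]"] this [of "[(0,0), (1,0), (1,1), (2,1)]"]
    this [of "[(0,0), (1,0), (2,0), (2,1)]"]
  show ?thesis
    by (simp add: cobd_2_prism_simplex prism_cochain_def prism_simplex_face skip_def Suc_1
        One_nat_def [symmetric] del: One_nat_def flip: prism_simplex_level_2)
qed

section \<open>Reversal of simplices\<close>

definition reindex :: "nat list \<Rightarrow> 'b ssimplex \<Rightarrow> 'b ssimplex" where
  "reindex ls \<sigma> = prism_simplex (map (\<lambda>l. (l, 0)) ls) (\<lambda>x t. \<sigma> x)"

lemma singular_simplex_reindex:
  assumes "singular_simplex q Y \<sigma>" "set ls \<subseteq> {..q}" "length ls = Suc p"
  shows "singular_simplex p Y (reindex ls \<sigma>)"
proof -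
  have "continuous_map (top_of_set (standard_simplex q \<times> {0})) Y (\<lambda>w. \<sigma> (fst w))"
    by (rule continuous_map_compose_on [of "standard_simplex q"])
      (use assms in \<open>auto simp: singular_simplex_iff_top_of_set intro!: continuous_on_fst\<close>)
  then show ?thesis unfolding reindex_def using assms
    by (intro singular_simplex_prism_simplex [of q "{0}"]) (auto simp: split_def)
qed

lemma reindex_face:
  assumes "set ls \<subseteq> {..p}" "ls \<noteq> []"
  shows "reindex ls (singular_face (Suc p) k \<sigma>) = reindex (map (skip k) ls) \<sigma>"
proof -
  have "reindex ls (singular_face (Suc p) k \<sigma>)
      = prism_simplex (map (\<lambda>l. (l, 0)) ls) (\<lambda>x t. \<sigma> (simplical_face k x))"
    unfolding reindex_def
    by (rule prism_simplex_cong [of p "{0}"]) (use assms in \<open>auto simp: singular_face_apply\<close>)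
  also have "\<dots> = reindex (map (skip k) ls) \<sigma>"
    using prism_simplex_face [of "map (\<lambda>l. (l, 0)) ls" "\<lambda>x t. \<sigma> x" k] by (simp add: reindex_def o_def)
  finally show ?thesis .
qed

lemma reindex_face_triangle:
  "\<lbrakk>set ls \<subseteq> {..1}; ls \<noteq> []\<rbrakk> \<Longrightarrow> reindex ls (singular_face 2 k \<sigma>) = reindex (map (skip k) ls) \<sigma>"
  using reindex_face [of ls 1] by (simp add: numeral_2_eq_2)

lemma cobd_1_reindex:
  "cobd 1 \<phi> (reindex [a, b, c] \<sigma>) = \<phi> (reindex [b, c] \<sigma>) - \<phi> (reindex [a, c] \<sigma>) + \<phi> (reindex [a, b] \<sigma>)"
  by (simp add: reindex_def cobd_1_prism_simplex del: One_nat_def)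

lemma cobd_2_reindex:
  "cobd 2 \<psi> (reindex [a, b, c, d] \<sigma>) = \<psi> (reindex [b, c, d] \<sigma>) - \<psi> (reindex [a, c, d] \<sigma>)
      + \<psi> (reindex [a, b, d] \<sigma>) - \<psi> (reindex [a, b, c] \<sigma>)"
  by (simp add: reindex_def cobd_2_prism_simplex)

lemma reindex_id:
  assumes "singular_simplex p Y \<sigma>"
  shows "reindex [0..<Suc p] \<sigma> = \<sigma>"
  unfolding reindex_def prism_simplex_level
  using assms by (simp add: singular_simplex_def extensional_restrict)

abbreviation reverse_edge :: "'b ssimplex \<Rightarrow> 'b ssimplex" where
  "reverse_edge \<equiv> reindex [1, 0]"

abbreviation reverse_triangle :: "'b ssimplex \<Rightarrow> 'b ssimplex" where
  "reverse_triangle \<equiv> reindex [2, 1, 0]"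

lemma singular_simplex_reverse_edge: "singular_simplex 1 Y e \<Longrightarrow> singular_simplex 1 Y (reverse_edge e)"
  by (rule singular_simplex_reindex) auto

lemma singular_simplex_reverse_triangle:
  "singular_simplex 2 Y \<sigma> \<Longrightarrow> singular_simplex 2 Y (reverse_triangle \<sigma>)"
  by (rule singular_simplex_reindex) auto

lemma cobd_1_reverse_triangle: "cobd 1 \<phi> (reverse_triangle \<sigma>) = cobd 1 (\<lambda>e. \<phi> (reverse_edge e)) \<sigma>"
  unfolding cobd_1_reindex cobd_1 [of "\<lambda>e. \<phi> (reverse_edge e)"]
  by (simp add: reindex_face_triangle skip_def Suc_1 One_nat_def [symmetric] del: One_nat_def)

definition reverse_cochain :: "('b ssimplex \<Rightarrow> real) \<Rightarrow> 'b ssimplex \<Rightarrow> real" where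
  "reverse_cochain \<psi> e = \<psi> (reindex [0, 1, 0] e) + \<psi> (reindex [0, 0, 0] e)"

lemma vanishing_reverse_cochain:
  assumes "vanishing_cochain 2 Y \<psi>"
  shows "vanishing_cochain 1 Y (reverse_cochain \<psi>)"
  unfolding vanishing_cochain_def
proof (intro allI impI)
  fix e assume e: "singular_simplex 1 Y e"
  have "\<psi> (reindex ls e) = 0" if "ls = [0, 1, 0] \<or> ls = [0, 0, 0]" for ls
    by (rule vanishing_cochainD [OF assms], rule singular_simplex_reindex [OF e]) (use that in auto)
  then show "reverse_cochain \<psi> e = 0" by (simp add: reverse_cochain_def)
qed

text \<open>The six tetrahedra are the cone from vertex \<open>0\<close> over the cycle whose vanishing is claimed.\<close>

lemma cocycle_reverse_triangle:
  assumes \<psi>: "cocycle 2 Y \<psi>" and \<sigma>: "singular_simplex 2 Y \<sigma>"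
  shows "\<psi> \<sigma> + \<psi> (reverse_triangle \<sigma>) = cobd 1 (reverse_cochain \<psi>) \<sigma>"
proof -
  have vanish: "cobd 2 \<psi> (reindex ls \<sigma>) = 0" if "set ls \<subseteq> {..2}" "length ls = 4" for ls
    using that by (intro cocycleD [OF \<psi>] singular_simplex_reindex [OF \<sigma>]) auto
  have "reindex [0, 1, 2] \<sigma> = \<sigma>" using reindex_id [OF \<sigma>] by (simp add: numeral_2_eq_2)
  moreover have "cobd 1 (reverse_cochain \<psi>) \<sigma> = \<psi> (reindex [1, 2, 1] \<sigma>) + \<psi> (reindex [1, 1, 1] \<sigma>)
     - (\<psi> (reindex [0, 2, 0] \<sigma>) + \<psi> (reindex [0, 0, 0] \<sigma>)) + (\<psi> (reindex [0, 1, 0] \<sigma>) + \<psi> (reindex [0, 0, 0] \<sigma>))"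
    by (simp add: cobd_1 reverse_cochain_def reindex_face_triangle skip_def Suc_1 One_nat_def [symmetric] del: One_nat_def)
  ultimately show ?thesis
    using vanish [of "[0, 2, 1, 0]"] vanish [of "[0, 0, 1, 2]"] vanish [of "[0, 1, 2, 1]"]
      vanish [of "[0, 1, 1, 1]"] vanish [of "[0, 0, 2, 0]"] vanish [of "[0, 0, 1, 0]"]
    by (simp add: cobd_2_reindex del: One_nat_def)
qed

section \<open>Homotopy extension from the boundary of a simplex\<close>

lemma continuous_on_fst_coordinate: "continuous_on S (\<lambda>w :: (nat \<Rightarrow> real) \<times> real. fst w i)"
  by (rule continuous_on_coordinate [OF continuous_on_fst [OF continuous_on_id]])

definition simplex_boundary :: "nat \<Rightarrow> (nat \<Rightarrow> real) set" where
  "simplex_boundary p = {x \<in> standard_simplex p. \<exists>i\<le>p. x i = 0}"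

definition min_coord :: "nat \<Rightarrow> (nat \<Rightarrow> real) \<Rightarrow> real" where
  "min_coord p x = Min (x ` {..p})"

lemma min_coord_le: "i \<le> p \<Longrightarrow> min_coord p x \<le> x i"
  by (simp add: min_coord_def)

lemma min_coord_attained: "\<exists>i\<le>p. min_coord p x = x i"
proof -
  have "min_coord p x \<in> x ` {..p}" unfolding min_coord_def by (rule Min_in) auto
  then show ?thesis by blast
qed

lemma min_coord_nonneg: "x \<in> standard_simplex p \<Longrightarrow> 0 \<le> min_coord p x"
  unfolding min_coord_def by (rule Min.boundedI) (auto simp: standard_simplex_iff)

lemma continuous_on_min_coord: "continuous_on S f \<Longrightarrow> continuous_on S (\<lambda>x. min_coord p (f x))"
proof (induction p)
  case 0
  then show ?case using continuous_on_coordinate by (simp add: min_coord_def)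
next
  case (Suc p)
  have "min_coord (Suc p) x = min (x (Suc p)) (min_coord p x)" for x
    by (simp add: min_coord_def atMost_Suc)
  then show ?case
    using continuous_on_min [OF continuous_on_coordinate [OF Suc.prems, of "Suc p"] Suc.IH [OF Suc.prems]]
    by (simp only:)
qed

text \<open>\<open>simplex_gauge p x\<close> is the Minkowski gauge of the simplex about its barycentre, so that \<open>dilate p s x\<close>, the
  image of \<open>x\<close> under the homothety with factor \<open>s\<close>, lies in the simplex iff \<open>simplex_gauge p x * s \<le> 1\<close>.\<close>

definition simplex_gauge :: "nat \<Rightarrow> (nat \<Rightarrow> real) \<Rightarrow> real" where
  "simplex_gauge p x = 1 - (real p + 1) * min_coord p x"

definition dilate :: "nat \<Rightarrow> real \<Rightarrow> (nat \<Rightarrow> real) \<Rightarrow> nat \<Rightarrow> real" where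
  "dilate p s x i = (if i \<le> p then 1 / (real p + 1) + s * (x i - 1 / (real p + 1)) else 0)"

lemma min_coord_eq_simplex_gauge: "min_coord p x = (1 - simplex_gauge p x) / (real p + 1)"
  by (simp add: simplex_gauge_def)

lemma simplex_gauge_le_1: "x \<in> standard_simplex p \<Longrightarrow> simplex_gauge p x \<le> 1"
  using min_coord_nonneg [of x p] by (simp add: simplex_gauge_def)

lemma simplex_gauge_boundary:
  assumes "x \<in> simplex_boundary p"
  shows "simplex_gauge p x = 1"
proof -
  obtain i where i: "i \<le> p" "x i = 0" and x: "x \<in> standard_simplex p"
    using assms unfolding simplex_boundary_def by blast
  have "min_coord p x = 0"
    using min_coord_le [OF i(1), of x] i(2) min_coord_nonneg [OF x] by linarith
  then show ?thesis by (simp add: simplex_gauge_def)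
qed

lemma continuous_on_simplex_gauge: "continuous_on S f \<Longrightarrow> continuous_on S (\<lambda>w. simplex_gauge p (f w))"
  unfolding simplex_gauge_def by (intro continuous_on_diff continuous_on_mult continuous_on_const continuous_on_min_coord)

lemma continuous_on_if_const:
  "\<lbrakk>P \<Longrightarrow> continuous_on S f; \<not> P \<Longrightarrow> continuous_on S g\<rbrakk>
    \<Longrightarrow> continuous_on S (\<lambda>x. if P then f x else g x)"
  by (cases P) simp_all

lemma continuous_on_dilate:
  assumes "continuous_on S s" "continuous_on S f"
  shows "continuous_on S (\<lambda>w. dilate p (s w) (f w))"
proof (rule continuous_on_coordinatewise_then_product)
  fix i
  have "continuous_on S (\<lambda>w. f w i)" using assms(2) by (rule continuous_on_coordinate)
  then show "continuous_on S (\<lambda>w. dilate p (s w) (f w) i)"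
    unfolding dilate_def
    by (cases "i \<le> p") (simp_all add: continuous_on_add continuous_on_mult continuous_on_diff assms(1))
qed

lemma dilate_1: "x \<in> standard_simplex p \<Longrightarrow> dilate p 1 x = x"
  by (auto simp: dilate_def standard_simplex_iff)

lemma dilate_in_simplex:
  assumes x: "x \<in> standard_simplex p" and s: "0 \<le> s" "simplex_gauge p x * s \<le> 1"
  shows "dilate p s x \<in> standard_simplex p"
proof -
  define b where "b = 1 / (real p + 1)"
  have b: "(real p + 1) * b = 1" "b > 0" by (auto simp: b_def)
  have "0 \<le> dilate p s x i" for i
  proof (cases "i \<le> p")
    case True
    have "x i - b \<ge> - (b * simplex_gauge p x)"
      using min_coord_le [OF True, of x] by (simp add: min_coord_eq_simplex_gauge b_def diff_divide_distrib)
    then have "s * (x i - b) \<ge> s * (- (b * simplex_gauge p x))" using s(1) by (rule mult_left_mono)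
    moreover have "b * (simplex_gauge p x * s) \<le> b * 1" using s(2) b(2) by (intro mult_left_mono) auto
    ultimately show ?thesis using True by (simp add: dilate_def mult_ac flip: b_def)
  qed (simp add: dilate_def)
  moreover have "(\<Sum>i\<le>p. dilate p s x i) = 1"
  proof -
    have "(\<Sum>i\<le>p. x i - b) = 0" using x b(1) by (simp add: sum_subtractf standard_simplex_iff add.commute)
    moreover have "(\<Sum>i\<le>p. dilate p s x i) = (\<Sum>i\<le>p. b + s * (x i - b))"
      by (simp add: dilate_def b_def)
    ultimately show ?thesis using b(1) by (simp add: sum.distrib add.commute flip: sum_distrib_left)
  qed
  ultimately show ?thesis by (simp add: standard_simplex_iff) (simp add: dilate_def)
qed

lemma dilate_in_boundary:
  assumes x: "x \<in> standard_simplex p" and s: "0 \<le> s" "simplex_gauge p x * s = 1"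
  shows "dilate p s x \<in> simplex_boundary p"
proof -
  obtain i where i: "i \<le> p" "min_coord p x = x i" using min_coord_attained by blast
  have "x i - 1 / (real p + 1) = - simplex_gauge p x / (real p + 1)"
    unfolding i(2) [symmetric] min_coord_eq_simplex_gauge by (simp add: diff_divide_distrib)
  then have "dilate p s x i = (1 - simplex_gauge p x * s) / (real p + 1)"
    using i(1) by (simp add: dilate_def diff_divide_distrib)
  then show ?thesis
    using i(1) s dilate_in_simplex [OF x] by (auto simp: simplex_boundary_def)
qed

definition prism_stretch :: "nat \<Rightarrow> (nat \<Rightarrow> real) \<times> real \<Rightarrow> real" where
  "prism_stretch p w = simplex_gauge p (fst w) * (1 + snd w)"

definition project_to_walls :: "nat \<Rightarrow> (nat \<Rightarrow> real) \<times> real \<Rightarrow> (nat \<Rightarrow> real) \<times> real" where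
  "project_to_walls p w = (dilate p (1 / simplex_gauge p (fst w)) (fst w), prism_stretch p w - 1)"

lemma continuous_on_simplex_gauge_fst:
  "continuous_on S (\<lambda>w :: (nat \<Rightarrow> real) \<times> real. simplex_gauge p (fst w))"
  by (intro continuous_on_simplex_gauge continuous_on_fst continuous_on_id)

lemma continuous_on_prism_stretch: "continuous_on S (prism_stretch p)"
  unfolding prism_stretch_def [abs_def]
  by (intro continuous_on_mult continuous_on_add continuous_on_const continuous_on_snd continuous_on_id
      continuous_on_simplex_gauge_fst)

lemma prism_stretch_le_2:
  assumes "w \<in> standard_simplex p \<times> {0..1}"
  shows "prism_stretch p w \<le> 2"
  using mult_mono [of "simplex_gauge p (fst w)" 1 "1 + snd w" 2] simplex_gauge_le_1 [of "fst w" p] assms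
  by (auto simp: prism_stretch_def)

lemma simplex_gauge_pos:
  assumes "w \<in> standard_simplex p \<times> {0..1}" "1 \<le> prism_stretch p w"
  shows "0 < simplex_gauge p (fst w)"
  using assms zero_less_mult_pos2 [of "simplex_gauge p (fst w)" "1 + snd w"] by (auto simp: prism_stretch_def)

lemma project_to_walls_in_walls:
  assumes "w \<in> standard_simplex p \<times> {0..1}" "1 \<le> prism_stretch p w"
  shows "project_to_walls p w \<in> simplex_boundary p \<times> {0..1}"
  using assms simplex_gauge_pos [OF assms] prism_stretch_le_2 [OF assms(1)]
  by (auto simp: project_to_walls_def intro!: dilate_in_boundary)

lemma continuous_on_project_to_walls:
  "continuous_on {w \<in> standard_simplex p \<times> {0..1}. 1 \<le> prism_stretch p w} (project_to_walls p)"
proof -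
  have "simplex_gauge p (fst w) \<noteq> 0" if "w \<in> {w \<in> standard_simplex p \<times> {0..1}. 1 \<le> prism_stretch p w}" for w
    using simplex_gauge_pos [of w p] that by auto
  then show ?thesis
    unfolding project_to_walls_def [abs_def]
    by (intro continuous_on_Pair continuous_on_dilate continuous_on_divide continuous_on_const
        continuous_on_simplex_gauge_fst continuous_on_prism_stretch continuous_on_fst continuous_on_diff
        continuous_on_id) auto
qed

lemma project_to_walls_of_boundary:
  assumes "y \<in> simplex_boundary p"
  shows "project_to_walls p (y, t) = (y, t)"
  using assms simplex_gauge_boundary [OF assms]
  by (simp add: project_to_walls_def prism_stretch_def simplex_boundary_def dilate_1)

lemma project_to_walls_onto_base:
  assumes w: "w \<in> standard_simplex p \<times> {0..1}" and stretch: "prism_stretch p w = 1"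
  shows "project_to_walls p w = (dilate p (1 + snd w) (fst w), 0)"
proof -
  have "1 / simplex_gauge p (fst w) = 1 + snd w"
    using stretch simplex_gauge_pos [OF w eq_refl [OF stretch [symmetric]]]
    by (simp add: prism_stretch_def field_simps)
  then show ?thesis by (simp add: project_to_walls_def stretch)
qed

lemma homotopy_extension_simplex:
  fixes B :: "(nat \<Rightarrow> real) \<times> real \<Rightarrow> 'b"
  assumes \<sigma>: "continuous_map (top_of_set (standard_simplex p)) Y \<sigma>"
    and B: "continuous_map (top_of_set (simplex_boundary p \<times> {0..1})) Y B"
    and B_0: "\<And>y. y \<in> simplex_boundary p \<Longrightarrow> B (y, 0) = \<sigma> y"
  obtains G where "simplex_homotopy p Y G" "\<And>x. x \<in> standard_simplex p \<Longrightarrow> G x 0 = \<sigma> x"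
    "\<And>y t. \<lbrakk>y \<in> simplex_boundary p; t \<in> {0..1}\<rbrakk> \<Longrightarrow> G y t = B (y, t)"
proof -
  let ?P = "standard_simplex p \<times> {0..1::real}"
  define inner where "inner = (\<lambda>w :: (nat \<Rightarrow> real) \<times> real. \<sigma> (dilate p (1 + snd w) (fst w)))"
  define outer where "outer = (\<lambda>w. B (project_to_walls p w))"
  define G where "G = (\<lambda>x t. if prism_stretch p (x, t) \<le> 1 then inner (x, t) else outer (x, t))"
  have cont_inner: "continuous_map (top_of_set {w \<in> ?P. prism_stretch p w \<le> 1}) Y inner"
    unfolding inner_def
  proof (rule continuous_map_compose_on [OF \<sigma>])
    show "continuous_on {w \<in> ?P. prism_stretch p w \<le> 1} (\<lambda>w. dilate p (1 + snd w) (fst w))"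
      by (intro continuous_on_dilate continuous_on_add continuous_on_const continuous_on_fst
          continuous_on_snd continuous_on_id)
  qed (auto simp: prism_stretch_def intro: dilate_in_simplex)
  have cont_outer: "continuous_map (top_of_set {w \<in> ?P. 1 \<le> prism_stretch p w}) Y outer"
    unfolding outer_def
    by (rule continuous_map_compose_on [OF B continuous_on_project_to_walls])
      (use project_to_walls_in_walls [of _ p] in blast)
  have inner_eq_outer: "inner w = outer w" if w: "w \<in> ?P" and eq: "prism_stretch p w = 1" for w
  proof -
    have "dilate p (1 + snd w) (fst w) \<in> simplex_boundary p"
      using w eq by (intro dilate_in_boundary) (auto simp: prism_stretch_def)
    then show ?thesis by (simp add: inner_def outer_def project_to_walls_onto_base [OF w eq] B_0)
  qed
  have "continuous_map (top_of_set ?P) Y (\<lambda>w. if prism_stretch p w \<le> 1 then inner w else outer w)"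
    by (rule continuous_map_cases_le) (use cont_inner cont_outer continuous_on_prism_stretch inner_eq_outer in
        \<open>simp_all add: subtopology_subtopology Int_def\<close>)
  moreover have "(\<lambda>w. if prism_stretch p w \<le> 1 then inner w else outer w) = case_prod G" by (auto simp: G_def)
  ultimately have "simplex_homotopy p Y G" by simp
  moreover have "G x 0 = \<sigma> x" if "x \<in> standard_simplex p" for x
    using simplex_gauge_le_1 [OF that] dilate_1 [OF that] by (simp add: G_def prism_stretch_def inner_def)
  moreover have "G y t = B (y, t)" if y: "y \<in> simplex_boundary p" and t: "t \<in> {0..1}" for y t
    using y t simplex_gauge_boundary [OF y] B_0 [OF y] dilate_1 [of y p] project_to_walls_of_boundary [OF y]
    by (cases "t = 0") (simp_all add: G_def prism_stretch_def inner_def outer_def simplex_boundary_def)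
  ultimately show ?thesis by (rule that)
qed

definition drop_coord :: "nat \<Rightarrow> (nat \<Rightarrow> real) \<Rightarrow> nat \<Rightarrow> real" where
  "drop_coord k y j = y (skip k j)"

lemma simplical_face_drop_coord: "y k = 0 \<Longrightarrow> simplical_face k (drop_coord k y) = y"
  by (auto simp: simplical_face_def drop_coord_def skip_def fun_eq_iff)

lemma drop_coord_simplical_face: "drop_coord k (simplical_face k x) = x"
  by (auto simp: simplical_face_def drop_coord_def skip_def fun_eq_iff)

lemma simplical_face_at: "simplical_face k x k = 0"
  by (simp add: simplical_face_def)

lemma drop_coord_in_simplex:
  assumes y: "y \<in> standard_simplex (Suc p)" "y k = 0" and k: "k \<le> Suc p"
  shows "drop_coord k y \<in> standard_simplex p"
proof -
  have "(\<Sum>j\<le>p. drop_coord k y j) = (\<Sum>j\<le>Suc p. y j)"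
    using sum_simplical_face [OF k, of "\<lambda>_. 1" "drop_coord k y"] simplical_face_drop_coord [of y k, OF y(2)] by simp
  then show ?thesis using y k by (auto simp: standard_simplex_iff drop_coord_def skip_def)
qed

lemma simplical_faces_meet:
  assumes x: "x \<in> standard_simplex p" and y: "y \<in> standard_simplex p"
    and eq: "simplical_face i x = simplical_face j y" and ij: "i < j" "j \<le> Suc p"
  obtains q w where "p = Suc q" "w \<in> standard_simplex q" "x = simplical_face (j - 1) w" "y = simplical_face i w"
proof -
  have "simplical_face i x j = 0" unfolding eq by (rule simplical_face_at)
  then have x0: "x (j - 1) = 0" using ij by (simp add: simplical_face_def)
  then have p: "p \<noteq> 0" using x ij by (cases p) (auto simp: standard_simplex_0 le_Suc_eq)
  define w where "w = drop_coord (j - 1) x"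
  have xw: "x = simplical_face (j - 1) w" unfolding w_def using simplical_face_drop_coord [of x "j - 1", OF x0] by simp
  have "simplical_face j (simplical_face i w) = simplical_face j y"
    using simplical_face_simplical_face [OF ij(1), of w] eq xw by simp
  then have "y = simplical_face i w" by (metis drop_coord_simplical_face)
  moreover have "w \<in> standard_simplex (p - 1)"
    unfolding w_def using x x0 p ij by (intro drop_coord_in_simplex) auto
  ultimately show ?thesis using that [of "p - 1" w] p xw by simp
qed

lemma simplical_face_in_boundary:
  "\<lbrakk>i \<le> Suc p; x \<in> standard_simplex p\<rbrakk> \<Longrightarrow> simplical_face i x \<in> simplex_boundary (Suc p)"
  using simplical_face_in_simplex [of x p i] simplical_face_at unfolding simplex_boundary_def by blast

lemma simplex_boundary_cases:
  assumes "y \<in> simplex_boundary (Suc p)"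
  obtains i x where "i \<le> Suc p" "x \<in> standard_simplex p" "y = simplical_face i x"
proof -
  obtain i where i: "i \<le> Suc p" "y i = 0" and y: "y \<in> standard_simplex (Suc p)"
    using assms by (auto simp: simplex_boundary_def)
  show ?thesis
    by (rule that [OF i(1) drop_coord_in_simplex [OF y i(2,1)]])
      (use i(2) in \<open>simp add: simplical_face_drop_coord\<close>)
qed

lemma continuous_map_face_homotopy:
  assumes E: "simplex_homotopy p Y E" and i: "i \<le> Suc p"
  shows "continuous_map (top_of_set {w \<in> simplex_boundary (Suc p) \<times> {0..1}. fst w i = 0}) Y
    (\<lambda>w. E (drop_coord i (fst w)) (snd w))"
proof -
  let ?face = "{w \<in> simplex_boundary (Suc p) \<times> {0..1::real}. fst w i = 0}"
  have "continuous_map (top_of_set ?face) Y (\<lambda>w. case_prod E (drop_coord i (fst w), snd w))"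
  proof (rule continuous_map_compose_on [OF E])
    show "continuous_on ?face (\<lambda>w. (drop_coord i (fst w), snd w))"
      unfolding drop_coord_def
      by (rule continuous_on_Pair [OF continuous_on_coordinatewise_then_product
            [OF continuous_on_fst_coordinate] continuous_on_snd [OF continuous_on_id]])
    show "(\<lambda>w. (drop_coord i (fst w), snd w)) \<in> ?face \<rightarrow> standard_simplex p \<times> {0..1}"
      using i by (auto simp: simplex_boundary_def intro: drop_coord_in_simplex)
  qed
  then show ?thesis by simp
qed

lemma paste_face_homotopies:
  fixes E :: "nat \<Rightarrow> (nat \<Rightarrow> real) \<Rightarrow> real \<Rightarrow> 'b"
  assumes E: "\<And>i. i \<le> Suc p \<Longrightarrow> simplex_homotopy p Y (E i)"
    and E_meet: "\<And>i j x y t. \<lbrakk>i < j; j \<le> Suc p; x \<in> standard_simplex p; y \<in> standard_simplex p;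
        simplical_face i x = simplical_face j y; t \<in> {0..1}\<rbrakk> \<Longrightarrow> E i x t = E j y t"
  obtains B where "continuous_map (top_of_set (simplex_boundary (Suc p) \<times> {0..1})) Y B"
    "\<And>i x t. \<lbrakk>i \<le> Suc p; x \<in> standard_simplex p; t \<in> {0..1}\<rbrakk> \<Longrightarrow> B (simplical_face i x, t) = E i x t"
proof -
  let ?S = "simplex_boundary (Suc p) \<times> {0..1::real}"
  let ?face = "\<lambda>i. {w \<in> ?S. fst w i = 0}" and ?E = "\<lambda>i w. E i (drop_coord i (fst w)) (snd w)"
  have drop: "drop_coord i (fst w) \<in> standard_simplex p" if "i \<le> Suc p" "w \<in> ?face i" for i w
    using that by (intro drop_coord_in_simplex) (auto simp: simplex_boundary_def)
  have meet: "?E i w = ?E j w" if "i < j" "j \<le> Suc p" "w \<in> ?face i" "w \<in> ?face j" for i j w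
  proof (rule E_meet [OF that(1,2)])
    show "drop_coord i (fst w) \<in> standard_simplex p" "drop_coord j (fst w) \<in> standard_simplex p"
      using drop [of i w] drop [of j w] that by simp_all
  qed (use that in \<open>auto simp: simplical_face_drop_coord\<close>)
  obtain B where B: "continuous_map (top_of_set ?S) Y B"
    and B_face: "\<And>i w. \<lbrakk>i \<in> {..Suc p}; w \<in> topspace (top_of_set ?S) \<inter> ?face i\<rbrakk> \<Longrightarrow> B w = ?E i w"
  proof (rule pasting_lemma_exists_closed [of "{..Suc p}" "top_of_set ?S" ?face Y ?E])
    show "topspace (top_of_set ?S) \<subseteq> (\<Union>i\<in>{..Suc p}. ?face i)"
      by (auto simp: simplex_boundary_def)
    show "closedin (top_of_set ?S) (?face i)" for i
      by (rule continuous_closedin_preimage_constant [OF continuous_on_fst_coordinate])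
    fix i assume i: "i \<in> {..Suc p}"
    then have "continuous_map (top_of_set (?face i)) Y (?E i)"
      by (intro continuous_map_face_homotopy E) simp_all
    then show "continuous_map (subtopology (top_of_set ?S) (?face i)) Y (?E i)"
      by (simp add: subtopology_subtopology Int_def)
    fix j w assume "j \<in> {..Suc p}" "w \<in> topspace (top_of_set ?S) \<inter> ?face i \<inter> ?face j"
    then have "j \<le> Suc p" "i \<le> Suc p" "w \<in> ?face i" "w \<in> ?face j" using i by simp_all
    then show "?E i w = ?E j w"
      by (cases i j rule: linorder_cases) (blast intro: meet meet [symmetric])+
  qed auto
  have "B (simplical_face i x, t) = E i x t" if "i \<le> Suc p" "x \<in> standard_simplex p" "t \<in> {0..1}" for i x t
    using B_face [of i "(simplical_face i x, t)"] simplical_face_in_boundary [OF that(1,2)] that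
    by (simp add: drop_coord_simplical_face simplical_face_at)
  with B show ?thesis by (rule that)
qed

lemma homotopy_extension_faces:
  fixes E :: "nat \<Rightarrow> (nat \<Rightarrow> real) \<Rightarrow> real \<Rightarrow> 'b"
  assumes \<sigma>: "singular_simplex (Suc p) Y \<sigma>"
    and E: "\<And>i. i \<le> Suc p \<Longrightarrow> simplex_homotopy p Y (E i)"
    and E_0: "\<And>i x. \<lbrakk>i \<le> Suc p; x \<in> standard_simplex p\<rbrakk> \<Longrightarrow> E i x 0 = \<sigma> (simplical_face i x)"
    and E_meet: "\<And>i j x y t. \<lbrakk>i < j; j \<le> Suc p; x \<in> standard_simplex p; y \<in> standard_simplex p;
        simplical_face i x = simplical_face j y; t \<in> {0..1}\<rbrakk> \<Longrightarrow> E i x t = E j y t"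
  obtains G where "simplex_homotopy (Suc p) Y G" "\<And>x. x \<in> standard_simplex (Suc p) \<Longrightarrow> G x 0 = \<sigma> x"
    "\<And>i x t. \<lbrakk>i \<le> Suc p; x \<in> standard_simplex p; t \<in> {0..1}\<rbrakk> \<Longrightarrow> G (simplical_face i x) t = E i x t"
proof -
  obtain B where B: "continuous_map (top_of_set (simplex_boundary (Suc p) \<times> {0..1})) Y B"
    and B_face: "\<And>i x t. \<lbrakk>i \<le> Suc p; x \<in> standard_simplex p; t \<in> {0..1}\<rbrakk> \<Longrightarrow> B (simplical_face i x, t) = E i x t"
    by (rule paste_face_homotopies [OF E E_meet]) (assumption | rule that)+
  have B_0: "B (y, 0) = \<sigma> y" if "y \<in> simplex_boundary (Suc p)" for y
    using that by (rule simplex_boundary_cases) (simp add: B_face E_0)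
  obtain G where G: "simplex_homotopy (Suc p) Y G" "\<And>x. x \<in> standard_simplex (Suc p) \<Longrightarrow> G x 0 = \<sigma> x"
    and G_B: "\<And>y t. \<lbrakk>y \<in> simplex_boundary (Suc p); t \<in> {0..1}\<rbrakk> \<Longrightarrow> G y t = B (y, t)"
    using homotopy_extension_simplex [OF _ B B_0] \<sigma> unfolding singular_simplex_iff_top_of_set by blast
  have "G (simplical_face i x) t = E i x t" if "i \<le> Suc p" "x \<in> standard_simplex p" "t \<in> {0..1}" for i x t
    using G_B [OF simplical_face_in_boundary [OF that(1,2)] that(3)] B_face [OF that] by simp
  with G show ?thesis by (rule that)
qed

section \<open>Sliding simplices along circles\<close>

lemma continuous_on_Ints_imp_constant:
  fixes f :: "'c::topological_space \<Rightarrow> real"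
  assumes "connected S" "continuous_on S f" and Ints: "f \<in> S \<rightarrow> \<int>"
  shows "f constant_on S"
proof (rule continuous_discrete_range_constant [OF assms(1,2)])
  fix x assume x: "x \<in> S"
  have "1 \<le> norm (f y - f x)" if "y \<in> S" "f y \<noteq> f x" for y
    using that x Ints by (auto intro!: Ints_nonzero_abs_ge1 Ints_diff)
  then show "\<exists>e>0. \<forall>y. y \<in> S \<and> f y \<noteq> f x \<longrightarrow> e \<le> norm (f y - f x)"
    by (intro exI [of _ 1]) auto
qed

lemma connected_standard_simplex: "connected (standard_simplex p)"
  using connectedin_standard_simplex [of p] by (simp add: euclidean_product_topology)

abbreviation vertex :: "nat \<Rightarrow> nat \<Rightarrow> real" where
  "vertex i \<equiv> (\<lambda>j. if j = i then 1 else 0)"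

lemma simplical_face_vertex: "simplical_face k (vertex i) = vertex (skip k i)"
  by (auto simp: simplical_face_def skip_def fun_eq_iff)

lemma continuous_on_simplical_face: "continuous_on S (simplical_face k :: (nat \<Rightarrow> real) \<Rightarrow> _)"
  unfolding simplical_face_def
  by (rule continuous_on_coordinatewise_then_product)
    (intro continuous_on_if_const continuous_on_coordinate [OF continuous_on_id] continuous_on_const)

locale circle_family =
  fixes Y :: "'b topology" and A :: "'b set" and k :: nat and circ :: "nat \<Rightarrow> real \<Rightarrow> 'b"
  assumes continuous_circ: "j < k \<Longrightarrow> continuous_map euclideanreal (subtopology Y A) (circ j)"
    and circ_eq_iff: "\<lbrakk>j < k; j' < k\<rbrakk> \<Longrightarrow> circ j s = circ j' t \<longleftrightarrow> j = j' \<and> s - t \<in> \<int>"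
    and lift_exists: "singular_simplex p (subtopology Y A) \<sigma> \<Longrightarrow>
       \<exists>j<k. \<exists>g. continuous_on (standard_simplex p) g \<and> (\<forall>x\<in>standard_simplex p. \<sigma> x = circ j (g x))"
begin

definition lifts :: "nat \<Rightarrow> 'b ssimplex \<Rightarrow> nat \<Rightarrow> ((nat \<Rightarrow> real) \<Rightarrow> real) \<Rightarrow> bool" where
  "lifts p \<sigma> j g \<longleftrightarrow> j < k \<and> continuous_on (standard_simplex p) g \<and>
      (\<forall>x\<in>standard_simplex p. \<sigma> x = circ j (g x))"

lemma lifts_exist: "singular_simplex p (subtopology Y A) \<sigma> \<Longrightarrow> \<exists>j g. lifts p \<sigma> j g"
  using lift_exists by (auto simp: lifts_def)

lemma circ_shift: "j < k \<Longrightarrow> m \<in> \<int> \<Longrightarrow> circ j (s + m) = circ j s"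
  using circ_eq_iff by simp

lemma continuous_map_circ:
  assumes "j < k" "continuous_on S f"
  shows "continuous_map (top_of_set S) (subtopology Y A) (\<lambda>x. circ j (f x))"
  using continuous_map_compose [of "top_of_set S" euclideanreal f "subtopology Y A" "circ j"] assms continuous_circ
  by (simp add: o_def)

lemma lifts_unique:
  assumes "lifts p \<sigma> j g" "lifts p \<sigma> j' g'"
  shows "j' = j" and "\<exists>m\<in>\<int>. \<forall>x\<in>standard_simplex p. g' x = g x + m"
proof -
  have jk: "j < k" "j' < k" using assms by (simp_all add: lifts_def)
  have eq: "circ j' (g' x) = circ j (g x)" if "x \<in> standard_simplex p" for x
    using assms that by (auto simp: lifts_def)
  obtain x0 where x0: "x0 \<in> standard_simplex p" using nonempty_standard_simplex by blast
  show "j' = j" using eq [OF x0] circ_eq_iff jk by blast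
  have Ints: "g' x - g x \<in> \<int>" if "x \<in> standard_simplex p" for x
    using eq [OF that] circ_eq_iff jk by blast
  have "(\<lambda>x. g' x - g x) constant_on standard_simplex p"
    using assms Ints
    by (intro continuous_on_Ints_imp_constant connected_standard_simplex continuous_on_diff) (auto simp: lifts_def)
  then obtain m where m: "\<And>x. x \<in> standard_simplex p \<Longrightarrow> g' x - g x = m"
    unfolding constant_on_def by blast
  then have "m \<in> \<int>" "\<forall>x\<in>standard_simplex p. g' x = g x + m" using Ints [OF x0] m [OF x0] by force+
  then show "\<exists>m\<in>\<int>. \<forall>x\<in>standard_simplex p. g' x = g x + m" by blast
qed

lemma lifts_face:
  assumes "lifts (Suc p) \<sigma> j g" "i \<le> Suc p"
  shows "lifts p (singular_face (Suc p) i \<sigma>) j (\<lambda>x. g (simplical_face i x))"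
proof -
  have "continuous_on (standard_simplex p) (\<lambda>x. g (simplical_face i x))"
    by (rule continuous_on_compose2 [of "standard_simplex (Suc p)" g])
      (use assms simplical_face_in_simplex in \<open>auto simp: lifts_def continuous_on_simplical_face\<close>)
  then show ?thesis
    using assms simplical_face_in_simplex by (auto simp: lifts_def singular_face_apply)
qed

definition angle :: "'b \<Rightarrow> real" where
  "angle v = (SOME s. \<exists>j<k. v = circ j s)"

lemma diff_angle_Ints:
  assumes "j < k"
  shows "s - angle (circ j s) \<in> \<int>"
proof -
  obtain j' where "j' < k" "circ j s = circ j' (angle (circ j s))"
    unfolding angle_def using assms someI [of "\<lambda>t. \<exists>j'<k. circ j s = circ j' t" s] by blast
  then show ?thesis using circ_eq_iff assms by blast
qed

definition turns :: "'b ssimplex \<Rightarrow> ((nat \<Rightarrow> real) \<Rightarrow> real) \<Rightarrow> nat \<Rightarrow> real" where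
  "turns \<sigma> g i = g (vertex i) - angle (\<sigma> (vertex i))"

lemma turns_Ints:
  assumes "lifts p \<sigma> j g" "i \<le> p"
  shows "turns \<sigma> g i \<in> \<int>"
proof -
  have "j < k" "\<sigma> (vertex i) = circ j (g (vertex i))" using assms by (auto simp: lifts_def)
  then show ?thesis using diff_angle_Ints by (simp add: turns_def)
qed

lemma turns_face:
  "i \<le> p \<Longrightarrow> turns (singular_face (Suc p) l \<sigma>) (\<lambda>x. g (simplical_face l x)) i = turns \<sigma> g (skip l i)"
  by (simp add: turns_def singular_face_apply simplical_face_vertex)

text \<open>The affine homotopy that moves the \<open>i\<close>-th vertex to the basepoint of its circle, the difference
  of the numbers of turns made by two vertices being prescribed by the integers \<open>ns\<close>.\<close>

definition straight_slide ::
  "nat \<Rightarrow> 'b ssimplex \<Rightarrow> ((nat \<Rightarrow> real) \<Rightarrow> real) \<Rightarrow> int list \<Rightarrow> (nat \<Rightarrow> real) \<Rightarrow> real \<Rightarrow> real" where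
  "straight_slide p \<sigma> g ns x t = (1 - t) * g x + t * (\<Sum>i\<le>p. (of_int (ns ! i) + turns \<sigma> g i) * x i)"

lemma straight_slide_face:
  assumes "l \<le> Suc p" "length ns = Suc (Suc p)"
  shows "straight_slide (Suc p) \<sigma> g ns (simplical_face l x) t
    = straight_slide p (singular_face (Suc p) l \<sigma>) (\<lambda>x. g (simplical_face l x)) (omit l ns) x t"
  unfolding straight_slide_def sum_simplical_face [OF assms(1)]
  using assms by (simp add: nth_omit turns_face)

lemma circ_straight_slide_unique:
  assumes l: "lifts p \<sigma> j g" "lifts p \<sigma> j' g'" and x: "x \<in> standard_simplex p"
  shows "circ j' (straight_slide p \<sigma> g' ns x t) = circ j (straight_slide p \<sigma> g ns x t)"
proof -
  obtain m where m: "m \<in> \<int>" "\<And>x. x \<in> standard_simplex p \<Longrightarrow> g' x = g x + m" and j: "j' = j"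
    using lifts_unique [OF l] by blast
  have "(\<Sum>i\<le>p. (of_int (ns ! i) + turns \<sigma> g' i) * x i) = (\<Sum>i\<le>p. (of_int (ns ! i) + turns \<sigma> g i) * x i + m * x i)"
    using m(2) by (intro sum.cong) (simp_all add: turns_def algebra_simps)
  also have "\<dots> = (\<Sum>i\<le>p. (of_int (ns ! i) + turns \<sigma> g i) * x i) + m"
    using x by (simp add: sum.distrib standard_simplex_iff flip: sum_distrib_left)
  finally have "straight_slide p \<sigma> g' ns x t = straight_slide p \<sigma> g ns x t + m"
    unfolding straight_slide_def m(2) [OF x] by (simp add: algebra_simps)
  then show ?thesis using j m(1) l(1) by (simp add: circ_shift lifts_def)
qed

lemma continuous_on_straight_slide:
  assumes "lifts p \<sigma> j g"
  shows "continuous_on (standard_simplex p \<times> {0..1}) (\<lambda>w. straight_slide p \<sigma> g ns (fst w) (snd w))"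
proof -
  have "continuous_on (standard_simplex p \<times> {0..1::real}) (\<lambda>w. g (fst w))"
    by (rule continuous_on_compose2 [of "standard_simplex p" g])
      (use assms in \<open>auto simp: lifts_def intro: continuous_on_fst\<close>)
  then show ?thesis unfolding straight_slide_def
    by (intro continuous_on_add continuous_on_mult continuous_on_diff continuous_on_const
        continuous_on_snd continuous_on_id continuous_on_sum continuous_on_fst_coordinate)
qed

definition straight_homotopy :: "nat \<Rightarrow> 'b ssimplex \<Rightarrow> int list \<Rightarrow> (nat \<Rightarrow> real) \<Rightarrow> real \<Rightarrow> 'b" where
  "straight_homotopy p \<sigma> ns = (SOME G. \<exists>j g. lifts p \<sigma> j g \<and> G = (\<lambda>x t. circ j (straight_slide p \<sigma> g ns x t)))"

lemma straight_homotopy_eq: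
  assumes "lifts p \<sigma> j g" "x \<in> standard_simplex p"
  shows "straight_homotopy p \<sigma> ns x t = circ j (straight_slide p \<sigma> g ns x t)"
proof -
  obtain j' g' where "lifts p \<sigma> j' g'" "straight_homotopy p \<sigma> ns = (\<lambda>x t. circ j' (straight_slide p \<sigma> g' ns x t))"
    unfolding straight_homotopy_def
    using someI [of "\<lambda>G. \<exists>j g. lifts p \<sigma> j g \<and> G = (\<lambda>x t. circ j (straight_slide p \<sigma> g ns x t))"] assms(1) by blast
  then show ?thesis using circ_straight_slide_unique [OF assms(1) _ assms(2)] by simp
qed

definition extends_faces ::
  "nat \<Rightarrow> 'b ssimplex \<Rightarrow> (nat \<Rightarrow> (nat \<Rightarrow> real) \<Rightarrow> real \<Rightarrow> 'b) \<Rightarrow> ((nat \<Rightarrow> real) \<Rightarrow> real \<Rightarrow> 'b) \<Rightarrow> bool" where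
  "extends_faces p \<sigma> E G \<longleftrightarrow> simplex_homotopy (Suc p) Y G \<and> (\<forall>x\<in>standard_simplex (Suc p). G x 0 = \<sigma> x)
     \<and> (\<forall>i\<le>Suc p. \<forall>x\<in>standard_simplex p. \<forall>t\<in>{0..1}. G (simplical_face i x) t = E i x t)"

primrec slide :: "nat \<Rightarrow> 'b ssimplex \<Rightarrow> int list \<Rightarrow> (nat \<Rightarrow> real) \<Rightarrow> real \<Rightarrow> 'b" where
  "slide 0 \<sigma> ns = (if \<exists>j g. lifts 0 \<sigma> j g then straight_homotopy 0 \<sigma> ns else (\<lambda>x t. \<sigma> x))"
| "slide (Suc p) \<sigma> ns = (if \<exists>j g. lifts (Suc p) \<sigma> j g then straight_homotopy (Suc p) \<sigma> ns
     else SOME G. extends_faces p \<sigma> (\<lambda>i. slide p (singular_face (Suc p) i \<sigma>) (omit i ns)) G)"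

lemma slide_eq_of_lifts:
  assumes "lifts p \<sigma> j g" "x \<in> standard_simplex p"
  shows "slide p \<sigma> ns x t = circ j (straight_slide p \<sigma> g ns x t)"
proof -
  have "slide p \<sigma> ns = straight_homotopy p \<sigma> ns" using assms(1) by (cases p) auto
  then show ?thesis using straight_homotopy_eq [OF assms] by simp
qed

lemma simplex_homotopy_slide_of_lifts:
  assumes "lifts p \<sigma> j g"
  shows "simplex_homotopy p (subtopology Y A) (slide p \<sigma> ns)"
proof (rule continuous_map_eq)
  have "j < k" using assms by (simp add: lifts_def)
  then show "continuous_map (top_of_set (standard_simplex p \<times> {0..1})) (subtopology Y A)
      (\<lambda>w. circ j (straight_slide p \<sigma> g ns (fst w) (snd w)))"
    by (rule continuous_map_circ) (rule continuous_on_straight_slide [OF assms])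
qed (auto simp: slide_eq_of_lifts [OF assms])

lemma slide_0_of_lifts:
  assumes "lifts p \<sigma> j g" "x \<in> standard_simplex p"
  shows "slide p \<sigma> ns x 0 = \<sigma> x"
  using assms by (simp add: slide_eq_of_lifts [OF assms] straight_slide_def lifts_def)

lemma slide_face_of_lifts:
  assumes l: "lifts (Suc p) \<sigma> j g" and i: "i \<le> Suc p" and ns: "length ns = Suc (Suc p)" and x: "x \<in> standard_simplex p"
  shows "slide (Suc p) \<sigma> ns (simplical_face i x) t = slide p (singular_face (Suc p) i \<sigma>) (omit i ns) x t"
  unfolding slide_eq_of_lifts [OF l simplical_face_in_simplex [OF x i]]
    slide_eq_of_lifts [OF lifts_face [OF l i] x] straight_slide_face [OF i ns] ..

lemma extends_faces_slide:
  assumes \<sigma>: "singular_simplex (Suc p) Y \<sigma>" and ns: "length ns = Suc (Suc p)"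
    and not_lifts: "\<nexists>j g. lifts (Suc p) \<sigma> j g"
    and homotopy: "\<And>\<tau> ms. \<lbrakk>singular_simplex p Y \<tau>; length ms = Suc p\<rbrakk> \<Longrightarrow> simplex_homotopy p Y (slide p \<tau> ms)"
    and start: "\<And>\<tau> ms x. \<lbrakk>singular_simplex p Y \<tau>; length ms = Suc p; x \<in> standard_simplex p\<rbrakk>
        \<Longrightarrow> slide p \<tau> ms x 0 = \<tau> x"
    and face: "\<And>q \<tau> ms i x t. \<lbrakk>p = Suc q; singular_simplex p Y \<tau>; length ms = Suc p; i \<le> p; x \<in> standard_simplex q;
        t \<in> {0..1}\<rbrakk> \<Longrightarrow> slide p \<tau> ms (simplical_face i x) t = slide q (singular_face p i \<tau>) (omit i ms) x t"
  shows "extends_faces p \<sigma> (\<lambda>i. slide p (singular_face (Suc p) i \<sigma>) (omit i ns)) (slide (Suc p) \<sigma> ns)"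
proof -
  let ?\<tau> = "\<lambda>i. singular_face (Suc p) i \<sigma>" and ?ms = "\<lambda>i. omit i ns"
  note \<tau> = singular_simplex_face [OF \<sigma>]
  have ms: "length (?ms i) = Suc p" if "i \<le> Suc p" for i
    using that ns by (simp add: length_omit)
  obtain G where "extends_faces p \<sigma> (\<lambda>i. slide p (?\<tau> i) (?ms i)) G"
  proof (rule homotopy_extension_faces [OF \<sigma>, of "\<lambda>i. slide p (?\<tau> i) (?ms i)"])
    show "simplex_homotopy p Y (slide p (?\<tau> i) (?ms i))" if "i \<le> Suc p" for i
      using that \<tau> ms by (intro homotopy)
    show "slide p (?\<tau> i) (?ms i) x 0 = \<sigma> (simplical_face i x)" if "i \<le> Suc p" "x \<in> standard_simplex p" for i x
      using start [OF \<tau> ms] that by (simp add: singular_face_apply)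
    fix i j x y and t :: real
    assume ij: "i < j" "j \<le> Suc p" and xy: "x \<in> standard_simplex p" "y \<in> standard_simplex p"
      "simplical_face i x = simplical_face j y" and t: "t \<in> {0..1}"
    obtain q w where q: "p = Suc q" "w \<in> standard_simplex q" "x = simplical_face (j - 1) w" "y = simplical_face i w"
      using simplical_faces_meet [OF xy ij] by blast
    have "slide p (?\<tau> i) (?ms i) x t = slide q (singular_face p (j - 1) (?\<tau> i)) (omit (j - 1) (?ms i)) w t"
      unfolding q(3) using ij t q(2) by (intro face [OF q(1)] \<tau> ms) auto
    also have "\<dots> = slide q (singular_face p i (?\<tau> j)) (omit i (?ms j)) w t"
      using singular_face_singular_face [of i j q \<sigma>] omit_omit [of i j ns] ij q(1) ns by simp
    also have "\<dots> = slide p (?\<tau> j) (?ms j) y t"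
      unfolding q(4) using ij t q(2) by (intro face [OF q(1), symmetric] \<tau> ms) auto
    finally show "slide p (?\<tau> i) (?ms i) x t = slide p (?\<tau> j) (?ms j) y t" .
  qed (unfold extends_faces_def, blast)
  then show ?thesis unfolding slide.simps(2) if_not_P [OF not_lifts]
    by (rule someI [where P = "extends_faces p \<sigma> (\<lambda>i. slide p (?\<tau> i) (?ms i))"])
qed

lemma slide_properties:
  assumes "singular_simplex p Y \<sigma>" "length ns = Suc p"
  shows "simplex_homotopy p Y (slide p \<sigma> ns) \<and> (\<forall>x\<in>standard_simplex p. slide p \<sigma> ns x 0 = \<sigma> x) \<and>
    (\<forall>q. p = Suc q \<longrightarrow> (\<forall>i\<le>p. \<forall>x\<in>standard_simplex q. \<forall>t\<in>{0..1}.
      slide p \<sigma> ns (simplical_face i x) t = slide q (singular_face p i \<sigma>) (omit i ns) x t))"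
  using assms
proof (induction p arbitrary: \<sigma> ns)
  case 0
  show ?case
  proof (cases "\<exists>j g. lifts 0 \<sigma> j g")
    case True
    then obtain j g where lift: "lifts 0 \<sigma> j g" by blast
    show ?thesis
      using simplex_homotopy_slide_of_lifts [OF lift] slide_0_of_lifts [OF lift]
      by (simp add: continuous_map_in_subtopology)
  next
    case False
    have "continuous_map (top_of_set (standard_simplex 0)) Y \<sigma>"
      using 0(1) by (simp add: singular_simplex_iff_top_of_set)
    then have "continuous_map (top_of_set (standard_simplex 0 \<times> {0..1::real})) Y (\<lambda>w. \<sigma> (fst w))"
      by (rule continuous_map_compose_on) (auto intro: continuous_on_fst)
    moreover have "slide 0 \<sigma> ns = (\<lambda>x t. \<sigma> x)" using False by simp
    ultimately show ?thesis by (simp add: split_def)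
  qed
next
  case (Suc p)
  show ?case
  proof (cases "\<exists>j g. lifts (Suc p) \<sigma> j g")
    case True
    then obtain j g where lift: "lifts (Suc p) \<sigma> j g" by blast
    show ?thesis
      using simplex_homotopy_slide_of_lifts [OF lift] slide_0_of_lifts [OF lift]
        slide_face_of_lifts [OF lift _ Suc.prems(2)]
      by (simp add: continuous_map_in_subtopology)
  next
    case False
    have "extends_faces p \<sigma> (\<lambda>i. slide p (singular_face (Suc p) i \<sigma>) (omit i ns)) (slide (Suc p) \<sigma> ns)"
      by (rule extends_faces_slide [OF Suc.prems False]) (use Suc.IH in blast)+
    then show ?thesis by (simp only: extends_faces_def nat.inject) blast
  qed
qed

lemma simplex_homotopy_slide:
  "\<lbrakk>singular_simplex p Y \<sigma>; length ns = Suc p\<rbrakk> \<Longrightarrow> simplex_homotopy p Y (slide p \<sigma> ns)"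
  using slide_properties by blast

lemma slide_0:
  "\<lbrakk>singular_simplex p Y \<sigma>; length ns = Suc p; x \<in> standard_simplex p\<rbrakk> \<Longrightarrow> slide p \<sigma> ns x 0 = \<sigma> x"
  using slide_properties by blast

lemma slide_face:
  "\<lbrakk>singular_simplex (Suc p) Y \<sigma>; length ns = Suc (Suc p); i \<le> Suc p; x \<in> standard_simplex p; t \<in> {0..1}\<rbrakk>
    \<Longrightarrow> slide (Suc p) \<sigma> ns (simplical_face i x) t = slide p (singular_face (Suc p) i \<sigma>) (omit i ns) x t"
  using slide_properties by blast

lemma simplex_homotopy_slide_in_A:
  "singular_simplex p (subtopology Y A) \<sigma> \<Longrightarrow> simplex_homotopy p (subtopology Y A) (slide p \<sigma> ns)"
  using lifts_exist simplex_homotopy_slide_of_lifts by blast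

definition slid :: "nat \<Rightarrow> 'b ssimplex \<Rightarrow> int list \<Rightarrow> 'b ssimplex" where
  "slid p \<sigma> ns = restrict (\<lambda>x. slide p \<sigma> ns x 1) (standard_simplex p)"

lemma singular_simplex_slid:
  assumes "singular_simplex p Y \<sigma>" "length ns = Suc p"
  shows "singular_simplex p Y (slid p \<sigma> ns)"
proof -
  have "continuous_map (top_of_set (standard_simplex p)) Y (\<lambda>x. case_prod (slide p \<sigma> ns) (x, 1))"
    by (rule continuous_map_compose_on [OF simplex_homotopy_slide [OF assms]]) (auto intro!: continuous_intros)
  then show ?thesis by (simp add: slid_def singular_simplex_iff_top_of_set)
qed

lemma singular_face_slid:
  assumes "singular_simplex (Suc p) Y \<sigma>" "length ns = Suc (Suc p)" "i \<le> Suc p"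
  shows "singular_face (Suc p) i (slid (Suc p) \<sigma> ns) = slid p (singular_face (Suc p) i \<sigma>) (omit i ns)"
proof
  fix x
  show "singular_face (Suc p) i (slid (Suc p) \<sigma> ns) x = slid p (singular_face (Suc p) i \<sigma>) (omit i ns) x"
  proof (cases "x \<in> standard_simplex p")
    case True
    then show ?thesis
      using slide_face [OF assms True, of 1] simplical_face_in_simplex [OF True assms(3)]
      by (simp add: slid_def singular_face_apply del: slide.simps)
  qed (simp add: slid_def singular_face_def)
qed

lemma cobd_1_slid:
  assumes "singular_simplex 2 Y \<sigma>"
  shows "cobd 1 \<phi> (slid 2 \<sigma> [a, b, c]) = \<phi> (slid 1 (singular_face 2 0 \<sigma>) [b, c])
     - \<phi> (slid 1 (singular_face 2 1 \<sigma>) [a, c]) + \<phi> (slid 1 (singular_face 2 2 \<sigma>) [a, b])"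
  unfolding cobd_1 using singular_face_slid [of 1 \<sigma> "[a, b, c]"] assms
  by (simp add: numeral_2_eq_2 del: slide.simps)

lemma cocycle_slid:
  assumes \<psi>: "cocycle 2 Z \<psi>" and \<sigma>: "singular_simplex 2 Y \<sigma>" and homotopy: "simplex_homotopy 2 Z (slide 2 \<sigma> [a, b, c])"
  shows "\<psi> (slid 2 \<sigma> [a, b, c]) = \<psi> \<sigma> + (prism_cochain \<psi> (slide 1 (singular_face 2 0 \<sigma>) [b, c])
     - prism_cochain \<psi> (slide 1 (singular_face 2 1 \<sigma>) [a, c]) + prism_cochain \<psi> (slide 1 (singular_face 2 2 \<sigma>) [a, b]))"
proof -
  have "restrict (\<lambda>x. slide 2 \<sigma> [a, b, c] x 0) (standard_simplex 2) = \<sigma>"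
    using slide_0 [OF \<sigma>, of "[a, b, c]"] \<sigma> by (auto simp: singular_simplex_def extensional_def fun_eq_iff)
  moreover have "prism_cochain \<psi> (\<lambda>x t. slide 2 \<sigma> [a, b, c] (simplical_face i x) t)
      = prism_cochain \<psi> (slide 1 (singular_face 2 i \<sigma>) (omit i [a, b, c]))" if "i \<le> 2" for i
    using slide_face [of 1 \<sigma> "[a, b, c]" i] \<sigma> that by (intro prism_cochain_cong) (simp add: numeral_2_eq_2)
  from this [of 0] this [of 1] this [of 2] have "prism_cochain \<psi> (\<lambda>x t. slide 2 \<sigma> [a, b, c] (simplical_face 0 x) t)
        = prism_cochain \<psi> (slide 1 (singular_face 2 0 \<sigma>) [b, c])"
      "prism_cochain \<psi> (\<lambda>x t. slide 2 \<sigma> [a, b, c] (simplical_face 1 x) t)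
        = prism_cochain \<psi> (slide 1 (singular_face 2 1 \<sigma>) [a, c])"
      "prism_cochain \<psi> (\<lambda>x t. slide 2 \<sigma> [a, b, c] (simplical_face 2 x) t)
        = prism_cochain \<psi> (slide 1 (singular_face 2 2 \<sigma>) [a, b])"
    by (simp_all add: numeral_2_eq_2)
  ultimately show ?thesis using prism_identity [OF \<psi> homotopy] unfolding slid_def by simp
qed

lemma abs_prism_cochain_slide_le:
  assumes "cochain_bound 2 (subtopology Y A) \<psi> B" "singular_simplex 1 (subtopology Y A) e"
  shows "\<bar>prism_cochain \<psi> (slide 1 e ns)\<bar> \<le> 2 * B"
  by (rule abs_prism_cochain_le [OF assms(1) simplex_homotopy_slide_in_A [OF assms(2)]])

definition line :: "nat \<Rightarrow> real list \<Rightarrow> 'b ssimplex" where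
  "line j ts = prism_simplex (map (\<lambda>t. (0, t)) ts) (\<lambda>x t. circ j t)"

lemma singular_simplex_line:
  assumes "j < k" "length ts = Suc p"
  shows "singular_simplex p (subtopology Y A) (line j ts)"
  unfolding line_def
proof (rule singular_simplex_prism_simplex [of 0 UNIV])
  show "continuous_map (top_of_set (standard_simplex 0 \<times> UNIV)) (subtopology Y A) (\<lambda>(x, t). circ j t)"
    using continuous_map_circ [OF assms(1) continuous_on_snd [OF continuous_on_id]] by (simp add: split_def)
qed (use assms in auto)

lemma line_eq:
  "length ts = Suc p \<Longrightarrow> line j ts = restrict (\<lambda>x. circ j (\<Sum>i\<le>p. ts ! i * x i)) (standard_simplex p)"
  by (simp add: line_def prism_simplex_def prism_height_def lessThan_Suc_atMost)

lemma line_shift: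
  assumes "j < k" "m \<in> \<int>" "length ts = Suc p"
  shows "line j (map (\<lambda>t. t + m) ts) = line j ts"
proof -
  have "(\<Sum>i\<le>p. map (\<lambda>t. t + m) ts ! i * x i) = (\<Sum>i\<le>p. ts ! i * x i) + m" if "x \<in> standard_simplex p" for x
  proof -
    have "(\<Sum>i\<le>p. map (\<lambda>t. t + m) ts ! i * x i) = (\<Sum>i\<le>p. ts ! i * x i + m * x i)"
      using assms(3) by (intro sum.cong) (simp_all add: distrib_right)
    then show ?thesis using that by (simp add: sum.distrib standard_simplex_iff flip: sum_distrib_left)
  qed
  then show ?thesis using assms by (auto simp: line_eq circ_shift)
qed

lemma slid_eq_line:
  assumes "lifts p \<sigma> j g"
  shows "slid p \<sigma> ns = line j (map (\<lambda>i. of_int (ns ! i) + turns \<sigma> g i) [0..<Suc p])"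
proof -
  let ?ts = "map (\<lambda>i. of_int (ns ! i) + turns \<sigma> g i) [0..<Suc p]"
  have "slide p \<sigma> ns x 1 = circ j (\<Sum>i\<le>p. ?ts ! i * x i)" if "x \<in> standard_simplex p" for x
  proof -
    have "(\<Sum>i\<le>p. ?ts ! i * x i) = (\<Sum>i\<le>p. (of_int (ns ! i) + turns \<sigma> g i) * x i)"
      by (intro sum.cong) (simp_all del: upt_Suc)
    then show ?thesis by (simp only: slide_eq_of_lifts [OF assms that] straight_slide_def) simp
  qed
  then show ?thesis
    unfolding slid_def by (subst line_eq [of _ p]) (auto intro!: restrict_ext)
qed

definition winding :: "'b ssimplex \<Rightarrow> int" where
  "winding e = (THE w. \<exists>j g. lifts 1 e j g \<and> of_int w = turns e g 1 - turns e g 0)"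

lemma of_int_winding:
  assumes l: "lifts 1 e j g"
  shows "of_int (winding e) = turns e g 1 - turns e g 0"
proof -
  have "turns e g 1 - turns e g 0 \<in> \<int>" by (intro Ints_diff turns_Ints [OF l]) auto
  then obtain w where w: "turns e g 1 - turns e g 0 = of_int w" by (rule Ints_cases)
  have "turns e g' 1 - turns e g' 0 = turns e g 1 - turns e g 0" if "lifts 1 e j' g'" for j' g'
  proof -
    obtain m where "\<And>x. x \<in> standard_simplex 1 \<Longrightarrow> g' x = g x + m"
      using lifts_unique(2) [OF l \<open>lifts 1 e j' g'\<close>] by blast
    then show ?thesis by (simp add: turns_def)
  qed
  then have "w' = w" if "\<exists>j g. lifts 1 e j g \<and> of_int w' = turns e g 1 - turns e g 0" for w'
    using that w by (metis of_int_eq_iff)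
  moreover have "\<exists>j g. lifts 1 e j g \<and> of_int w = turns e g 1 - turns e g 0" using l w by metis
  ultimately have "winding e = w" unfolding winding_def by (rule the_equality [rotated])
  then show ?thesis using w by simp
qed

lemma slid_edge_eq_line:
  assumes l: "lifts 1 e j g"
  shows "slid 1 e [a, b] = line j [0, of_int (b - a + winding e)]"
proof -
  have "slid 1 e [a, b] = line j (map (\<lambda>t. t + (of_int a + turns e g 0)) [0, of_int (b - a + winding e)])"
    unfolding slid_eq_line [OF l] by (simp add: of_int_winding [OF l])
  also have "\<dots> = line j [0, of_int (b - a + winding e)]"
    using l by (intro line_shift) (auto simp: lifts_def intro!: Ints_add turns_Ints [OF l])
  finally show ?thesis .
qed

end

section \<open>Averaging over slides\<close>

definition mean :: "nat \<Rightarrow> (int \<Rightarrow> real) \<Rightarrow> real" where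
  "mean N f = (\<Sum>n<N. f (int n)) / real N"

lemma mean_add: "mean N (\<lambda>n. f n + g n) = mean N f + mean N g"
  by (simp add: mean_def sum.distrib add_divide_distrib)

lemma mean_diff: "mean N (\<lambda>n. f n - g n) = mean N f - mean N g"
  by (simp add: mean_def sum_subtractf diff_divide_distrib)

lemma mean_const: "N > 0 \<Longrightarrow> mean N (\<lambda>n. c) = c"
  by (simp add: mean_def)

lemma abs_mean_le:
  assumes "\<And>n. \<bar>f n\<bar> \<le> B"
  shows "\<bar>mean N f\<bar> \<le> B"
proof (cases "N = 0")
  case True
  then show ?thesis using order_trans [OF abs_ge_zero assms] by (simp add: mean_def)
next
  case False
  have "\<bar>\<Sum>n<N. f (int n)\<bar> \<le> (\<Sum>n<N. B)"
    using assms by (intro order_trans [OF sum_abs] sum_mono)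
  then show ?thesis using False by (simp add: mean_def field_simps)
qed

lemma abs_mean_shift_nat_le:
  assumes "\<And>n. \<bar>f n\<bar> \<le> B"
  shows "\<bar>mean N (\<lambda>n. f (n + int d)) - mean N f\<bar> \<le> 2 * B * real d / real N"
proof (induction d)
  case (Suc d)
  have "(\<Sum>n<N. f (int n + int (Suc d)) - f (int n + int d)) = f (int N + int d) - f (int d)"
    using sum_lessThan_telescope [of "\<lambda>n. f (int n + int d)" N] by (simp add: algebra_simps)
  then have "mean N (\<lambda>n. f (n + int (Suc d))) - mean N (\<lambda>n. f (n + int d)) = (f (int N + int d) - f (int d)) / real N"
    by (simp add: mean_def sum_subtractf flip: diff_divide_distrib)
  moreover have "\<bar>(f (int N + int d) - f (int d)) / real N\<bar> \<le> 2 * B / real N"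
    using assms [of "int N + int d"] assms [of "int d"] by (simp add: abs_divide divide_right_mono)
  moreover have "2 * B * real (Suc d) / real N = 2 * B / real N + 2 * B * real d / real N"
    by (simp add: distrib_left add_divide_distrib)
  ultimately show ?case using Suc by linarith
qed simp

lemma abs_mean_shift_le:
  assumes "\<And>n. \<bar>f n\<bar> \<le> B"
  shows "\<bar>mean N (\<lambda>n. f (n + d)) - mean N f\<bar> \<le> 2 * B * \<bar>of_int d\<bar> / real N"
proof (cases "d \<ge> 0")
  case True
  then show ?thesis using abs_mean_shift_nat_le [of f B N "nat d"] assms by simp
next
  case False
  then show ?thesis using abs_mean_shift_nat_le [of "\<lambda>n. f (n + d)" B N "nat (- d)"] assms
    by (simp add: abs_minus_commute)
qed

lemma mean_shift_tendsto:
  assumes "\<And>n. \<bar>f n\<bar> \<le> B"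
  shows "(\<lambda>N. mean N (\<lambda>n. f (n + d)) - mean N f) \<longlonglongrightarrow> 0"
  by (rule Lim_null_comparison [OF always_eventually lim_const_over_n [of "2 * B * \<bar>of_int d\<bar>"]])
    (use abs_mean_shift_le [of f B] assms in simp)

lemma mean_mean_shift_tendsto:
  assumes "\<And>n. \<bar>f n\<bar> \<le> B"
  shows "(\<lambda>N. mean N (\<lambda>a. mean N (\<lambda>b. f (b - a + d))) - mean N (\<lambda>a. mean N (\<lambda>b. f (b - a)))) \<longlonglongrightarrow> 0"
proof (rule Lim_null_comparison [OF always_eventually lim_const_over_n [of "2 * B * \<bar>of_int d\<bar>"]], intro allI)
  fix N
  have "\<bar>mean N (\<lambda>a. mean N (\<lambda>b. f (b - a + d)) - mean N (\<lambda>b. f (b - a)))\<bar> \<le> 2 * B * \<bar>of_int d\<bar> / real N"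
  proof (rule abs_mean_le)
    show "\<bar>mean N (\<lambda>b. f (b - a + d)) - mean N (\<lambda>b. f (b - a))\<bar> \<le> 2 * B * \<bar>of_int d\<bar> / real N" for a
      using abs_mean_shift_le [of "\<lambda>b. f (b - a)" B N d] assms by (simp add: algebra_simps)
  qed
  then show "norm (mean N (\<lambda>a. mean N (\<lambda>b. f (b - a + d))) - mean N (\<lambda>a. mean N (\<lambda>b. f (b - a))))
      \<le> 2 * B * \<bar>of_int d\<bar> / real N"
    by (simp add: mean_diff)
qed

lemma mean_cobd_1:
  assumes "N > 0"
  shows "mean N (\<lambda>a. mean N (\<lambda>b. mean N (\<lambda>c. h (singular_face 2 0 \<sigma>) b c - h (singular_face 2 1 \<sigma>) a c
      + h (singular_face 2 2 \<sigma>) a b))) = cobd 1 (\<lambda>e. mean N (\<lambda>a. mean N (\<lambda>b. h e a b))) \<sigma>"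
  using assms by (simp add: cobd_1 mean_add mean_diff mean_const del: One_nat_def)

lemma abs_kronecker_le_antisymmetrised:
  assumes z: "rrelcycle 2 Y A z" and \<psi>: "bcocycle 2 Y A \<psi>" and \<omega>: "cochain_bound 2 Y \<omega> C"
    and \<psi>_eq: "\<And>\<sigma>. singular_simplex 2 Y \<sigma> \<Longrightarrow> \<psi> \<sigma> = \<omega> \<sigma> + cobd 1 \<phi> \<sigma>"
  shows "2 * \<bar>kronecker z \<psi>\<bar> \<le> 2 * C * l1norm z + \<bar>kronecker (rbd 2 z) (\<lambda>e. \<phi> e - \<phi> (reverse_edge e))\<bar>"
proof -
  let ?\<alpha> = "\<lambda>\<sigma>. \<omega> \<sigma> - \<omega> (reverse_triangle \<sigma>)" and ?\<beta> = "\<lambda>e. \<phi> e - \<phi> (reverse_edge e)"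
  have cocycle: "cocycle 2 Y \<psi>" and vanish: "vanishing_cochain 2 (subtopology Y A) \<psi>"
    using \<psi> by (simp_all add: bcocycle_iff)
  have z_simplex: "singular_simplex 2 Y \<sigma>" if "z \<sigma> \<noteq> 0" for \<sigma>
    using z that by (simp add: rrelcycle_def rchain_def)
  have decomposition: "2 * \<psi> \<sigma> = ?\<alpha> \<sigma> + (cobd 1 ?\<beta> \<sigma> + cobd 1 (reverse_cochain \<psi>) \<sigma>)"
    if \<sigma>: "singular_simplex 2 Y \<sigma>" for \<sigma>
    using cocycle_reverse_triangle [OF cocycle \<sigma>] \<psi>_eq [OF \<sigma>] \<psi>_eq [OF singular_simplex_reverse_triangle [OF \<sigma>]]
    by (simp add: cobd_1_reverse_triangle cobd_diff del: One_nat_def)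
  have "2 * kronecker z \<psi> = kronecker z (\<lambda>\<sigma>. 2 * \<psi> \<sigma>)"
    by (simp add: kronecker_def sum_distrib_left mult_ac)
  also have "\<dots> = kronecker z (\<lambda>\<sigma>. ?\<alpha> \<sigma> + (cobd 1 ?\<beta> \<sigma> + cobd 1 (reverse_cochain \<psi>) \<sigma>))"
    by (rule kronecker_cong) (rule decomposition [OF z_simplex])
  also have "\<dots> = kronecker z ?\<alpha> + kronecker z (cobd 1 ?\<beta>)"
    using kronecker_cobd_vanishing [of 1 Y A z] z vanishing_reverse_cochain [OF vanish]
    by (simp add: kronecker_add_right numeral_2_eq_2)
  also have "kronecker z (cobd 1 ?\<beta>) = kronecker (rbd 2 z) ?\<beta>"
    using kronecker_rbd [of z 1 ?\<beta>] z by (simp add: rrelcycle_def rchain_def numeral_2_eq_2)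
  finally have "2 * kronecker z \<psi> = kronecker z ?\<alpha> + kronecker (rbd 2 z) ?\<beta>" .
  moreover have "\<bar>kronecker z ?\<alpha>\<bar> \<le> 2 * C * l1norm z"
  proof (rule abs_kronecker_le)
    fix \<sigma> assume "z \<sigma> \<noteq> 0"
    note \<sigma> = z_simplex [OF this]
    show "\<bar>?\<alpha> \<sigma>\<bar> \<le> 2 * C"
      using cochain_boundD [OF \<omega> \<sigma>] cochain_boundD [OF \<omega> singular_simplex_reverse_triangle [OF \<sigma>]] by linarith
  qed
  ultimately show ?thesis by linarith
qed

lemma reverse_edge_vertex_0: "reverse_edge e (vertex 0) = e (vertex 1)"
proof -
  have "prism_base [(1, 0), (0, 0)] (vertex 0) = vertex 1"
    by (auto simp: prism_base_def fun_eq_iff lessThan_Suc)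
  then show ?thesis by (simp add: reindex_def prism_simplex_def)
qed

context circle_family
begin

definition averaged_edge :: "nat \<Rightarrow> ('b ssimplex \<Rightarrow> real) \<Rightarrow> 'b ssimplex \<Rightarrow> real" where
  "averaged_edge N \<phi> e = mean N (\<lambda>a. mean N (\<lambda>b. \<phi> (slid 1 e [a, b])))"

definition averaged_prism :: "nat \<Rightarrow> ('b ssimplex \<Rightarrow> real) \<Rightarrow> 'b ssimplex \<Rightarrow> real" where
  "averaged_prism N \<psi> e = mean N (\<lambda>a. mean N (\<lambda>b. prism_cochain \<psi> (slide 1 e [a, b])))"

definition averaged_triangle :: "nat \<Rightarrow> ('b ssimplex \<Rightarrow> real) \<Rightarrow> 'b ssimplex \<Rightarrow> real" where
  "averaged_triangle N \<omega> \<sigma> = mean N (\<lambda>a. mean N (\<lambda>b. mean N (\<lambda>c. \<omega> (slid 2 \<sigma> [a, b, c]))))"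

lemma averaged_triangle_cocycle:
  assumes \<psi>: "cocycle 2 Y \<psi>" and \<sigma>: "singular_simplex 2 Y \<sigma>" and N: "N > 0"
  shows "averaged_triangle N \<psi> \<sigma> = \<psi> \<sigma> + cobd 1 (averaged_prism N \<psi>) \<sigma>"
proof -
  have "\<psi> (slid 2 \<sigma> [a, b, c]) = \<psi> \<sigma>
      + (prism_cochain \<psi> (slide 1 (singular_face 2 0 \<sigma>) [b, c]) - prism_cochain \<psi> (slide 1 (singular_face 2 1 \<sigma>) [a, c])
      + prism_cochain \<psi> (slide 1 (singular_face 2 2 \<sigma>) [a, b]))" for a b c
    by (rule cocycle_slid [OF \<psi> \<sigma> simplex_homotopy_slide [OF \<sigma>]]) simp
  then have "averaged_triangle N \<psi> \<sigma> = mean N (\<lambda>a. mean N (\<lambda>b. mean N (\<lambda>c. \<psi> \<sigma>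
      + (prism_cochain \<psi> (slide 1 (singular_face 2 0 \<sigma>) [b, c]) - prism_cochain \<psi> (slide 1 (singular_face 2 1 \<sigma>) [a, c])
      + prism_cochain \<psi> (slide 1 (singular_face 2 2 \<sigma>) [a, b])))))"
    by (simp only: averaged_triangle_def)
  also have "\<dots> = \<psi> \<sigma> + cobd 1 (averaged_prism N \<psi>) \<sigma>"
    unfolding mean_add [of _ "\<lambda>_. \<psi> \<sigma>"] mean_const [OF N]
      mean_cobd_1 [OF N, of "\<lambda>e a b. prism_cochain \<psi> (slide 1 e [a, b])"] averaged_prism_def ..
  finally show ?thesis .
qed

lemma averaged_triangle_cobd:
  assumes "singular_simplex 2 Y \<sigma>" "N > 0"
  shows "averaged_triangle N (cobd 1 \<phi>) \<sigma> = cobd 1 (averaged_edge N \<phi>) \<sigma>"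
  unfolding averaged_triangle_def averaged_edge_def cobd_1_slid [OF assms(1)]
  by (rule mean_cobd_1 [OF assms(2), of "\<lambda>e a b. \<phi> (slid 1 e [a, b])"])

lemma averaged_triangle_add:
  "averaged_triangle N (\<lambda>\<sigma>. \<omega> \<sigma> + \<omega>' \<sigma>) \<sigma> = averaged_triangle N \<omega> \<sigma> + averaged_triangle N \<omega>' \<sigma>"
  by (simp add: averaged_triangle_def mean_add)

lemma averaged_triangle_cong:
  assumes "\<And>\<sigma>. singular_simplex 2 Y \<sigma> \<Longrightarrow> \<omega> \<sigma> = \<omega>' \<sigma>" "singular_simplex 2 Y \<sigma>"
  shows "averaged_triangle N \<omega> \<sigma> = averaged_triangle N \<omega>' \<sigma>"
  using assms(1) [OF singular_simplex_slid [OF assms(2)]] by (simp add: averaged_triangle_def)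

lemma cochain_bound_averaged_triangle:
  assumes "cochain_bound 2 Y \<omega> C"
  shows "cochain_bound 2 Y (averaged_triangle N \<omega>) C"
  unfolding cochain_bound_def averaged_triangle_def
  by (intro allI impI abs_mean_le cochain_boundD [OF assms] singular_simplex_slid) simp_all

lemma vanishing_averaged_prism:
  assumes "vanishing_cochain 2 (subtopology Y A) \<psi>"
  shows "vanishing_cochain 1 (subtopology Y A) (averaged_prism N \<psi>)"
proof -
  have "cochain_bound 2 (subtopology Y A) \<psi> 0"
    using assms by (simp add: cochain_bound_def vanishing_cochain_def)
  then have "prism_cochain \<psi> (slide 1 e ns) = 0" if "singular_simplex 1 (subtopology Y A) e" for e ns
    using abs_prism_cochain_slide_le [OF _ that, of \<psi> 0 ns] by simp
  then show ?thesis by (simp add: vanishing_cochain_def averaged_prism_def mean_def)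
qed

lemma averaged_edge_tendsto:
  assumes \<phi>: "cochain_bound 1 (subtopology Y A) \<phi> B" and l: "lifts 1 e j g"
  shows "(\<lambda>N. averaged_edge N \<phi> e - mean N (\<lambda>a. mean N (\<lambda>b. \<phi> (line j [0, of_int (b - a)])))) \<longlonglongrightarrow> 0"
proof -
  have "\<bar>\<phi> (line j [0, of_int n])\<bar> \<le> B" for n
    using l by (intro cochain_boundD [OF \<phi>] singular_simplex_line) (auto simp: lifts_def)
  from mean_mean_shift_tendsto [of "\<lambda>n. \<phi> (line j [0, of_int n])", OF this, of "winding e"]
  show ?thesis unfolding averaged_edge_def slid_edge_eq_line [OF l] .
qed

lemma averaged_edge_reverse_tendsto:
  assumes \<phi>: "cochain_bound 1 (subtopology Y A) \<phi> B" and e: "singular_simplex 1 (subtopology Y A) e"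
  shows "(\<lambda>N. averaged_edge N \<phi> e - averaged_edge N \<phi> (reverse_edge e)) \<longlonglongrightarrow> 0"
proof -
  obtain j g where l: "lifts 1 e j g" using lifts_exist [OF e] by blast
  obtain j' g' where l': "lifts 1 (reverse_edge e) j' g'"
    using lifts_exist [OF singular_simplex_reverse_edge [OF e]] by blast
  have "circ j' (g' (vertex 0)) = circ j (g (vertex 1))"
    using l l' reverse_edge_vertex_0 [of e] by (simp add: lifts_def)
  then have "j' = j" using circ_eq_iff l l' unfolding lifts_def by blast
  then show ?thesis
    using tendsto_diff [OF averaged_edge_tendsto [OF \<phi> l] averaged_edge_tendsto [OF \<phi> l']] by simp
qed

theorem abs_kronecker_le_of_cohomologous:
  assumes z: "rrelcycle 2 Y A z" and \<psi>: "bcocycle 2 Y A \<psi>"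
    and \<omega>: "cochain_bound 2 Y \<omega> C" and cohom: "bcohomologous 2 Y {} \<psi> \<omega>"
  shows "\<bar>kronecker z \<psi>\<bar> \<le> C * l1norm z"
proof -
  obtain \<phi> B where \<phi>: "cochain_bound 1 Y \<phi> B"
    and \<psi>_eq: "\<And>\<sigma>. singular_simplex 2 Y \<sigma> \<Longrightarrow> \<psi> \<sigma> = \<omega> \<sigma> + cobd 1 \<phi> \<sigma>"
    using cohom unfolding bcohomologous_def bounded_cochain_iff by (auto simp: algebra_simps)
  have \<phi>_A: "cochain_bound 1 (subtopology Y A) \<phi> B"
    using \<phi> by (simp add: cochain_bound_def singular_simplex_subtopology)
  have cocycle: "cocycle 2 Y \<psi>" and vanish: "vanishing_cochain 2 (subtopology Y A) \<psi>"
    using \<psi> by (simp_all add: bcocycle_iff)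
  define \<phi>' where "\<phi>' = (\<lambda>N e. averaged_edge N \<phi> e - averaged_prism N \<psi> e)"
  define \<beta> where "\<beta> = (\<lambda>N e. \<phi>' N e - \<phi>' N (reverse_edge e))"
  have averaged: "\<psi> \<sigma> = averaged_triangle N \<omega> \<sigma> + cobd 1 (\<phi>' N) \<sigma>"
    if \<sigma>: "singular_simplex 2 Y \<sigma>" and N: "N > 0" for \<sigma> N
  proof -
    have "averaged_triangle N \<psi> \<sigma> = averaged_triangle N (\<lambda>\<sigma>. \<omega> \<sigma> + cobd 1 \<phi> \<sigma>) \<sigma>"
      by (rule averaged_triangle_cong [OF \<psi>_eq \<sigma>])
    then show ?thesis
      unfolding averaged_triangle_cocycle [OF cocycle \<sigma> N] averaged_triangle_add
        averaged_triangle_cobd [OF \<sigma> N] \<phi>'_def cobd_diff by linarith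
  qed
  have bound: "2 * \<bar>kronecker z \<psi>\<bar> \<le> 2 * C * l1norm z + \<bar>kronecker (rbd 2 z) (\<beta> N)\<bar>" if N: "N > 0" for N
    unfolding \<beta>_def
    by (rule abs_kronecker_le_antisymmetrised [OF z \<psi> cochain_bound_averaged_triangle [OF \<omega>] averaged [OF _ N]])
  have "(\<lambda>N. \<beta> N e) \<longlonglongrightarrow> 0" if e: "singular_simplex 1 (subtopology Y A) e" for e
    using averaged_edge_reverse_tendsto [OF \<phi>_A e] vanishing_cochainD [OF vanishing_averaged_prism [OF vanish]]
      e singular_simplex_reverse_edge [OF e] by (simp add: \<beta>_def \<phi>'_def del: One_nat_def)
  then have "(\<lambda>N. kronecker (rbd 2 z) (\<beta> N)) \<longlonglongrightarrow> kronecker (rbd 2 z) (\<lambda>_. 0)"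
    using z by (intro tendsto_kronecker) (auto simp: rrelcycle_def rchain_def)
  then have "(\<lambda>N. 2 * C * l1norm z + \<bar>kronecker (rbd 2 z) (\<beta> N)\<bar>) \<longlonglongrightarrow> 2 * C * l1norm z + \<bar>0\<bar>"
    unfolding kronecker_zero_right by (intro tendsto_intros)
  then have "2 * \<bar>kronecker z \<psi>\<bar> \<le> 2 * C * l1norm z + \<bar>0\<bar>"
    by (rule LIMSEQ_le_const) (use bound in \<open>auto intro!: exI [of _ 1]\<close>)
  then show ?thesis by simp
qed

end

section \<open>Bounded primitives on the circles\<close>

lemma bounded_int_cocycle_primitive:
  fixes f :: "int \<Rightarrow> int \<Rightarrow> real"
  assumes B: "\<And>a b. \<bar>f a b\<bar> \<le> B"
    and cocycle: "\<And>a b c. f b c - f (a + b) c + f a (b + c) - f a b = 0"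
  obtains \<Phi> where "\<And>a. \<bar>\<Phi> a\<bar> \<le> B" "\<And>a b. f a b = \<Phi> b - \<Phi> (a + b) + \<Phi> a"
proof -
  have defect: "(\<lambda>N. mean N (f b) - mean N (f (a + b)) + mean N (f a)) \<longlonglongrightarrow> f a b" for a b
  proof -
    have "f a b - (mean N (\<lambda>n. f a (n + b)) - mean N (f a)) = mean N (f b) - mean N (f (a + b)) + mean N (f a)"
      if "N > 0" for N
    proof -
      have "mean N (\<lambda>n. f a b) = mean N (\<lambda>n. f b n - f (a + b) n + f a (n + b))"
        using cocycle [of b _ a] by (intro arg_cong [of _ _ "mean N"]) (auto simp: fun_eq_iff algebra_simps)
      then show ?thesis using that by (simp add: mean_const mean_add mean_diff)
    qed
    then have "eventually (\<lambda>N. f a b - (mean N (\<lambda>n. f a (n + b)) - mean N (f a))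
        = mean N (f b) - mean N (f (a + b)) + mean N (f a)) sequentially"
      using eventually_gt_at_top [of 0] by (rule eventually_mono [rotated])
    moreover have "(\<lambda>N. f a b - (mean N (\<lambda>n. f a (n + b)) - mean N (f a))) \<longlonglongrightarrow> f a b - 0"
      by (intro tendsto_diff tendsto_const mean_shift_tendsto [of "f a" B, OF B])
    ultimately show ?thesis unfolding diff_0_right by (rule Lim_transform_eventually [rotated])
  qed
  have bounded: "\<bar>mean N (f a)\<bar> \<le> B" for N a by (rule abs_mean_le [OF B])
  obtain r where r: "strict_mono (r :: nat \<Rightarrow> nat)" "\<And>a. a \<in> UNIV \<Longrightarrow> \<exists>l. (\<lambda>n. mean (r n) (f a)) \<longlonglongrightarrow> l"
    using function_convergent_subsequence [of "UNIV :: int set" "\<lambda>N a. mean N (f a)" B] bounded by auto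
  then obtain \<Phi> where \<Phi>: "\<And>a. (\<lambda>n. mean (r n) (f a)) \<longlonglongrightarrow> \<Phi> a" by (metis UNIV_I)
  have "\<bar>\<Phi> a\<bar> \<le> B" for a
    by (rule LIMSEQ_le_const2 [OF tendsto_rabs [OF \<Phi>]]) (use bounded in auto)
  moreover have "f a b = \<Phi> b - \<Phi> (a + b) + \<Phi> a" for a b
    by (rule LIMSEQ_unique [OF LIMSEQ_subseq_LIMSEQ [OF defect r(1), unfolded o_def]
          tendsto_add [OF tendsto_diff [OF \<Phi> \<Phi>] \<Phi>]])
  ultimately show ?thesis by (rule that)
qed

context circle_family
begin

definition component :: "'b \<Rightarrow> nat" where
  "component v = (THE j. j < k \<and> v \<in> range (circ j))"

lemma component_circ: "j < k \<Longrightarrow> component (circ j s) = j"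
  unfolding component_def using circ_eq_iff by (intro the_equality) auto

lemma of_int_winding_face:
  assumes "lifts 2 \<sigma> j g" "i \<le> 2"
  shows "of_int (winding (singular_face 2 i \<sigma>)) = turns \<sigma> g (skip i 1) - turns \<sigma> g (skip i 0)"
  using of_int_winding [OF lifts_face [of 1 \<sigma> j g i]] assms turns_face [of _ 1 i \<sigma> g]
  by (simp add: numeral_2_eq_2)

lemma winding_cocycle:
  assumes "lifts 2 \<sigma> j g"
  shows "winding (singular_face 2 1 \<sigma>) = winding (singular_face 2 2 \<sigma>) + winding (singular_face 2 0 \<sigma>)"
proof -
  have "real_of_int (winding (singular_face 2 1 \<sigma>))
      = of_int (winding (singular_face 2 2 \<sigma>) + winding (singular_face 2 0 \<sigma>))"
    using of_int_winding_face [OF assms, of 0] of_int_winding_face [OF assms, of 1] of_int_winding_face [OF assms, of 2]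
    by (simp add: skip_def numeral_2_eq_2)
  then show ?thesis by (simp only: of_int_eq_iff)
qed

lemma slid_triangle_eq_line:
  assumes l: "lifts 2 \<sigma> j g"
  shows "slid 2 \<sigma> [0, 0, 0]
    = line j [0, of_int (winding (singular_face 2 2 \<sigma>)), of_int (winding (singular_face 2 2 \<sigma>) + winding (singular_face 2 0 \<sigma>))]"
proof -
  have "slid 2 \<sigma> [0, 0, 0] = line j [turns \<sigma> g 0, turns \<sigma> g 1, turns \<sigma> g 2]"
    unfolding slid_eq_line [OF l] by (simp add: numeral_2_eq_2)
  also have "\<dots> = line j (map (\<lambda>t. t + turns \<sigma> g 0)
      [0, of_int (winding (singular_face 2 2 \<sigma>)), of_int (winding (singular_face 2 2 \<sigma>) + winding (singular_face 2 0 \<sigma>))])"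
    using of_int_winding_face [OF l, of 0] of_int_winding_face [OF l, of 2] by (simp add: skip_def numeral_2_eq_2)
  also have "\<dots> = line j [0, of_int (winding (singular_face 2 2 \<sigma>)),
      of_int (winding (singular_face 2 2 \<sigma>) + winding (singular_face 2 0 \<sigma>))]"
    using l turns_Ints [OF l, of 0] by (intro line_shift) (auto simp: lifts_def)
  finally show ?thesis .
qed

lemma cocycle_line:
  assumes \<psi>: "cocycle 2 (subtopology Y A) \<psi>" and j: "j < k"
  shows "\<psi> (line j [0, of_int b, of_int (b + c)]) - \<psi> (line j [0, of_int (a + b), of_int ((a + b) + c)])
     + \<psi> (line j [0, of_int a, of_int (a + (b + c))]) - \<psi> (line j [0, of_int a, of_int (a + b)]) = 0"
proof -
  have "cobd 2 \<psi> (line j [0, of_int a, of_int (a + b), of_int (a + b + c)]) = 0"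
    by (intro cocycleD [OF \<psi>] singular_simplex_line j) simp
  moreover have "line j [of_int a, of_int (a + b), of_int (a + b + c)] = line j [0, of_int b, of_int (b + c)]"
    using line_shift [OF j, of "of_int a" "[0, of_int b, of_int (b + c)]" 2] by (simp add: add_ac)
  ultimately show ?thesis unfolding line_def by (simp add: cobd_2_prism_simplex add.assoc)
qed

lemma bounded_primitive_on_lines:
  assumes \<psi>: "cocycle 2 (subtopology Y A) \<psi>" and B: "cochain_bound 2 (subtopology Y A) \<psi> B"
  obtains \<Phi> :: "nat \<Rightarrow> int \<Rightarrow> real" where "\<And>j a. j < k \<Longrightarrow> \<bar>\<Phi> j a\<bar> \<le> B"
    "\<And>j a b. j < k \<Longrightarrow> \<psi> (line j [0, of_int a, of_int (a + b)]) = \<Phi> j b - \<Phi> j (a + b) + \<Phi> j a"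
proof -
  define f where "f = (\<lambda>j (a::int) (b::int). \<psi> (line j [0, of_int a, of_int (a + b)]))"
  have "\<exists>\<Phi>. (\<forall>a. \<bar>\<Phi> a\<bar> \<le> B) \<and> (\<forall>a b. f j a b = \<Phi> b - \<Phi> (a + b) + \<Phi> a)" if j: "j < k" for j
  proof (rule bounded_int_cocycle_primitive [of "f j" B])
    show "\<bar>f j a b\<bar> \<le> B" for a b
      unfolding f_def by (intro cochain_boundD [OF B] singular_simplex_line j) simp
    show "f j b c - f j (a + b) c + f j a (b + c) - f j a b = 0" for a b c
      unfolding f_def by (rule cocycle_line [OF \<psi> j])
  qed blast
  then obtain \<Phi> where "\<And>j a. j < k \<Longrightarrow> \<bar>\<Phi> j a\<bar> \<le> B"
    "\<And>j a b. j < k \<Longrightarrow> f j a b = \<Phi> j b - \<Phi> j (a + b) + \<Phi> j a" by metis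
  then show ?thesis unfolding f_def by (rule that)
qed

theorem bounded_primitive_on_circles:
  assumes \<psi>: "cocycle 2 (subtopology Y A) \<psi>" and B: "cochain_bound 2 (subtopology Y A) \<psi> B"
  obtains \<phi> where "cochain_bound 1 (subtopology Y A) \<phi> (3 * B)"
    "\<And>\<sigma>. singular_simplex 2 (subtopology Y A) \<sigma> \<Longrightarrow> \<psi> \<sigma> = cobd 1 \<phi> \<sigma>"
proof -
  obtain \<Phi> where \<Phi>: "\<And>j a. j < k \<Longrightarrow> \<bar>\<Phi> j a\<bar> \<le> B"
    "\<And>j a b. j < k \<Longrightarrow> \<psi> (line j [0, of_int a, of_int (a + b)]) = \<Phi> j b - \<Phi> j (a + b) + \<Phi> j a"
    by (rule bounded_primitive_on_lines [OF assms]) (rule that)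
  define F where "F = (\<lambda>e. \<Phi> (component (e (vertex 0))) (winding e))"
  have F: "F e = \<Phi> j (winding e)" if "lifts 1 e j g" for e j g
    using that component_circ by (simp add: F_def lifts_def)
  define P where "P = (\<lambda>e. prism_cochain \<psi> (slide 1 e [0, 0]))"
  have "cochain_bound 1 (subtopology Y A) (\<lambda>e. F e - P e) (3 * B)"
    unfolding cochain_bound_def
  proof (intro allI impI)
    fix e assume e: "singular_simplex 1 (subtopology Y A) e"
    obtain j g where l: "lifts 1 e j g" using lifts_exist [OF e] by blast
    then have "\<bar>F e\<bar> \<le> B" unfolding F [OF l] by (intro \<Phi>(1)) (simp add: lifts_def)
    moreover have "\<bar>P e\<bar> \<le> 2 * B" unfolding P_def by (rule abs_prism_cochain_slide_le [OF B e])
    ultimately show "\<bar>F e - P e\<bar> \<le> 3 * B" by linarith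
  qed
  moreover have "\<psi> \<sigma> = cobd 1 (\<lambda>e. F e - P e) \<sigma>" if \<sigma>: "singular_simplex 2 (subtopology Y A) \<sigma>" for \<sigma>
  proof -
    obtain j g where l: "lifts 2 \<sigma> j g" using lifts_exist [OF \<sigma>] by blast
    then have j: "j < k" by (simp add: lifts_def)
    have "singular_simplex 2 Y \<sigma>" using \<sigma> by (simp add: singular_simplex_subtopology)
    from cocycle_slid [OF \<psi> this simplex_homotopy_slide_in_A [OF \<sigma>], of 0 0 0]
    have "\<psi> \<sigma> = \<psi> (slid 2 \<sigma> [0, 0, 0]) - cobd 1 P \<sigma>" unfolding cobd_1 P_def by simp
    also have "\<psi> (slid 2 \<sigma> [0, 0, 0]) = \<Phi> j (winding (singular_face 2 0 \<sigma>))
        - \<Phi> j (winding (singular_face 2 1 \<sigma>)) + \<Phi> j (winding (singular_face 2 2 \<sigma>))"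
      unfolding slid_triangle_eq_line [OF l] winding_cocycle [OF l] by (rule \<Phi>(2) [OF j])
    also have "\<dots> = cobd 1 F \<sigma>"
      using F [OF lifts_face [of 1 \<sigma> j g]] l unfolding cobd_1 by (simp add: numeral_2_eq_2)
    finally show ?thesis unfolding cobd_diff .
  qed
  ultimately show ?thesis by (rule that)
qed

end

section \<open>The Hahn--Banach theorem\<close>

definition sublinear :: "('v::real_vector \<Rightarrow> real) \<Rightarrow> bool" where
  "sublinear q \<longleftrightarrow> (\<forall>x y. q (x + y) \<le> q x + q y) \<and> (\<forall>x. \<forall>r>0. q (r *\<^sub>R x) \<le> r * q x)"

lemma sublinear_add: "sublinear q \<Longrightarrow> q (x + y) \<le> q x + q y"
  by (simp add: sublinear_def)

lemma sublinear_scaleR_le: "\<lbrakk>sublinear q; r > 0\<rbrakk> \<Longrightarrow> q (r *\<^sub>R x) \<le> r * q x"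
  by (simp add: sublinear_def)

lemma sublinear_scaleR:
  assumes "sublinear q" "r > 0"
  shows "q (r *\<^sub>R x) = r * q x"
proof (rule antisym [OF sublinear_scaleR_le [OF assms]])
  have "q ((1 / r) *\<^sub>R (r *\<^sub>R x)) \<le> (1 / r) * q (r *\<^sub>R x)"
    using assms by (intro sublinear_scaleR_le) auto
  then show "r * q x \<le> q (r *\<^sub>R x)" using assms(2) by (simp add: field_simps)
qed

lemma sublinear_zero: "sublinear q \<Longrightarrow> q 0 = 0"
  using sublinear_scaleR [of q 2 0] by simp

lemma sublinear_minus_le: "sublinear q \<Longrightarrow> - q (- x) \<le> q x"
  using sublinear_add [of q x "- x"] sublinear_zero [of q] by simp

text \<open>The largest sublinear functional below \<open>q\<close> whose value at \<open>- y\<close> is at most \<open>- q y\<close>.\<close>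

definition lowered :: "('v::real_vector \<Rightarrow> real) \<Rightarrow> 'v \<Rightarrow> 'v \<Rightarrow> real" where
  "lowered q y x = (INF t\<in>{0..}. q (x + t *\<^sub>R y) - t * q y)"

lemma lowered_le:
  assumes q: "sublinear q" and "t \<ge> 0"
  shows "lowered q y x \<le> q (x + t *\<^sub>R y) - t * q y"
  unfolding lowered_def
proof (rule cINF_lower [OF bdd_belowI2])
  fix t :: real assume "t \<in> {0..}"
  then have "t * q y = q (t *\<^sub>R y)"
    using sublinear_scaleR [OF q, of t y] sublinear_zero [OF q] by (cases "t = 0") auto
  then show "- q (- x) \<le> q (x + t *\<^sub>R y) - t * q y"
    using sublinear_add [OF q, of "x + t *\<^sub>R y" "- x"] by simp
qed (use assms in auto)

lemma le_lowered:
  assumes "\<And>t. t \<ge> 0 \<Longrightarrow> c \<le> q (x + t *\<^sub>R y) - t * q y"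
  shows "c \<le> lowered q y x"
  unfolding lowered_def using assms by (intro cINF_greatest) auto

lemma lowered_le_self: "sublinear q \<Longrightarrow> lowered q y x \<le> q x"
  using lowered_le [of q 0 y x] by simp

lemma lowered_minus_le: "sublinear q \<Longrightarrow> lowered q y (- y) \<le> - q y"
  using lowered_le [of q 1 y "- y"] sublinear_zero [of q] by simp

lemma sublinear_lowered:
  assumes q: "sublinear q"
  shows "sublinear (lowered q y)"
  unfolding sublinear_def
proof (intro conjI allI impI)
  fix x x'
  have "lowered q y (x + x') - (q (x' + t *\<^sub>R y) - t * q y) \<le> q (x + s *\<^sub>R y) - s * q y"
    if "s \<ge> 0" "t \<ge> 0" for s t
  proof -
    have "lowered q y (x + x') \<le> q ((x + x') + (s + t) *\<^sub>R y) - (s + t) * q y"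
      using that by (intro lowered_le q) auto
    also have "(x + x') + (s + t) *\<^sub>R y = (x + s *\<^sub>R y) + (x' + t *\<^sub>R y)"
      by (simp add: algebra_simps)
    also have "q \<dots> \<le> q (x + s *\<^sub>R y) + q (x' + t *\<^sub>R y)" by (rule sublinear_add [OF q])
    finally show ?thesis by (simp add: algebra_simps)
  qed
  then have "lowered q y (x + x') - (q (x' + t *\<^sub>R y) - t * q y) \<le> lowered q y x" if "t \<ge> 0" for t
    using that by (intro le_lowered) auto
  then have "lowered q y (x + x') - lowered q y x \<le> lowered q y x'"
    by (intro le_lowered) (simp add: algebra_simps)
  then show "lowered q y (x + x') \<le> lowered q y x + lowered q y x'" by simp
next
  fix x and r :: real assume r: "r > 0"
  have "lowered q y (r *\<^sub>R x) / r \<le> q (x + t *\<^sub>R y) - t * q y" if "t \<ge> 0" for t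
  proof -
    have "lowered q y (r *\<^sub>R x) \<le> q (r *\<^sub>R x + (r * t) *\<^sub>R y) - (r * t) * q y"
      using that r by (intro lowered_le q) auto
    also have "r *\<^sub>R x + (r * t) *\<^sub>R y = r *\<^sub>R (x + t *\<^sub>R y)" by (simp add: scaleR_right_distrib)
    also have "q \<dots> = r * q (x + t *\<^sub>R y)" by (rule sublinear_scaleR [OF q r])
    finally show ?thesis using r by (simp add: field_simps)
  qed
  then have "lowered q y (r *\<^sub>R x) / r \<le> lowered q y x" by (rule le_lowered)
  then show "lowered q y (r *\<^sub>R x) \<le> r * lowered q y x" using r by (simp add: field_simps)
qed

lemma INF_chain_le:
  assumes C: "\<And>q. q \<in> C \<Longrightarrow> sublinear q \<and> q \<le> p" and "q \<in> C"
  shows "(INF q\<in>C. q x) \<le> q x"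
proof (rule cINF_lower [OF bdd_belowI2 assms(2)])
  fix q assume "q \<in> C"
  then have q: "sublinear q" "q (- x) \<le> p (- x)" using C by (auto dest: le_funD)
  then show "- p (- x) \<le> q x" using sublinear_minus_le [OF q(1), of x] by linarith
qed

lemma sublinear_INF_chain:
  assumes C: "\<And>q. q \<in> C \<Longrightarrow> sublinear q \<and> q \<le> p" "C \<noteq> {}"
    and chain: "\<And>q q'. \<lbrakk>q \<in> C; q' \<in> C\<rbrakk> \<Longrightarrow> q \<le> q' \<or> q' \<le> q"
  shows "sublinear (\<lambda>x. INF q\<in>C. q x)"
proof -
  let ?u = "\<lambda>x. INF q\<in>C. q x"
  have u_le: "?u x \<le> q x" if "q \<in> C" for q x by (rule INF_chain_le [OF C(1) that])
  have le_u: "c \<le> ?u x" if "\<And>q. q \<in> C \<Longrightarrow> c \<le> q x" for c x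
    using C(2) that by (rule cINF_greatest)
  have "?u (x + y) \<le> ?u x + ?u y" for x y
  proof -
    have "?u (x + y) - q' y \<le> q x" if qq': "q \<in> C" "q' \<in> C" for q q'
    proof -
      obtain r where r: "r \<in> C" "r \<le> q" "r \<le> q'" using chain [OF qq'] qq' by blast
      have "?u (x + y) \<le> r (x + y)" by (rule u_le [OF r(1)])
      also have "\<dots> \<le> r x + r y" using C(1) [OF r(1)] by (simp add: sublinear_add)
      also have "\<dots> \<le> q x + q' y" by (rule add_mono [OF le_funD [OF r(2)] le_funD [OF r(3)]])
      finally show ?thesis by simp
    qed
    then have "?u (x + y) - q' y \<le> ?u x" if "q' \<in> C" for q' using that by (intro le_u)
    then have "?u (x + y) - ?u x \<le> ?u y" by (intro le_u) (simp add: algebra_simps)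
    then show ?thesis by simp
  qed
  moreover have "?u (r *\<^sub>R x) \<le> r * ?u x" if r: "r > 0" for x r
  proof -
    have "?u (r *\<^sub>R x) / r \<le> q x" if q: "q \<in> C" for q
    proof -
      have "?u (r *\<^sub>R x) \<le> q (r *\<^sub>R x)" by (rule u_le [OF q])
      also have "\<dots> \<le> r * q x" using C(1) [OF q] r by (simp add: sublinear_scaleR_le)
      finally show ?thesis using r by (simp add: field_simps)
    qed
    then have "?u (r *\<^sub>R x) / r \<le> ?u x" by (rule le_u)
    then show ?thesis using r by (simp add: field_simps)
  qed
  ultimately show ?thesis by (simp add: sublinear_def)
qed

lemma minimal_sublinear_exists:
  assumes p: "sublinear p"
  obtains q where "sublinear q" "q \<le> p" "\<And>q'. \<lbrakk>sublinear q'; q' \<le> q\<rbrakk> \<Longrightarrow> q' = q"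
proof -
  define S where "S = {q. sublinear q \<and> q \<le> p}"
  have "\<exists>m\<in>S. \<forall>q\<in>S. m \<ge> q \<longrightarrow> q = m"
  proof (rule predicate_Zorn)
    show "partial_order_on S (relation_of (\<ge>) S)"
      by (rule partial_order_on_relation_ofI) auto
    fix C assume "C \<in> Chains (relation_of (\<ge>) S)"
    then have C: "C \<subseteq> S" and chain: "\<And>q q'. \<lbrakk>q \<in> C; q' \<in> C\<rbrakk> \<Longrightarrow> q \<le> q' \<or> q' \<le> q"
      by (auto simp: Chains_def relation_of_def)
    show "\<exists>u\<in>S. \<forall>q\<in>C. q \<ge> u"
    proof (cases "C = {}")
      case True
      then show ?thesis using p by (auto simp: S_def)
    next
      case False
      let ?u = "\<lambda>x. INF q\<in>C. q x"
      have CS: "sublinear q \<and> q \<le> p" if "q \<in> C" for q using C that by (auto simp: S_def)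
      have lower: "?u \<le> q" if "q \<in> C" for q using INF_chain_le [OF CS that] by (intro le_funI)
      obtain q where "q \<in> C" using False by blast
      then have "?u \<le> p" using lower CS order_trans by blast
      then have "?u \<in> S" using sublinear_INF_chain [OF CS False chain] by (simp add: S_def)
      then show ?thesis using lower by blast
    qed
  qed
  then obtain m where m: "m \<in> S" "\<And>q. \<lbrakk>q \<in> S; q \<le> m\<rbrakk> \<Longrightarrow> q = m" by blast
  show ?thesis
  proof (rule that)
    show "sublinear m" "m \<le> p" using m(1) by (simp_all add: S_def)
    show "q' = m" if "sublinear q'" "q' \<le> m" for q'
      using m that order_trans [OF that(2)] by (auto simp: S_def)
  qed
qed

lemma linear_if_minimal_sublinear:
  assumes q: "sublinear q" and minimal: "\<And>q'. \<lbrakk>sublinear q'; q' \<le> q\<rbrakk> \<Longrightarrow> q' = q"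
  shows "linear q"
proof -
  have add: "q (x + y) = q x + q y" for x y
  proof (rule antisym [OF sublinear_add [OF q]])
    have "lowered q y = q"
      using minimal [OF sublinear_lowered [OF q]] lowered_le_self [OF q] by (simp add: le_fun_def)
    then show "q x + q y \<le> q (x + y)" using lowered_le [OF q, of 1 y x] by simp
  qed
  have minus: "q (- x) = - q x" for x
    using add [of x "- x"] sublinear_zero [OF q] by simp
  have "q (r *\<^sub>R x) = r * q x" for r x
  proof (cases r "0 :: real" rule: linorder_cases)
    case less
    then show ?thesis using sublinear_scaleR [OF q, of "- r" x] minus [of "r *\<^sub>R x"] by simp
  next
    case greater
    then show ?thesis by (rule sublinear_scaleR [OF q])
  qed (simp add: sublinear_zero [OF q])
  then show ?thesis using add by (intro linearI) auto
qed

theorem hahn_banach: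
  assumes p: "sublinear p"
  obtains f where "linear f" "\<And>x. f x \<le> p x" "f z = p z"
proof -
  obtain f where f: "sublinear f" "f \<le> lowered p z" "\<And>q. \<lbrakk>sublinear q; q \<le> f\<rbrakk> \<Longrightarrow> q = f"
    using minimal_sublinear_exists [OF sublinear_lowered [OF p]] by blast
  have linear: "linear f" by (rule linear_if_minimal_sublinear [OF f(1,3)])
  have le: "f x \<le> p x" for x using le_funD [OF f(2), of x] lowered_le_self [OF p, of z x] by linarith
  have "f (- z) \<le> - p z" using le_funD [OF f(2), of "- z"] lowered_minus_le [OF p, of z] by linarith
  then have "f z = p z" using le [of z] linear_neg [OF linear, of z] by simp
  with linear le show ?thesis by (rule that)
qed

lemma sublinear_infdist:
  fixes W :: "'v::real_normed_vector set"
  assumes W: "subspace W"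
  shows "sublinear (\<lambda>x. infdist x W)"
proof -
  have "W \<noteq> {}" using subspace_0 [OF W] by blast
  have le_infdist: "c \<le> infdist x W" if "\<And>w. w \<in> W \<Longrightarrow> c \<le> dist x w" for c x
    unfolding infdist_notempty [OF \<open>W \<noteq> {}\<close>] using \<open>W \<noteq> {}\<close> that by (rule cINF_greatest)
  have "infdist (x + y) W \<le> infdist x W + infdist y W" for x y
  proof -
    have "infdist (x + y) W \<le> dist x w + dist y w'" if "w \<in> W" "w' \<in> W" for w w'
      using infdist_le2 [OF subspace_add [OF W that] dist_triangle_add] .
    then have "infdist (x + y) W - dist y w' \<le> infdist x W" if "w' \<in> W" for w'
      using that by (intro le_infdist) (simp add: algebra_simps)
    then have "infdist (x + y) W - infdist x W \<le> infdist y W"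
      by (intro le_infdist) (simp add: algebra_simps)
    then show ?thesis by simp
  qed
  moreover have "infdist (r *\<^sub>R x) W \<le> r * infdist x W" if r: "r > 0" for r x
  proof -
    have "infdist (r *\<^sub>R x) W / r \<le> dist x w" if "w \<in> W" for w
    proof -
      have "infdist (r *\<^sub>R x) W \<le> dist (r *\<^sub>R x) (r *\<^sub>R w)" by (rule infdist_le [OF subspace_scale [OF W that]])
      also have "\<dots> = r * dist x w" using r by (simp add: dist_norm flip: scaleR_right_diff_distrib)
      finally show ?thesis using r by (simp add: field_simps)
    qed
    then have "infdist (r *\<^sub>R x) W / r \<le> infdist x W" by (rule le_infdist)
    then show ?thesis using r by (simp add: field_simps)
  qed
  ultimately show ?thesis by (simp add: sublinear_def)
qed

theorem hahn_banach_infdist: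
  fixes W :: "'v::real_normed_vector set"
  assumes W: "subspace W"
  obtains f :: "'v \<Rightarrow> real" where "linear f" "\<And>x. \<bar>f x\<bar> \<le> norm x" "\<And>w. w \<in> W \<Longrightarrow> f w = 0" "f z = infdist z W"
proof -
  obtain f where f: "linear f" "\<And>x. f x \<le> infdist x W" "f z = infdist z W"
    using hahn_banach [OF sublinear_infdist [OF W]] by blast
  note neg = linear_neg [OF f(1)]
  have "\<bar>f x\<bar> \<le> norm x" for x
    using f(2) [of x] f(2) [of "- x"] infdist_le [OF subspace_0 [OF W], of x] infdist_le [OF subspace_0 [OF W], of "- x"]
    by (simp add: neg)
  moreover have "f w = 0" if "w \<in> W" for w
    using f(2) [of w] f(2) [of "- w"] that subspace_neg [OF W that] by (simp add: neg)
  ultimately show ?thesis using that f by blast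
qed

section \<open>Norm-attaining relative cocycles\<close>

text \<open>Finitely supported chains form the normed space \<open>'b ssimplex \<Rightarrow>\<^sub>0 real\<close>, whose norm is the
  \<open>\<ell>\<^sup>1\<close>-norm; the Gromov norm of a class is its distance from the subspace of relative boundaries.\<close>

definition relative_boundaries :: "nat \<Rightarrow> 'b topology \<Rightarrow> 'b set \<Rightarrow> ('b ssimplex \<Rightarrow>\<^sub>0 real) set" where
  "relative_boundaries p Y A = {w. \<exists>b a. rchain (Suc p) Y b \<and> rchain p (subtopology Y A) a \<and>
     Poly_Mapping.lookup w = (\<lambda>\<sigma>. rbd (Suc p) b \<sigma> + a \<sigma>)}"

lemma lookup_scaleR: "Poly_Mapping.lookup (r *\<^sub>R c) \<sigma> = r * Poly_Mapping.lookup c \<sigma>"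
proof -
  have "{\<sigma>. r * Poly_Mapping.lookup c \<sigma> \<noteq> 0} \<subseteq> {\<sigma>. Poly_Mapping.lookup c \<sigma> \<noteq> 0}" by auto
  then have "finite {\<sigma>. r * Poly_Mapping.lookup c \<sigma> \<noteq> 0}" by (rule finite_subset) simp
  then show ?thesis by (simp add: scaleR_poly_mapping_def)
qed

lemma norm_eq_l1norm: "norm c = l1norm (Poly_Mapping.lookup c)"
  by (simp add: norm_poly_mapping_def dist_poly_mapping_def l1norm_def keys.rep_eq)

lemma subspace_relative_boundaries: "subspace (relative_boundaries p Y A)"
  unfolding subspace_def
proof (intro conjI ballI allI)
  show "0 \<in> relative_boundaries p Y A"
    unfolding relative_boundaries_def
    by (intro CollectI exI [of _ "\<lambda>_. 0"]) (simp add: rchain_zero rbd_zero fun_eq_iff)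
next
  fix w w' assume "w \<in> relative_boundaries p Y A" "w' \<in> relative_boundaries p Y A"
  then obtain b a b' a' where "rchain (Suc p) Y b" "rchain p (subtopology Y A) a" "rchain (Suc p) Y b'"
    "rchain p (subtopology Y A) a'"
    and "Poly_Mapping.lookup w = (\<lambda>\<sigma>. rbd (Suc p) b \<sigma> + a \<sigma>)"
    "Poly_Mapping.lookup w' = (\<lambda>\<sigma>. rbd (Suc p) b' \<sigma> + a' \<sigma>)"
    by (auto simp: relative_boundaries_def)
  then show "w + w' \<in> relative_boundaries p Y A"
    unfolding relative_boundaries_def
    by (intro CollectI exI [of _ "\<lambda>\<sigma>. b \<sigma> + b' \<sigma>"] exI [of _ "\<lambda>\<sigma>. a \<sigma> + a' \<sigma>"])
      (simp add: rchain_add rbd_add [of _ Y b b'] lookup_add fun_eq_iff)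
next
  fix r w assume "w \<in> relative_boundaries p Y A"
  then obtain b a where "rchain (Suc p) Y b" "rchain p (subtopology Y A) a"
    and "Poly_Mapping.lookup w = (\<lambda>\<sigma>. rbd (Suc p) b \<sigma> + a \<sigma>)"
    by (auto simp: relative_boundaries_def)
  then show "r *\<^sub>R w \<in> relative_boundaries p Y A"
    unfolding relative_boundaries_def
    by (intro CollectI exI [of _ "\<lambda>\<sigma>. r * b \<sigma>"] exI [of _ "\<lambda>\<sigma>. r * a \<sigma>"])
      (simp add: rchain_scale rbd_scale lookup_scaleR fun_eq_iff distrib_left)
qed

lemma rhomologous_iff_relative_boundaries:
  "rhomologous p Y A (Poly_Mapping.lookup c) (Poly_Mapping.lookup z) \<longleftrightarrow> c - z \<in> relative_boundaries p Y A"
  by (simp add: rhomologous_def relative_boundaries_def lookup_minus fun_eq_iff)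

lemma gromov_norm_eq_infdist:
  assumes z: "rrelcycle (Suc p) Y A (Poly_Mapping.lookup z)"
  shows "gromov_norm (Suc p) Y A (Poly_Mapping.lookup z) = infdist z (relative_boundaries (Suc p) Y A)"
proof -
  let ?W = "relative_boundaries (Suc p) Y A"
  note neg = subspace_neg [OF subspace_relative_boundaries]
  have "{l1norm c |c. rrelcycle (Suc p) Y A c \<and> rhomologous (Suc p) Y A c (Poly_Mapping.lookup z)} = dist z ` ?W"
  proof (intro equalityI subsetI)
    fix r assume "r \<in> {l1norm c |c. rrelcycle (Suc p) Y A c \<and> rhomologous (Suc p) Y A c (Poly_Mapping.lookup z)}"
    then obtain c where c: "r = l1norm c" "finite {\<sigma>. c \<sigma> \<noteq> 0}" "rhomologous (Suc p) Y A c (Poly_Mapping.lookup z)"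
      by (auto simp: rrelcycle_def rchain_def)
    define c' where "c' = Abs_poly_mapping c"
    have c': "Poly_Mapping.lookup c' = c" using c(2) by (simp add: c'_def)
    then have "z - c' \<in> ?W" using c(3) neg [of "c' - z"] rhomologous_iff_relative_boundaries [of _ Y A c' z] by simp
    moreover have "r = dist z (z - c')" using c(1) c' by (simp add: dist_norm norm_eq_l1norm)
    ultimately show "r \<in> dist z ` ?W" by blast
  next
    fix r assume "r \<in> dist z ` ?W"
    then obtain w where w: "w \<in> ?W" "r = l1norm (Poly_Mapping.lookup (z - w))" by (auto simp: dist_norm norm_eq_l1norm)
    then have "rhomologous (Suc p) Y A (Poly_Mapping.lookup (z - w)) (Poly_Mapping.lookup z)"
      using neg by (simp add: rhomologous_iff_relative_boundaries)
    then show "r \<in> {l1norm c |c. rrelcycle (Suc p) Y A c \<and> rhomologous (Suc p) Y A c (Poly_Mapping.lookup z)}"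
      using rrelcycle_homologous [OF z] w(2) by blast
  qed
  moreover have "?W \<noteq> {}" using subspace_0 [OF subspace_relative_boundaries] by blast
  ultimately show ?thesis by (simp add: gromov_norm_def infdist_notempty)
qed

lemma linear_eq_kronecker:
  assumes "linear f"
  shows "f c = kronecker (Poly_Mapping.lookup c) (\<lambda>\<sigma>. f (Poly_Mapping.single \<sigma> 1))"
proof -
  have "c = (\<Sum>\<sigma>\<in>Poly_Mapping.keys c. Poly_Mapping.lookup c \<sigma> *\<^sub>R Poly_Mapping.single \<sigma> 1)"
    by (rule poly_mapping_eqI)
      (simp add: lookup_sum lookup_scaleR lookup_single when_def in_keys_iff if_distrib [of "\<lambda>x. _ * x"] cong: if_cong)
  then have "f c = f (\<Sum>\<sigma>\<in>Poly_Mapping.keys c. Poly_Mapping.lookup c \<sigma> *\<^sub>R Poly_Mapping.single \<sigma> 1)" by (rule arg_cong)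
  then show ?thesis
    by (simp add: linear_sum [OF assms] linear_scale [OF assms] kronecker_def keys.rep_eq)
qed

lemma single_in_relative_boundaries:
  assumes "singular_simplex p (subtopology Y A) \<sigma>"
  shows "Poly_Mapping.single \<sigma> 1 \<in> relative_boundaries p Y A"
proof -
  have "rchain p (subtopology Y A) (Poly_Mapping.lookup (Poly_Mapping.single \<sigma> 1))"
    using assms by (simp add: rchain_def lookup_single when_def)
  then show ?thesis unfolding relative_boundaries_def
    by (intro CollectI exI [of _ "\<lambda>_. 0"] exI [of _ "Poly_Mapping.lookup (Poly_Mapping.single \<sigma> 1)"])
      (simp add: rchain_zero rbd_zero)
qed

lemma boundary_in_relative_boundaries:
  assumes "rchain (Suc p) Y b"
  shows "Abs_poly_mapping (rbd (Suc p) b) \<in> relative_boundaries p Y A"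
  using assms finite_rbd_support [of b "Suc p"] unfolding relative_boundaries_def
  by (intro CollectI exI [of _ b] exI [of _ "\<lambda>_. 0"]) (simp add: rchain_def)

theorem norm_attaining_cocycle:
  assumes z: "rrelcycle (Suc p) Y A z"
  obtains \<psi> where "bcocycle (Suc p) Y A \<psi>" "cochain_bound (Suc p) Y \<psi> 1"
    "kronecker z \<psi> = gromov_norm (Suc p) Y A z"
proof -
  define z' where "z' = Abs_poly_mapping z"
  have z': "Poly_Mapping.lookup z' = z" using z by (simp add: z'_def rrelcycle_def rchain_def)
  obtain f where f: "linear f" "\<And>c. \<bar>f c\<bar> \<le> norm c" "\<And>w. w \<in> relative_boundaries (Suc p) Y A \<Longrightarrow> f w = 0"
    "f z' = infdist z' (relative_boundaries (Suc p) Y A)"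
    using hahn_banach_infdist [OF subspace_relative_boundaries] by blast
  define \<psi> where "\<psi> = (\<lambda>\<sigma>. f (Poly_Mapping.single \<sigma> 1))"
  have f_kronecker: "f c = kronecker (Poly_Mapping.lookup c) \<psi>" for c
    unfolding \<psi>_def by (rule linear_eq_kronecker [OF f(1)])
  have "\<bar>\<psi> \<sigma>\<bar> \<le> 1" for \<sigma>
    using f(2) [of "Poly_Mapping.single \<sigma> 1"] unfolding \<psi>_def
    by (simp add: norm_eq_l1norm l1norm_def lookup_single when_def)
  then have bound: "cochain_bound (Suc p) Y \<psi> 1" by (simp add: cochain_bound_def)
  have "vanishing_cochain (Suc p) (subtopology Y A) \<psi>"
    using f(3) [OF single_in_relative_boundaries] by (simp add: vanishing_cochain_def \<psi>_def)
  moreover have "cobd (Suc p) \<psi> \<tau> = 0" if \<tau>: "singular_simplex (Suc (Suc p)) Y \<tau>" for \<tau>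
  proof -
    define b :: "'a ssimplex \<Rightarrow> real" where "b = (\<lambda>\<sigma>. if \<sigma> = \<tau> then 1 else 0)"
    have b: "rchain (Suc (Suc p)) Y b" "finite {\<sigma>. b \<sigma> \<noteq> 0}" using \<tau> by (simp_all add: rchain_def b_def)
    have "cobd (Suc p) \<psi> \<tau> = kronecker b (cobd (Suc p) \<psi>)" by (simp add: kronecker_def b_def)
    also have "\<dots> = kronecker (rbd (Suc (Suc p)) b) \<psi>" by (rule kronecker_rbd [OF b(2), symmetric])
    also have "\<dots> = f (Abs_poly_mapping (rbd (Suc (Suc p)) b))"
      using finite_rbd_support [OF b(2)] by (simp add: f_kronecker)
    also have "\<dots> = 0" by (rule f(3) [OF boundary_in_relative_boundaries [OF b(1)]])
    finally show ?thesis .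
  qed
  ultimately have "bcocycle (Suc p) Y A \<psi>"
    using bound by (auto simp: bcocycle_iff bounded_cochain_iff cocycle_def vanishing_cochain_def)
  moreover have "kronecker z \<psi> = gromov_norm (Suc p) Y A z"
    using gromov_norm_eq_infdist [of p Y A z'] z f(4) f_kronecker [of z'] by (simp add: z')
  ultimately show ?thesis using bound that by blast
qed

section \<open>Bounded cohomology\<close>

lemma bounded_cochain_add:
  assumes "bounded_cochain p Y \<phi>" "bounded_cochain p Y \<phi>'"
  shows "bounded_cochain p Y (\<lambda>\<sigma>. \<phi> \<sigma> + \<phi>' \<sigma>)"
proof -
  obtain B B' where B: "cochain_bound p Y \<phi> B" "cochain_bound p Y \<phi>' B'"
    using assms by (auto simp: bounded_cochain_iff)
  have "\<bar>\<phi> \<sigma> + \<phi>' \<sigma>\<bar> \<le> B + B'" if "singular_simplex p Y \<sigma>" for \<sigma>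
    using cochain_boundD [OF B(1) that] cochain_boundD [OF B(2) that] by linarith
  then show ?thesis by (auto simp: bounded_cochain_def)
qed

lemma bounded_cochain_uminus: "bounded_cochain p Y \<phi> \<Longrightarrow> bounded_cochain p Y (\<lambda>\<sigma>. - \<phi> \<sigma>)"
  by (simp add: bounded_cochain_def)

lemma bounded_cochain_diff:
  "\<lbrakk>bounded_cochain p Y \<phi>; bounded_cochain p Y \<phi>'\<rbrakk> \<Longrightarrow> bounded_cochain p Y (\<lambda>\<sigma>. \<phi> \<sigma> - \<phi>' \<sigma>)"
  using bounded_cochain_add [of p Y \<phi> "\<lambda>\<sigma>. - \<phi>' \<sigma>"] bounded_cochain_uminus [of p Y \<phi>'] by simp

lemma bounded_cochain_cobd:
  assumes "bounded_cochain p Y \<phi>"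
  shows "bounded_cochain (Suc p) Y (cobd p \<phi>)"
proof -
  obtain B where B: "cochain_bound p Y \<phi> B" using assms by (auto simp: bounded_cochain_iff)
  have "\<bar>cobd p \<phi> \<sigma>\<bar> \<le> (\<Sum>k\<le>Suc p. B)" if \<sigma>: "singular_simplex (Suc p) Y \<sigma>" for \<sigma>
    unfolding cobd_def
    by (intro order_trans [OF sum_abs] sum_mono)
      (simp add: abs_mult cochain_boundD [OF B singular_simplex_face [OF \<sigma>]])
  then show ?thesis unfolding bounded_cochain_def by blast
qed

lemma cobd_zero: "cobd p (\<lambda>_. 0) \<sigma> = 0"
  by (simp add: cobd_def)

lemma cobd_uminus: "cobd p (\<lambda>\<sigma>. - \<phi> \<sigma>) \<sigma> = - cobd p \<phi> \<sigma>"
  using cobd_diff [of p "\<lambda>_. 0" \<phi> \<sigma>] by (simp add: cobd_zero)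

lemma bcohomologousI:
  assumes "bounded_cochain (p - 1) Y \<phi>" "vanishing_cochain (p - 1) (subtopology Y A) \<phi>"
    and "\<And>\<sigma>. singular_simplex p Y \<sigma> \<Longrightarrow> \<psi> \<sigma> - \<psi>' \<sigma> = cobd (p - 1) \<phi> \<sigma>"
  shows "bcohomologous p Y A \<psi> \<psi>'"
  using assms unfolding bcohomologous_def vanishing_cochain_def by blast

lemma bcohomologousE:
  assumes "bcohomologous p Y A \<psi> \<psi>'"
  obtains \<phi> where "bounded_cochain (p - 1) Y \<phi>" "vanishing_cochain (p - 1) (subtopology Y A) \<phi>"
    "\<And>\<sigma>. singular_simplex p Y \<sigma> \<Longrightarrow> \<psi> \<sigma> - \<psi>' \<sigma> = cobd (p - 1) \<phi> \<sigma>"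
  using assms unfolding bcohomologous_def vanishing_cochain_def by blast

lemma bcohomologous_cong:
  assumes "\<And>\<sigma>. singular_simplex p Y \<sigma> \<Longrightarrow> \<psi> \<sigma> = \<psi>' \<sigma>"
  shows "bcohomologous p Y A \<psi> \<psi>'"
  by (rule bcohomologousI [of _ _ "\<lambda>_. 0"]) (auto simp: assms bounded_cochain_def vanishing_cochain_def cobd_zero)

lemma bcohomologous_sym:
  assumes "bcohomologous p Y A \<psi> \<psi>'"
  shows "bcohomologous p Y A \<psi>' \<psi>"
proof -
  obtain \<phi> where \<phi>: "bounded_cochain (p - 1) Y \<phi>" "vanishing_cochain (p - 1) (subtopology Y A) \<phi>"
    "\<And>\<sigma>. singular_simplex p Y \<sigma> \<Longrightarrow> \<psi> \<sigma> - \<psi>' \<sigma> = cobd (p - 1) \<phi> \<sigma>"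
    by (rule bcohomologousE [OF assms]) (rule that)
  have "\<psi>' \<sigma> - \<psi> \<sigma> = cobd (p - 1) (\<lambda>\<tau>. - \<phi> \<tau>) \<sigma>" if "singular_simplex p Y \<sigma>" for \<sigma>
    using \<phi>(3) [OF that] unfolding cobd_uminus by linarith
  then show ?thesis
    using \<phi>(1,2) by (intro bcohomologousI [of _ _ "\<lambda>\<tau>. - \<phi> \<tau>"]) (auto simp: bounded_cochain_uminus vanishing_cochain_def)
qed

lemma bcohomologous_add:
  assumes "bcohomologous p Y A \<psi> \<psi>'" "bcohomologous p Y A \<omega> \<omega>'"
  shows "bcohomologous p Y A (\<lambda>\<sigma>. \<psi> \<sigma> + \<omega> \<sigma>) (\<lambda>\<sigma>. \<psi>' \<sigma> + \<omega>' \<sigma>)"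
proof -
  obtain \<phi> where \<phi>: "bounded_cochain (p - 1) Y \<phi>" "vanishing_cochain (p - 1) (subtopology Y A) \<phi>"
    "\<And>\<sigma>. singular_simplex p Y \<sigma> \<Longrightarrow> \<psi> \<sigma> - \<psi>' \<sigma> = cobd (p - 1) \<phi> \<sigma>"
    by (rule bcohomologousE [OF assms(1)]) (rule that)
  obtain \<phi>' where \<phi>': "bounded_cochain (p - 1) Y \<phi>'" "vanishing_cochain (p - 1) (subtopology Y A) \<phi>'"
    "\<And>\<sigma>. singular_simplex p Y \<sigma> \<Longrightarrow> \<omega> \<sigma> - \<omega>' \<sigma> = cobd (p - 1) \<phi>' \<sigma>"
    by (rule bcohomologousE [OF assms(2)]) (rule that)
  show ?thesis
  proof (rule bcohomologousI [of _ _ "\<lambda>\<tau>. \<phi> \<tau> + \<phi>' \<tau>"])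
    show "\<psi> \<sigma> + \<omega> \<sigma> - (\<psi>' \<sigma> + \<omega>' \<sigma>) = cobd (p - 1) (\<lambda>\<tau>. \<phi> \<tau> + \<phi>' \<tau>) \<sigma>" if "singular_simplex p Y \<sigma>" for \<sigma>
      using \<phi>(3) [OF that] \<phi>'(3) [OF that] unfolding cobd_add by linarith
  qed (use \<phi> \<phi>' in \<open>auto simp: bounded_cochain_add vanishing_cochain_def\<close>)
qed

lemma bcohomologous_trans [trans]:
  assumes "bcohomologous p Y A \<psi> \<psi>'" "bcohomologous p Y A \<psi>' \<psi>''"
  shows "bcohomologous p Y A \<psi> \<psi>''"
proof -
  have "bcohomologous p Y A (\<lambda>\<sigma>. \<psi> \<sigma> + \<psi>' \<sigma>) (\<lambda>\<sigma>. \<psi>' \<sigma> + \<psi>'' \<sigma>)"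
    by (rule bcohomologous_add [OF assms])
  then show ?thesis by (simp add: bcohomologous_def)
qed

lemma bcohomologous_diff_zero:
  assumes "bcohomologous p Y A \<psi> \<psi>'"
  shows "bcohomologous p Y A (\<lambda>\<sigma>. \<psi> \<sigma> - \<psi>' \<sigma>) (\<lambda>_. 0)"
  using assms by (simp add: bcohomologous_def)

lemma bcocycle_diff:
  assumes "bcocycle p Y A \<psi>" "bcocycle p Y A \<psi>'"
  shows "bcocycle p Y A (\<lambda>\<sigma>. \<psi> \<sigma> - \<psi>' \<sigma>)"
  using assms by (simp add: bcocycle_def bounded_cochain_diff cobd_diff)

lemma simplex_map_singular_face:
  "k \<le> Suc p \<Longrightarrow> simplex_map p f (singular_face (Suc p) k \<sigma>) = singular_face (Suc p) k (simplex_map (Suc p) f \<sigma>)"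
  using simplical_face_in_simplex [of _ p k] by (auto simp: singular_face_def simplex_map_def restrict_def)

lemma cobd_pullback: "cobd p (pullback p f \<phi>) \<sigma> = cobd p \<phi> (simplex_map (Suc p) f \<sigma>)"
  unfolding cobd_def pullback_def by (intro sum.cong) (simp_all add: simplex_map_singular_face)

lemma cochain_bound_pullback:
  "\<lbrakk>cochain_bound p Y \<phi> B; continuous_map X Y f\<rbrakk> \<Longrightarrow> cochain_bound p X (pullback p f \<phi>) B"
  using singular_simplex_simplex_map unfolding cochain_bound_def pullback_def by blast

lemma bounded_cochain_pullback:
  "\<lbrakk>bounded_cochain p Y \<phi>; continuous_map X Y f\<rbrakk> \<Longrightarrow> bounded_cochain p X (pullback p f \<phi>)"
  using cochain_bound_pullback unfolding bounded_cochain_iff by blast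

lemma vanishing_cochain_pullback:
  "\<lbrakk>vanishing_cochain p Y \<phi>; continuous_map X Y f\<rbrakk> \<Longrightarrow> vanishing_cochain p X (pullback p f \<phi>)"
  using singular_simplex_simplex_map unfolding vanishing_cochain_def pullback_def by blast

lemma cocycle_pullback:
  assumes "cocycle p Y \<psi>" "continuous_map X Y f"
  shows "cocycle p X (pullback p f \<psi>)"
  using assms singular_simplex_simplex_map [of "Suc p" X _ Y f]
  by (simp add: cocycle_def vanishing_cochain_def cobd_pullback)

lemma bcocycle_pullback:
  assumes "bcocycle p Y A \<psi>" "continuous_map X Y f" "f \<in> B \<rightarrow> A"
  shows "bcocycle p X B (pullback p f \<psi>)"
proof -
  have "continuous_map (subtopology X B) (subtopology Y A) f"
    using assms(2,3) by (auto simp: continuous_map_in_subtopology continuous_map_from_subtopology)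
  then show ?thesis
    using assms(1,2) bounded_cochain_pullback vanishing_cochain_pullback cocycle_pullback
    unfolding bcocycle_iff by blast
qed

lemma bcohomologous_pullback:
  assumes "bcohomologous (Suc p) Y A \<psi> \<psi>'" "continuous_map X Y f" "f \<in> B \<rightarrow> A"
  shows "bcohomologous (Suc p) X B (pullback (Suc p) f \<psi>) (pullback (Suc p) f \<psi>')"
proof -
  obtain \<phi> where \<phi>: "bounded_cochain p Y \<phi>" "vanishing_cochain p (subtopology Y A) \<phi>"
    "\<And>\<sigma>. singular_simplex (Suc p) Y \<sigma> \<Longrightarrow> \<psi> \<sigma> - \<psi>' \<sigma> = cobd p \<phi> \<sigma>"
    using bcohomologousE [OF assms(1)] by auto
  have f: "continuous_map (subtopology X B) (subtopology Y A) f"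
    using assms(2,3) by (auto simp: continuous_map_in_subtopology continuous_map_from_subtopology)
  show ?thesis
  proof (rule bcohomologousI)
    show "bounded_cochain (Suc p - 1) X (pullback p f \<phi>)" using bounded_cochain_pullback [OF \<phi>(1) assms(2)] by simp
    show "vanishing_cochain (Suc p - 1) (subtopology X B) (pullback p f \<phi>)"
      using vanishing_cochain_pullback [OF \<phi>(2) f] by simp
    show "pullback (Suc p) f \<psi> \<sigma> - pullback (Suc p) f \<psi>' \<sigma> = cobd (Suc p - 1) (pullback p f \<phi>) \<sigma>"
      if "singular_simplex (Suc p) X \<sigma>" for \<sigma>
      using \<phi>(3) [OF singular_simplex_simplex_map [OF that assms(2)]] by (simp add: cobd_pullback pullback_def [of "Suc p"])
  qed
qed

lemma relative_cocycle_of_primitive: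
  assumes \<psi>: "bcocycle (Suc p) Y {} \<psi>" and \<phi>: "bounded_cochain p (subtopology Y A) \<phi>"
    and \<psi>_eq: "\<And>\<sigma>. singular_simplex (Suc p) (subtopology Y A) \<sigma> \<Longrightarrow> \<psi> \<sigma> = cobd p \<phi> \<sigma>"
  obtains \<psi>' where "bcocycle (Suc p) Y A \<psi>'" "bcohomologous (Suc p) Y {} \<psi> \<psi>'"
proof -
  define \<phi>' where "\<phi>' = (\<lambda>e. if singular_simplex p (subtopology Y A) e then \<phi> e else 0)"
  define \<psi>' where "\<psi>' = (\<lambda>\<sigma>. \<psi> \<sigma> - cobd p \<phi>' \<sigma>)"
  obtain B where "cochain_bound p (subtopology Y A) \<phi> B" using \<phi> by (auto simp: bounded_cochain_iff)
  then have "\<bar>\<phi>' e\<bar> \<le> max 0 B" for e by (auto simp: \<phi>'_def cochain_bound_def)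
  then have \<phi>'_bounded: "bounded_cochain p Y \<phi>'" by (auto simp: bounded_cochain_def)
  have "cobd p \<phi>' \<sigma> = cobd p \<phi> \<sigma>" if "singular_simplex (Suc p) (subtopology Y A) \<sigma>" for \<sigma>
    unfolding cobd_def by (intro sum.cong) (simp_all add: \<phi>'_def singular_simplex_face [OF that])
  then have "vanishing_cochain (Suc p) (subtopology Y A) \<psi>'"
    using \<psi>_eq by (simp add: vanishing_cochain_def \<psi>'_def)
  moreover have "bounded_cochain (Suc p) Y \<psi>'"
    unfolding \<psi>'_def using \<psi> \<phi>'_bounded by (intro bounded_cochain_diff bounded_cochain_cobd) (simp_all add: bcocycle_def)
  moreover have "cocycle (Suc p) Y \<psi>'"
    using \<psi> unfolding \<psi>'_def by (simp add: bcocycle_iff cocycle_def vanishing_cochain_def cobd_diff cobd_cobd)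
  ultimately have "bcocycle (Suc p) Y A \<psi>'" by (simp add: bcocycle_iff)
  moreover have "bcohomologous (Suc p) Y {} \<psi> \<psi>'"
    using \<phi>'_bounded singular_simplex_empty
    by (intro bcohomologousI [of _ _ \<phi>']) (auto simp: \<psi>'_def vanishing_cochain_def)
  ultimately show ?thesis by (rule that)
qed

lemma bcohomologous_homotopic:
  assumes \<psi>: "bcocycle 2 Y A \<psi>" and "homotopic_with (\<lambda>_. True) X Y f g"
  shows "bcohomologous 2 X {} (pullback 2 f \<psi>) (pullback 2 g \<psi>)"
proof (rule bcohomologous_sym)
  obtain h where h: "continuous_map (prod_topology (top_of_set {0..1::real}) X) Y h"
    and h_ends: "\<And>x. h (0, x) = f x" "\<And>x. h (1, x) = g x"
    using assms(2) unfolding homotopic_with_def by blast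
  define G where "G = (\<lambda>\<sigma> (x :: nat \<Rightarrow> real) t. h (t :: real, \<sigma> x))"
  have homotopy: "simplex_homotopy p Y (G \<sigma>)" if \<sigma>: "singular_simplex p X \<sigma>" for p \<sigma>
  proof -
    let ?P = "standard_simplex p \<times> {0..1::real}"
    have "continuous_map (top_of_set ?P) X (\<lambda>w. \<sigma> (fst w))"
      by (rule continuous_map_compose_on [of "standard_simplex p"])
        (use \<sigma> in \<open>auto simp: singular_simplex_iff_top_of_set intro: continuous_on_fst\<close>)
    moreover have "continuous_map (top_of_set ?P) (top_of_set {0..1}) snd"
      by (auto simp: continuous_map_in_subtopology intro: continuous_on_snd)
    ultimately have "continuous_map (top_of_set ?P) (prod_topology (top_of_set {0..1}) X) (\<lambda>w. (snd w, \<sigma> (fst w)))"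
      by (simp add: continuous_map_pairwise o_def)
    from continuous_map_compose [OF this h] show ?thesis by (simp add: G_def o_def split_def)
  qed
  obtain B where "cochain_bound 2 Y \<psi> B" using \<psi> by (auto simp: bcocycle_def bounded_cochain_iff)
  then have bounded: "bounded_cochain 1 X (\<lambda>e. prism_cochain \<psi> (G e))"
    using abs_prism_cochain_le homotopy unfolding bounded_cochain_def by blast
  have "pullback 2 g \<psi> \<sigma> - pullback 2 f \<psi> \<sigma> = cobd 1 (\<lambda>e. prism_cochain \<psi> (G e)) \<sigma>"
    if \<sigma>: "singular_simplex 2 X \<sigma>" for \<sigma>
  proof -
    have "prism_cochain \<psi> (\<lambda>x t. G \<sigma> (simplical_face i x) t) = prism_cochain \<psi> (G (singular_face 2 i \<sigma>))" for i
      using singular_face_apply [of _ 1 i \<sigma>] by (intro prism_cochain_cong) (simp add: G_def numeral_2_eq_2)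
    moreover have "restrict (\<lambda>x. G \<sigma> x 0) (standard_simplex 2) = simplex_map 2 f \<sigma>"
      "restrict (\<lambda>x. G \<sigma> x 1) (standard_simplex 2) = simplex_map 2 g \<sigma>"
      by (simp_all add: G_def h_ends simplex_map_def o_def)
    ultimately show ?thesis
      unfolding cobd_1 using prism_identity [OF _ homotopy [OF \<sigma>], of \<psi>] \<psi>
      by (simp add: bcocycle_iff pullback_def)
  qed
  then show "bcohomologous 2 X {} (pullback 2 g \<psi>) (pullback 2 f \<psi>)"
    using bounded singular_simplex_empty by (intro bcohomologousI) (auto simp: vanishing_cochain_def)
qed

section \<open>Duality for spaces retracting away from boundary circles\<close>

definition cochain_sup :: "nat \<Rightarrow> 'b topology \<Rightarrow> ('b ssimplex \<Rightarrow> real) \<Rightarrow> real" where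
  "cochain_sup p X \<psi> = (SUP \<sigma>\<in>singular_simplex_set p X. \<bar>\<psi> \<sigma>\<bar>)"

lemma binfnorm_eq:
  "binfnorm p X \<psi> = Inf (cochain_sup p X ` {\<psi>'. bcocycle p X {} \<psi>' \<and> bcohomologous p X {} \<psi> \<psi>'})"
  by (simp add: binfnorm_def cochain_sup_def [abs_def] image_Collect)

lemma singular_simplex_exists:
  assumes "topspace X \<noteq> {}"
  shows "\<exists>\<sigma>. singular_simplex p X \<sigma>"
proof -
  obtain x where "x \<in> topspace X" using assms by blast
  then have "singular_simplex p X (restrict (\<lambda>_. x) (standard_simplex p))"
    by (simp add: singular_simplex_def)
  then show ?thesis by blast
qed

lemma cochain_bound_cochain_sup:
  assumes "bounded_cochain p X \<psi>"
  shows "cochain_bound p X \<psi> (cochain_sup p X \<psi>)"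
  using assms unfolding cochain_bound_def cochain_sup_def bounded_cochain_def
  by (auto intro!: cSUP_upper bdd_aboveI2)

lemma cochain_sup_nonneg:
  assumes "bounded_cochain p X \<psi>" "topspace X \<noteq> {}"
  shows "0 \<le> cochain_sup p X \<psi>"
proof -
  obtain \<sigma> where "singular_simplex p X \<sigma>" using singular_simplex_exists [OF assms(2)] by blast
  then have "\<bar>\<psi> \<sigma>\<bar> \<le> cochain_sup p X \<psi>" by (rule cochain_boundD [OF cochain_bound_cochain_sup [OF assms(1)]])
  then show ?thesis by linarith
qed

lemma cochain_sup_le:
  assumes "cochain_bound p X \<psi> C" "topspace X \<noteq> {}"
  shows "cochain_sup p X \<psi> \<le> C"
  unfolding cochain_sup_def
proof (rule cSUP_least)
  show "singular_simplex_set p X \<noteq> {}" using singular_simplex_exists [OF assms(2)] by blast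
qed (use assms(1) in \<open>simp add: cochain_bound_def\<close>)

lemma binfnorm_nonneg:
  assumes "bcocycle p X {} \<psi>" "topspace X \<noteq> {}"
  shows "0 \<le> binfnorm p X \<psi>"
  unfolding binfnorm_eq
  by (rule cINF_greatest)
    (use assms bcohomologous_cong [of p X \<psi> \<psi>] in \<open>auto simp: bcocycle_def intro: cochain_sup_nonneg\<close>)

lemma binfnorm_le:
  assumes \<psi>: "bcocycle p X {} \<psi>" and C: "cochain_bound p X \<psi> C" and X: "topspace X \<noteq> {}"
  shows "binfnorm p X \<psi> \<le> C"
proof -
  have "binfnorm p X \<psi> \<le> cochain_sup p X \<psi>"
    unfolding binfnorm_eq
    by (rule cINF_lower) (use \<psi> X bcohomologous_cong [of p X \<psi> \<psi>] in
        \<open>auto simp: bcocycle_def intro!: bdd_belowI2 [of _ 0] cochain_sup_nonneg\<close>)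
  also have "\<dots> \<le> C" by (rule cochain_sup_le [OF C X])
  finally show ?thesis .
qed

lemma gromov_norm_nonneg:
  assumes "rrelcycle p Y A z"
  shows "0 \<le> gromov_norm p Y A z"
  unfolding gromov_norm_def
proof (rule cInf_greatest)
  show "{l1norm c |c. rrelcycle p Y A c \<and> rhomologous p Y A c z} \<noteq> {}" using assms rhomologous_refl by blast
qed (auto simp: l1norm_def intro: sum_nonneg)

lemma le_mult_Inf:
  fixes m a :: real
  assumes "0 \<le> m" "L \<noteq> {}" "\<And>l. l \<in> L \<Longrightarrow> a \<le> m * l"
  shows "a \<le> m * Inf L"
proof (cases "m = 0")
  case True
  then show ?thesis using assms by auto
next
  case False
  then have m: "m > 0" using assms(1) by simp
  have "a / m \<le> Inf L" using assms(2,3) m by (intro cInf_greatest) (auto simp: field_simps)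
  then show ?thesis using m by (simp add: field_simps)
qed

text \<open>Where \<open>nrm\<close> vanishes, the quotient is \<open>0\<close> by convention and does not affect the supremum.\<close>

lemma eq_Sup_quotients:
  fixes n :: real and pairing nrm :: "'u \<Rightarrow> real"
  assumes n: "0 \<le> n" and nrm: "\<And>u. u \<in> U \<Longrightarrow> 0 \<le> nrm u"
    and le: "\<And>u. u \<in> U \<Longrightarrow> \<bar>pairing u\<bar> \<le> nrm u * n"
    and attained: "n > 0 \<Longrightarrow> \<exists>u\<in>U. pairing u = n \<and> nrm u \<le> 1"
  shows "n = (if U = {} then 0 else Sup ((\<lambda>u. pairing u / nrm u) ` U))"
proof (cases "U = {}")
  case True
  then show ?thesis using n attained by force
next
  case False
  have quotient_le: "pairing u / nrm u \<le> n" if "u \<in> U" for u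
    using nrm [OF that] le [OF that] n by (cases "nrm u = 0") (auto simp: divide_le_eq mult.commute)
  have "n \<in> (\<lambda>u. pairing u / nrm u) ` U"
  proof (cases "n = 0")
    case True
    obtain u where u: "u \<in> U" using False by blast
    then have "n = pairing u / nrm u" using le [OF u] True by simp
    with u show ?thesis by blast
  next
    case False
    then have pos: "n > 0" using n by simp
    then obtain u where u: "u \<in> U" "pairing u = n" "nrm u \<le> 1" using attained by blast
    have "n \<le> nrm u * n" using le [OF u(1)] u(2) pos by simp
    then have "nrm u = 1" using pos u(3) by simp
    then have "n = pairing u / nrm u" using u(2) by simp
    with u(1) show ?thesis by blast
  qed
  then have "Sup ((\<lambda>u. pairing u / nrm u) ` U) = n"
    by (rule cSup_eq_maximum) (use quotient_le in auto)
  then show ?thesis using False by simp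
qed

locale circle_family_retract = circle_family Y A k circ
  for Y :: "'b topology" and A :: "'b set" and k :: nat and circ :: "nat \<Rightarrow> real \<Rightarrow> 'b" +
  fixes X :: "'a topology" and \<iota> :: "'a \<Rightarrow> 'b" and r :: "'b \<Rightarrow> 'a"
  assumes retraction: "retraction_maps Y X r \<iota>" and homotopic: "homotopic_with (\<lambda>_. True) Y Y id (\<iota> \<circ> r)"
begin

lemma continuous_r: "continuous_map Y X r" and continuous_\<iota>: "continuous_map X Y \<iota>"
  and r_\<iota>: "x \<in> topspace X \<Longrightarrow> r (\<iota> x) = x"
  using retraction by (simp_all add: retraction_maps_def)

lemma relative_representative_exists:
  assumes \<psi>: "bcocycle 2 X {} \<psi>"
  obtains \<psi>' where "bcocycle 2 Y A \<psi>'" "bcohomologous 2 X {} (pullback 2 \<iota> \<psi>') \<psi>"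
proof -
  have r\<psi>: "bcocycle 2 Y {} (pullback 2 r \<psi>)" by (rule bcocycle_pullback [OF \<psi> continuous_r]) simp
  then obtain B where B: "cochain_bound 2 Y (pullback 2 r \<psi>) B" by (auto simp: bcocycle_def bounded_cochain_iff)
  obtain \<phi> where "cochain_bound 1 (subtopology Y A) \<phi> (3 * B)"
    and \<phi>: "\<And>\<sigma>. singular_simplex 2 (subtopology Y A) \<sigma> \<Longrightarrow> pullback 2 r \<psi> \<sigma> = cobd 1 \<phi> \<sigma>"
  proof (rule bounded_primitive_on_circles)
    show "cocycle 2 (subtopology Y A) (pullback 2 r \<psi>)" "cochain_bound 2 (subtopology Y A) (pullback 2 r \<psi>) B"
      using r\<psi> B by (simp_all add: bcocycle_iff cocycle_def vanishing_cochain_def cochain_bound_def singular_simplex_subtopology)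
  qed (rule that)
  then have "bounded_cochain 1 (subtopology Y A) \<phi>" by (auto simp: bounded_cochain_iff)
  then obtain \<psi>' where \<psi>': "bcocycle 2 Y A \<psi>'" "bcohomologous 2 Y {} (pullback 2 r \<psi>) \<psi>'"
    using relative_cocycle_of_primitive [of 1 Y "pullback 2 r \<psi>" A \<phi>] r\<psi> \<phi> by (metis Suc_1)
  have "bcohomologous 2 X {} (pullback 2 \<iota> \<psi>') (pullback 2 \<iota> (pullback 2 r \<psi>))"
    using bcohomologous_pullback [of 1, OF _ continuous_\<iota>] bcohomologous_sym [OF \<psi>'(2)] by (simp add: numeral_2_eq_2)
  also have "bcohomologous 2 X {} (pullback 2 \<iota> (pullback 2 r \<psi>)) \<psi>"
  proof (rule bcohomologous_cong)
    fix \<sigma> assume "singular_simplex 2 X \<sigma>"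
    then have "simplex_map 2 (r \<circ> \<iota>) \<sigma> = \<sigma>" by (rule simplex_map_id_gen) (simp add: r_\<iota>)
    then show "pullback 2 \<iota> (pullback 2 r \<psi>) \<sigma> = \<psi> \<sigma>" by (simp add: pullback_def simplex_map_compose)
  qed
  finally show ?thesis by (rule that [OF \<psi>'(1)])
qed

lemma abs_kronecker_le_of_cohomologous_base:
  assumes z: "rrelcycle 2 Y A z" and \<psi>': "bcocycle 2 Y A \<psi>'"
    and cohom: "bcohomologous 2 X {} (pullback 2 \<iota> \<psi>') \<psi>" and C: "cochain_bound 2 X \<psi> C"
  shows "\<bar>kronecker z \<psi>'\<bar> \<le> C * l1norm z"
proof (rule abs_kronecker_le_of_cohomologous [OF z \<psi>'])
  show "cochain_bound 2 Y (pullback 2 r \<psi>) C" by (rule cochain_bound_pullback [OF C continuous_r])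
  have "bcohomologous 2 Y {} \<psi>' (pullback 2 id \<psi>')"
    by (rule bcohomologous_cong) (simp add: pullback_def singular_simplex_def extensional_restrict)
  also have "bcohomologous 2 Y {} (pullback 2 id \<psi>') (pullback 2 (\<iota> \<circ> r) \<psi>')"
    by (rule bcohomologous_homotopic [OF \<psi>' homotopic])
  also have "pullback 2 (\<iota> \<circ> r) \<psi>' = pullback 2 r (pullback 2 \<iota> \<psi>')"
    by (simp add: pullback_def simplex_map_compose fun_eq_iff)
  also have "bcohomologous 2 Y {} (pullback 2 r (pullback 2 \<iota> \<psi>')) (pullback 2 r \<psi>)"
    using bcohomologous_pullback [of 1, OF _ continuous_r] cohom by (simp add: numeral_2_eq_2)
  finally show "bcohomologous 2 Y {} \<psi>' (pullback 2 r \<psi>)" .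
qed

lemma transported_pairing_eq:
  assumes z: "rrelcycle 2 Y A z" and \<psi>': "bcocycle 2 Y A \<psi>'"
    and cohom: "bcohomologous 2 X {} (pullback 2 \<iota> \<psi>') \<psi>"
  shows "transported_pairing 2 Y A \<iota> X \<psi> z = kronecker z \<psi>'"
  unfolding transported_pairing_def
proof (rule the_equality)
  show "\<exists>\<psi>''. bcocycle 2 Y A \<psi>'' \<and> bcohomologous 2 X {} (pullback 2 \<iota> \<psi>'') \<psi> \<and> kronecker z \<psi>' = kronecker z \<psi>''"
    using assms by blast
  fix x assume "\<exists>\<psi>''. bcocycle 2 Y A \<psi>'' \<and> bcohomologous 2 X {} (pullback 2 \<iota> \<psi>'') \<psi> \<and> x = kronecker z \<psi>''"
  then obtain \<psi>'' where \<psi>'': "bcocycle 2 Y A \<psi>''" "bcohomologous 2 X {} (pullback 2 \<iota> \<psi>'') \<psi>" "x = kronecker z \<psi>''"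
    by blast
  have "bcohomologous 2 X {} (pullback 2 \<iota> (\<lambda>\<sigma>. \<psi>'' \<sigma> - \<psi>' \<sigma>)) (\<lambda>_. 0)"
    using bcohomologous_diff_zero [OF bcohomologous_trans [OF \<psi>''(2) bcohomologous_sym [OF cohom]]]
    by (simp add: pullback_def)
  then have "\<bar>kronecker z (\<lambda>\<sigma>. \<psi>'' \<sigma> - \<psi>' \<sigma>)\<bar> \<le> 0 * l1norm z"
    by (rule abs_kronecker_le_of_cohomologous_base [OF z bcocycle_diff [OF \<psi>''(1) \<psi>']]) (simp add: cochain_bound_def)
  then show "x = kronecker z \<psi>'" unfolding \<psi>''(3) kronecker_diff_right by simp
qed

lemma abs_transported_pairing_le:
  assumes z: "rrelcycle 2 Y A z" and \<psi>: "bcocycle 2 X {} \<psi>" and X: "topspace X \<noteq> {}"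
  shows "\<bar>transported_pairing 2 Y A \<iota> X \<psi> z\<bar> \<le> binfnorm 2 X \<psi> * gromov_norm 2 Y A z"
proof -
  obtain \<psi>' where \<psi>': "bcocycle 2 Y A \<psi>'" "bcohomologous 2 X {} (pullback 2 \<iota> \<psi>') \<psi>"
    using relative_representative_exists [OF \<psi>] .
  let ?M = "cochain_sup 2 X ` {\<omega>. bcocycle 2 X {} \<omega> \<and> bcohomologous 2 X {} \<psi> \<omega>}"
  have "\<bar>kronecker z \<psi>'\<bar> \<le> l1norm c * m" if c: "rrelcycle 2 Y A c" "rhomologous 2 Y A c z" and "m \<in> ?M" for c m
  proof -
    obtain \<omega> where \<omega>: "m = cochain_sup 2 X \<omega>" "bcocycle 2 X {} \<omega>" "bcohomologous 2 X {} \<psi> \<omega>"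
      using \<open>m \<in> ?M\<close> by blast
    have "kronecker z \<psi>' = kronecker c \<psi>'"
      using kronecker_bcocycle_homologous [OF \<psi>'(1) _ c(2)] z by (simp add: rrelcycle_def)
    moreover have "\<bar>kronecker c \<psi>'\<bar> \<le> m * l1norm c"
      using \<omega>(2) unfolding \<omega>(1)
      by (intro abs_kronecker_le_of_cohomologous_base [OF c(1) \<psi>'(1) bcohomologous_trans [OF \<psi>'(2) \<omega>(3)]]
          cochain_bound_cochain_sup) (simp add: bcocycle_def)
    ultimately show ?thesis by (simp add: mult.commute)
  qed
  then have "\<bar>kronecker z \<psi>'\<bar> \<le> l1norm c * binfnorm 2 X \<psi>" if "rrelcycle 2 Y A c" "rhomologous 2 Y A c z" for c
    unfolding binfnorm_eq using \<psi> bcohomologous_cong [of 2 X \<psi> \<psi>] that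
    by (intro le_mult_Inf) (auto simp: l1norm_def intro: sum_nonneg)
  then have "\<bar>kronecker z \<psi>'\<bar> \<le> binfnorm 2 X \<psi> * gromov_norm 2 Y A z"
    unfolding gromov_norm_def using binfnorm_nonneg [OF \<psi> X] z rhomologous_refl [of 2 Y A z]
    by (intro le_mult_Inf) (auto simp: mult.commute)
  then show ?thesis unfolding transported_pairing_eq [OF z \<psi>'] .
qed

lemma transported_pairing_attains_gromov_norm:
  assumes z: "rrelcycle 2 Y A z"
  obtains \<psi> where "bcocycle 2 X {} \<psi>" "cochain_bound 2 X \<psi> 1"
    "transported_pairing 2 Y A \<iota> X \<psi> z = gromov_norm 2 Y A z"
proof -
  obtain \<psi>' where \<psi>': "bcocycle 2 Y A \<psi>'" "cochain_bound 2 Y \<psi>' 1" "kronecker z \<psi>' = gromov_norm 2 Y A z"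
    by (rule norm_attaining_cocycle [of 1, unfolded Suc_1, OF z]) (rule that)
  show ?thesis
  proof (rule that)
    show "bcocycle 2 X {} (pullback 2 \<iota> \<psi>')" by (rule bcocycle_pullback [OF \<psi>'(1) continuous_\<iota>]) simp
    show "cochain_bound 2 X (pullback 2 \<iota> \<psi>') 1" by (rule cochain_bound_pullback [OF \<psi>'(2) continuous_\<iota>])
    show "transported_pairing 2 Y A \<iota> X (pullback 2 \<iota> \<psi>') z = gromov_norm 2 Y A z"
      unfolding \<psi>'(3) [symmetric] by (rule transported_pairing_eq [OF z \<psi>'(1) bcohomologous_cong]) simp
  qed
qed

lemma transported_pairing_trivial:
  assumes z: "rrelcycle 2 Y A z" and \<psi>: "bcocycle 2 X {} \<psi>" "bcohomologous 2 X {} \<psi> (\<lambda>_. 0)"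
  shows "transported_pairing 2 Y A \<iota> X \<psi> z = 0"
proof -
  obtain \<psi>' where \<psi>': "bcocycle 2 Y A \<psi>'" "bcohomologous 2 X {} (pullback 2 \<iota> \<psi>') \<psi>"
    using relative_representative_exists [OF \<psi>(1)] .
  have "\<bar>kronecker z \<psi>'\<bar> \<le> 0 * l1norm z"
    by (rule abs_kronecker_le_of_cohomologous_base [OF z \<psi>'(1) bcohomologous_trans [OF \<psi>'(2) \<psi>(2)]])
      (simp add: cochain_bound_def)
  then show ?thesis unfolding transported_pairing_eq [OF z \<psi>'] by simp
qed

theorem gromov_norm_duality:
  assumes z: "rrelcycle 2 Y A z"
  defines "S \<equiv> {transported_pairing 2 Y A \<iota> X \<psi> z / binfnorm 2 X \<psi> | \<psi>.
      bcocycle 2 X {} \<psi> \<and> \<not> bcohomologous 2 X {} \<psi> (\<lambda>_. 0)}"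
  shows "gromov_norm 2 Y A z = (if S = {} then 0 else Sup S)"
proof -
  let ?n = "gromov_norm 2 Y A z" and ?U = "{\<psi>. bcocycle 2 X {} \<psi> \<and> \<not> bcohomologous 2 X {} \<psi> (\<lambda>_. 0)}"
  let ?pairing = "\<lambda>\<psi>. transported_pairing 2 Y A \<iota> X \<psi> z"
  have nonempty: "topspace X \<noteq> {}" if "\<psi> \<in> ?U" for \<psi>
    using that bcohomologous_cong [of 2 X \<psi> "\<lambda>_. 0"] singular_simplex_empty by blast
  have "?n = (if ?U = {} then 0 else Sup ((\<lambda>\<psi>. ?pairing \<psi> / binfnorm 2 X \<psi>) ` ?U))"
  proof (rule eq_Sup_quotients [OF gromov_norm_nonneg [OF z]])
    show "0 \<le> binfnorm 2 X \<psi>" "\<bar>?pairing \<psi>\<bar> \<le> binfnorm 2 X \<psi> * ?n" if "\<psi> \<in> ?U" for \<psi>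
      using that binfnorm_nonneg abs_transported_pairing_le [OF z] nonempty [OF that] by blast+
    assume pos: "?n > 0"
    obtain \<psi> where \<psi>: "bcocycle 2 X {} \<psi>" "cochain_bound 2 X \<psi> 1" "?pairing \<psi> = ?n"
      using transported_pairing_attains_gromov_norm [OF z] .
    then have U: "\<psi> \<in> ?U" using transported_pairing_trivial [OF z \<psi>(1)] pos by auto
    then show "\<exists>\<psi>\<in>?U. ?pairing \<psi> = ?n \<and> binfnorm 2 X \<psi> \<le> 1"
      using \<psi>(3) binfnorm_le [OF \<psi>(1,2) nonempty [OF U]] by blast
  qed
  moreover have "S = (\<lambda>\<psi>. ?pairing \<psi> / binfnorm 2 X \<psi>) ` ?U" unfolding S_def by blast
  ultimately show ?thesis by (simp only: image_is_empty)
qed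

end

section \<open>The mapping cylinder\<close>

lemma openin_mapping_cylinder:
  "openin (mapping_cylinder X k \<gamma>) U \<longleftrightarrow>
      U \<subseteq> Inl ` topspace X \<union> Inr ` (topspace (circles k) \<times> {0<..1}) \<and>
      openin X {x. Inl x \<in> U} \<and>
      openin (prod_topology (circles k) (top_of_set {0..1}))
             {w \<in> topspace (circles k) \<times> {0..1}. cyl_proj \<gamma> w \<in> U}"
proof -
  let ?inl = "\<lambda>U. {x. Inl x \<in> U}" and ?proj = "\<lambda>U. {w \<in> topspace (circles k) \<times> {0..1::real}. cyl_proj \<gamma> w \<in> U}"
  let ?T = "\<lambda>U. U \<subseteq> Inl ` topspace X \<union> Inr ` (topspace (circles k) \<times> {0<..1}) \<and> openin X (?inl U) \<and>
      openin (prod_topology (circles k) (top_of_set {0..1})) (?proj U)"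
  have "istopology ?T"
    unfolding istopology_def
  proof (intro conjI allI impI)
    fix S T assume S: "?T S" and T: "?T T"
    have "?inl (S \<inter> T) = ?inl S \<inter> ?inl T" "?proj (S \<inter> T) = ?proj S \<inter> ?proj T" by blast+
    then show "openin X (?inl (S \<inter> T))" "openin (prod_topology (circles k) (top_of_set {0..1})) (?proj (S \<inter> T))"
      using S T by (simp_all only: openin_Int)
    show "S \<inter> T \<subseteq> Inl ` topspace X \<union> Inr ` (topspace (circles k) \<times> {0<..1})" using S by blast
  next
    fix \<K> assume \<K>: "\<forall>K\<in>\<K>. ?T K"
    have "?inl (\<Union>\<K>) = (\<Union>K\<in>\<K>. ?inl K)" "?proj (\<Union>\<K>) = (\<Union>K\<in>\<K>. ?proj K)" by blast+
    then show "openin X (?inl (\<Union>\<K>))" "openin (prod_topology (circles k) (top_of_set {0..1})) (?proj (\<Union>\<K>))"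
      using \<K> by (auto intro!: openin_Union)
    show "\<Union>\<K> \<subseteq> Inl ` topspace X \<union> Inr ` (topspace (circles k) \<times> {0<..1})" using \<K> by blast
  qed
  then show ?thesis unfolding mapping_cylinder_def by (simp add: topology_inverse')
qed

lemma openin_forall_compactin:
  assumes f: "continuous_map (prod_topology K X) Z f" and C: "compactin K C" and W: "openin Z W"
  shows "openin X {x \<in> topspace X. \<forall>s\<in>C. f (s, x) \<in> W}"
proof (subst openin_subopen, intro ballI)
  fix x assume x: "x \<in> {x \<in> topspace X. \<forall>s\<in>C. f (s, x) \<in> W}"
  let ?P = "{w \<in> topspace (prod_topology K X). f w \<in> W}"
  have open_P: "openin (prod_topology K X) ?P" by (rule openin_continuous_map_preimage [OF f W])
  have "x \<in> topspace X" "C \<times> {x} \<subseteq> ?P" using x compactin_subset_topspace [OF C] by auto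
  from tube_lemma_left [OF open_P C this] obtain U V where UV: "openin X V" "C \<subseteq> U" "x \<in> V" "U \<times> V \<subseteq> ?P"
    by blast
  have "V \<subseteq> {x \<in> topspace X. \<forall>s\<in>C. f (s, x) \<in> W}" using openin_subset [OF UV(1)] UV(2,4) by blast
  with UV(1,3) show "\<exists>V. openin X V \<and> x \<in> V \<and> V \<subseteq> {x \<in> topspace X. \<forall>s\<in>C. f (s, x) \<in> W}" by blast
qed

definition cyl_retract :: "('c \<Rightarrow> 'a) \<Rightarrow> 'a + 'c \<times> real \<Rightarrow> 'a" where
  "cyl_retract \<gamma> = case_sum id (\<lambda>(u, t). \<gamma> u)"

definition cyl_contract :: "(nat \<times> (nat \<Rightarrow> real) \<Rightarrow> 'a) \<Rightarrow> real \<times> ('a + (nat \<times> (nat \<Rightarrow> real)) \<times> real)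
    \<Rightarrow> 'a + (nat \<times> (nat \<Rightarrow> real)) \<times> real" where
  "cyl_contract \<gamma> = (\<lambda>(s, y). case y of Inl x \<Rightarrow> Inl x | Inr (u, t) \<Rightarrow> cyl_proj \<gamma> (u, (1 - s) * t))"

lemma cyl_contract_cyl_proj: "cyl_contract \<gamma> (s, cyl_proj \<gamma> w) = cyl_proj \<gamma> (fst w, (1 - s) * snd w)"
  by (cases w) (simp add: cyl_contract_def cyl_proj_def)

definition circle_point :: "real \<Rightarrow> nat \<Rightarrow> real" where
  "circle_point s = (\<lambda>i. if i = 0 then cos (2 * pi * s) else if i = 1 then sin (2 * pi * s) else 0)"

definition cyl_circle :: "nat \<Rightarrow> real \<Rightarrow> 'a + (nat \<times> (nat \<Rightarrow> real)) \<times> real" where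
  "cyl_circle j s = Inr ((j, circle_point s), 1)"

definition end_point :: "'a + 'c \<times> real \<Rightarrow> 'c" where
  "end_point y = fst (projr y)"

lemma topspace_circles: "topspace (circles k) = {..<k} \<times> topspace (nsphere 1)"
  by (auto simp: circles_def)

locale cylinder =
  fixes X :: "'a topology" and k :: nat and \<gamma> :: "nat \<times> (nat \<Rightarrow> real) \<Rightarrow> 'a"
  assumes continuous_\<gamma>: "continuous_map (circles k) X \<gamma>"
begin

abbreviation "cyl \<equiv> mapping_cylinder X k \<gamma>"
abbreviation "circles_I \<equiv> prod_topology (circles k) (top_of_set {0..1::real})"

lemma \<gamma>_in_X: "u \<in> topspace (circles k) \<Longrightarrow> \<gamma> u \<in> topspace X"
  using continuous_map_funspace [OF continuous_\<gamma>] by blast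

lemma topspace_cyl: "topspace cyl = Inl ` topspace X \<union> Inr ` (topspace (circles k) \<times> {0<..1})" (is "_ = ?W")
proof
  show "topspace cyl \<subseteq> ?W"
    using openin_topspace [of cyl] unfolding openin_mapping_cylinder by blast
  have "{x. Inl x \<in> ?W} = topspace X" by auto
  moreover have "{w \<in> topspace (circles k) \<times> {0..1}. cyl_proj \<gamma> w \<in> ?W} = topspace circles_I"
    using \<gamma>_in_X by (auto simp: cyl_proj_def)
  ultimately have "openin cyl ?W"
    unfolding openin_mapping_cylinder by (simp only: openin_topspace subset_refl simp_thms)
  then show "?W \<subseteq> topspace cyl" by (rule openin_subset)
qed

lemma continuous_Inl: "continuous_map X cyl Inl"
  unfolding continuous_map
proof (intro conjI allI impI)
  show "Inl ` topspace X \<subseteq> topspace cyl" by (simp add: topspace_cyl)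
  fix U assume "openin cyl U"
  then have "openin X {x. Inl x \<in> U}" by (simp add: openin_mapping_cylinder)
  moreover from this have "{x \<in> topspace X. Inl x \<in> U} = {x. Inl x \<in> U}" using openin_subset by blast
  ultimately show "openin X {x \<in> topspace X. Inl x \<in> U}" by simp
qed

lemma continuous_cyl_proj: "continuous_map circles_I cyl (cyl_proj \<gamma>)"
  unfolding continuous_map
proof (intro conjI allI impI)
  show "cyl_proj \<gamma> ` topspace circles_I \<subseteq> topspace cyl"
    using \<gamma>_in_X by (auto simp: topspace_cyl cyl_proj_def)
  show "openin circles_I {w \<in> topspace circles_I. cyl_proj \<gamma> w \<in> U}" if "openin cyl U" for U
    using that by (simp add: openin_mapping_cylinder)
qed

lemma topspace_cyl_cases:
  assumes "y \<in> topspace cyl"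
  obtains x where "x \<in> topspace X" "y = Inl x" | w where "w \<in> topspace circles_I" "y = cyl_proj \<gamma> w"
proof (cases y)
  case (Inl x)
  then have "x \<in> topspace X" using assms by (auto simp: topspace_cyl)
  then show ?thesis using Inl by (rule that(1))
next
  case (Inr w)
  obtain u t where w: "w = (u, t)" by fastforce
  then have ut: "u \<in> topspace (circles k)" "0 < t" "t \<le> 1" using Inr assms by (auto simp: topspace_cyl)
  show ?thesis
  proof (rule that(2))
    show "w \<in> topspace circles_I" using w ut by simp
    show "y = cyl_proj \<gamma> w" using Inr w ut by (simp add: cyl_proj_def)
  qed
qed

lemma continuous_map_slice_cyl:
  assumes f_Inl: "continuous_map (prod_topology K X) Z (\<lambda>(s, x). f (s, Inl x))"
    and f_proj: "continuous_map (prod_topology K circles_I) Z (\<lambda>(s, w). f (s, cyl_proj \<gamma> w))"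
    and "y \<in> topspace cyl"
  shows "continuous_map K Z (\<lambda>s. f (s, y))"
  using \<open>y \<in> topspace cyl\<close>
proof (cases rule: topspace_cyl_cases)
  case (1 x)
  have "continuous_map K (prod_topology K X) (\<lambda>s. (s, x))" using 1 by (simp add: continuous_map_pairwise o_def)
  from continuous_map_compose [OF this f_Inl] show ?thesis using 1 by (simp add: o_def)
next
  case (2 w)
  have "continuous_map K (prod_topology K circles_I) (\<lambda>s. (s, w))"
    using 2 by (simp add: continuous_map_pairwise o_def)
  from continuous_map_compose [OF this f_proj] show ?thesis using 2 by (simp add: o_def)
qed

text \<open>The library result on products with a locally compact space, \<open>quotient_map_prod_right\<close>, does not apply
  directly, because the cylinder is a quotient of two spaces of different types.\<close>

lemma continuous_map_prod_cyl:
  assumes K: "locally_compact_space K" "Hausdorff_space K"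
    and f_Inl: "continuous_map (prod_topology K X) Z (\<lambda>(s, x). f (s, Inl x))"
    and f_proj: "continuous_map (prod_topology K circles_I) Z (\<lambda>(s, w). f (s, cyl_proj \<gamma> w))"
  shows "continuous_map (prod_topology K cyl) Z f"
proof -
  note slice = continuous_map_slice_cyl [OF f_Inl f_proj]
  have "openin (prod_topology K cyl) {p \<in> topspace (prod_topology K cyl). f p \<in> W}" (is "openin _ ?P")
    if W: "openin Z W" for W
    unfolding openin_prod_topology_alt
  proof (intro allI impI)
    fix s y assume sy: "(s, y) \<in> ?P"
    then have "openin K {s \<in> topspace K. f (s, y) \<in> W}"
      by (intro openin_continuous_map_preimage [OF slice W]) auto
    then obtain U C where UC: "openin K U" "compactin K C" "s \<in> U" "U \<subseteq> C" "C \<subseteq> {s \<in> topspace K. f (s, y) \<in> W}"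
      using sy K locally_compact_space_neighbourhood_base_closedin [of K]
      by (force simp: neighbourhood_base_of)
    define V where "V = {y \<in> topspace cyl. \<forall>s\<in>C. f (s, y) \<in> W}"
    have "{x. Inl x \<in> V} = {x \<in> topspace X. \<forall>s\<in>C. (\<lambda>(s, x). f (s, Inl x)) (s, x) \<in> W}"
      by (auto simp: V_def topspace_cyl)
    moreover have "{w \<in> topspace (circles k) \<times> {0..1}. cyl_proj \<gamma> w \<in> V}
        = {w \<in> topspace circles_I. \<forall>s\<in>C. (\<lambda>(s, w). f (s, cyl_proj \<gamma> w)) (s, w) \<in> W}"
      using continuous_map_funspace [OF continuous_cyl_proj] by (auto simp: V_def)
    moreover have "V \<subseteq> Inl ` topspace X \<union> Inr ` (topspace (circles k) \<times> {0<..1})"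
      unfolding V_def topspace_cyl by blast
    ultimately have "openin cyl V"
      unfolding openin_mapping_cylinder
      by (simp only: openin_forall_compactin [OF f_Inl UC(2) W] openin_forall_compactin [OF f_proj UC(2) W] simp_thms)
    moreover have "y \<in> V" "U \<times> V \<subseteq> ?P" using sy UC(4,5) openin_subset [OF UC(1)] by (auto simp: V_def)
    ultimately show "\<exists>U V. openin K U \<and> openin cyl V \<and> s \<in> U \<and> y \<in> V \<and> U \<times> V \<subseteq> ?P"
      using UC(1,3) by blast
  qed
  moreover have "f ` topspace (prod_topology K cyl) \<subseteq> topspace Z"
    using continuous_map_funspace [OF slice] by auto
  ultimately show ?thesis unfolding continuous_map by blast
qed

lemma continuous_cyl_contract:
  "continuous_map (prod_topology (top_of_set {0..1}) cyl) cyl (cyl_contract \<gamma>)"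
proof (rule continuous_map_prod_cyl)
  show "locally_compact_space (top_of_set {0..1::real})"
    by (intro compact_imp_locally_compact_space) (simp add: compact_space_subtopology)
  show "Hausdorff_space (top_of_set {0..1::real})" by (simp add: Hausdorff_space_subtopology)
  show "continuous_map (prod_topology (top_of_set {0..1}) X) cyl (\<lambda>(s, x). cyl_contract \<gamma> (s, Inl x))"
    using continuous_map_compose [OF continuous_map_snd continuous_Inl]
    by (simp add: cyl_contract_def o_def split_def)
  let ?P = "prod_topology (top_of_set {0..1::real}) circles_I"
  have "continuous_map ?P (circles k) (\<lambda>p. fst (snd p))"
    using continuous_map_compose [OF continuous_map_snd continuous_map_fst] by (simp add: o_def)
  moreover have "continuous_map ?P (top_of_set {0..1}) (\<lambda>p. (1 - fst p) * snd (snd p))"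
  proof -
    have "continuous_map ?P euclideanreal fst"
      using continuous_map_fst continuous_map_into_fulltopology by blast
    moreover have "continuous_map ?P euclideanreal (\<lambda>p. snd (snd p))"
      using continuous_map_compose [OF continuous_map_snd continuous_map_snd] continuous_map_into_fulltopology
      by (force simp: o_def)
    ultimately have "continuous_map ?P euclideanreal (\<lambda>p. (1 - fst p) * snd (snd p))"
      by (intro continuous_intros) auto
    moreover have "0 \<le> (1 - s) * t \<and> (1 - s) * t \<le> 1" if "s \<in> {0..1}" "t \<in> {0..1}" for s t :: real
      using that mult_mono [of "1 - s" 1 t 1] by auto
    ultimately show ?thesis by (auto simp: continuous_map_in_subtopology)
  qed
  ultimately have "continuous_map ?P circles_I (\<lambda>p. (fst (snd p), (1 - fst p) * snd (snd p)))"
    by (simp add: continuous_map_pairwise o_def)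
  from continuous_map_compose [OF this continuous_cyl_proj]
  show "continuous_map ?P cyl (\<lambda>(s, w). cyl_contract \<gamma> (s, cyl_proj \<gamma> w))"
    by (simp add: cyl_contract_cyl_proj o_def split_def)
qed

lemma continuous_cyl_retract: "continuous_map cyl X (cyl_retract \<gamma>)"
  unfolding continuous_map
proof (intro conjI allI impI)
  show "cyl_retract \<gamma> ` topspace cyl \<subseteq> topspace X"
    using \<gamma>_in_X by (auto simp: topspace_cyl cyl_retract_def)
  fix U assume U: "openin X U"
  let ?W = "{y \<in> topspace cyl. cyl_retract \<gamma> y \<in> U}"
  have "{x. Inl x \<in> ?W} = U"
    using openin_subset [OF U] by (auto simp: topspace_cyl cyl_retract_def)
  moreover have "{w \<in> topspace (circles k) \<times> {0..1}. cyl_proj \<gamma> w \<in> ?W} = {w \<in> topspace circles_I. (\<gamma> \<circ> fst) w \<in> U}"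
    using \<gamma>_in_X by (auto simp: topspace_cyl cyl_proj_def cyl_retract_def split: if_splits)
  moreover have "openin circles_I {w \<in> topspace circles_I. (\<gamma> \<circ> fst) w \<in> U}"
    by (rule openin_continuous_map_preimage [OF continuous_map_compose [OF continuous_map_fst continuous_\<gamma>] U])
  ultimately show "openin cyl ?W"
    unfolding openin_mapping_cylinder using U topspace_cyl by auto
qed

lemma retraction_maps_cyl: "retraction_maps cyl X (cyl_retract \<gamma>) Inl"
  using continuous_cyl_retract continuous_Inl by (simp add: retraction_maps_def) (simp add: cyl_retract_def)

lemma homotopic_id_cyl_retract: "homotopic_with (\<lambda>_. True) cyl cyl id (Inl \<circ> cyl_retract \<gamma>)"
proof -
  have "cyl_contract \<gamma> (0, y) = id y" if "y \<in> topspace cyl" for y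
    using that by (auto simp: topspace_cyl cyl_contract_def cyl_proj_def)
  moreover have "cyl_contract \<gamma> (1, y) = (Inl \<circ> cyl_retract \<gamma>) y" for y
    by (auto simp: cyl_contract_def cyl_proj_def cyl_retract_def split: sum.split)
  ultimately show ?thesis
    using continuous_cyl_contract by (subst homotopic_with) auto
qed

lemma continuous_end_point: "continuous_map (subtopology cyl (cyl_end k)) (circles k) end_point"
  unfolding continuous_map
proof (intro conjI allI impI)
  show "end_point ` topspace (subtopology cyl (cyl_end k)) \<subseteq> topspace (circles k)"
    by (auto simp: cyl_end_def end_point_def)
  fix U assume U: "openin (circles k) U"
  have sub: "U \<subseteq> topspace (circles k)" by (rule openin_subset [OF U])
  let ?V = "Inr ` (U \<times> {0<..1}) :: ('a + (nat \<times> (nat \<Rightarrow> real)) \<times> real) set"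
  have "{w \<in> topspace (circles k) \<times> {0..1}. cyl_proj \<gamma> w \<in> ?V} = U \<times> ({0..1} \<inter> {0<..})"
    using sub by (auto simp: cyl_proj_def split: if_splits)
  moreover have "openin circles_I (U \<times> ({0..1} \<inter> {0<..}))"
    using U openin_open_Int [of "{0<..} :: real set" "{0..1}"] by (simp add: openin_prod_Times_iff)
  moreover have "{x. Inl x \<in> ?V} = {}" by auto
  ultimately have "openin cyl ?V"
    unfolding openin_mapping_cylinder using sub by auto
  moreover have "{y \<in> topspace (subtopology cyl (cyl_end k)). end_point y \<in> U} = ?V \<inter> cyl_end k"
    using sub by (auto simp: cyl_end_def end_point_def topspace_cyl)
  ultimately show "openin (subtopology cyl (cyl_end k)) {y \<in> topspace (subtopology cyl (cyl_end k)). end_point y \<in> U}"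
    by (auto simp: openin_subtopology)
qed

end

section \<open>The circles at the end of the cylinder\<close>

lemma circle_point_eq_iff: "circle_point s = circle_point t \<longleftrightarrow> s - t \<in> \<int>"
proof -
  have "circle_point s = circle_point t \<longleftrightarrow> sin (2 * pi * s) = sin (2 * pi * t) \<and> cos (2 * pi * s) = cos (2 * pi * t)"
    by (auto simp: circle_point_def fun_eq_iff)
  also have "\<dots> \<longleftrightarrow> (\<exists>n::int. 2 * pi * s = 2 * pi * t + 2 * pi * n)" by (rule sin_cos_eq_iff)
  also have "\<dots> \<longleftrightarrow> (\<exists>n::int. s - t = of_int n)"
  proof -
    have "2 * pi * s = 2 * pi * t + 2 * pi * n \<longleftrightarrow> (2 * pi) * (s - t) = (2 * pi) * n" for n :: real
      by (auto simp: right_diff_distrib)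
    then show ?thesis by simp
  qed
  finally show ?thesis by (auto simp: Ints_def)
qed

lemma topspace_nsphere_1: "topspace (nsphere 1) = {x. (\<forall>i>1. x i = 0) \<and> x 0 ^ 2 + x 1 ^ 2 = (1::real)}"
  by (auto simp: nsphere)

lemma continuous_circle_point: "continuous_map euclideanreal (nsphere 1) circle_point"
proof -
  have "continuous_on UNIV circle_point"
    unfolding circle_point_def
    by (rule continuous_on_coordinatewise_then_product) (intro continuous_on_if_const continuous_intros)
  moreover have "circle_point s \<in> topspace (nsphere 1)" for s
    unfolding topspace_nsphere_1 by (simp add: circle_point_def)
  ultimately show ?thesis
    unfolding nsphere by (auto simp: continuous_map_in_subtopology euclidean_product_topology nsphere)
qed

lemma continuous_map_snd_circles: "continuous_map (circles k) (nsphere 1) snd"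
  unfolding continuous_map
proof (intro conjI allI impI)
  show "snd ` topspace (circles k) \<subseteq> topspace (nsphere 1)" by (auto simp: topspace_circles)
  fix U assume U: "openin (nsphere 1) U"
  have "{x. (i, x) \<in> {w \<in> topspace (circles k). snd w \<in> U}} = U" if "i < k" for i
    using that openin_subset [OF U] by (auto simp: topspace_circles)
  then show "openin (circles k) {w \<in> topspace (circles k). snd w \<in> U}"
    using U unfolding circles_def openin_sum_topology by auto
qed

lemma continuous_map_fst_circles: "continuous_map (circles k) euclideanreal (\<lambda>w. real (fst w))"
  unfolding continuous_map
proof (intro conjI allI impI)
  fix U :: "real set"
  have "{x. (i, x) \<in> {w \<in> topspace (circles k). real (fst w) \<in> U}} = (if real i \<in> U then topspace (nsphere 1) else {})"
    if "i < k" for i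
    using that by (auto simp: topspace_circles)
  then show "openin (circles k) {w \<in> topspace (circles k). real (fst w) \<in> U}"
    unfolding circles_def openin_sum_topology by auto
qed auto

lemma bounded_linear_lookup: "bounded_linear (\<lambda>c :: 'x \<Rightarrow>\<^sub>0 real. Poly_Mapping.lookup c i)"
proof (rule bounded_linear_intro)
  fix c :: "'x \<Rightarrow>\<^sub>0 real"
  have "\<bar>Poly_Mapping.lookup c i\<bar> \<le> (\<Sum>j\<in>Poly_Mapping.keys c. \<bar>Poly_Mapping.lookup c j\<bar>)"
    by (cases "i \<in> Poly_Mapping.keys c") (auto simp: in_keys_iff intro!: member_le_sum sum_nonneg)
  then show "norm (Poly_Mapping.lookup c i) \<le> norm c * 1"
    by (simp add: norm_poly_mapping_def dist_poly_mapping_def)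
qed (simp_all add: lookup_add lookup_scaleR)

text \<open>The library's logarithm needs a domain in a normed space, so the simplex is moved
  to the space of finitely supported functions.\<close>

lemma continuous_logarithm_on_simplex:
  fixes F :: "(nat \<Rightarrow> real) \<Rightarrow> complex"
  assumes F: "continuous_on (standard_simplex p) F" "\<And>x. x \<in> standard_simplex p \<Longrightarrow> F x \<noteq> 0"
  obtains h where "continuous_on (standard_simplex p) h" "\<And>x. x \<in> standard_simplex p \<Longrightarrow> F x = exp (h x)"
proof -
  define fin where "fin = (\<lambda>x :: nat \<Rightarrow> real. \<Sum>i\<le>p. x i *\<^sub>R Poly_Mapping.single i (1::real))"
  let ?D = "{w. Poly_Mapping.lookup w \<in> standard_simplex p}"
  have lookup_fin: "Poly_Mapping.lookup (fin x) = x" if "x \<in> standard_simplex p" for x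
  proof
    fix i
    have "Poly_Mapping.lookup (fin x) i = (if i \<le> p then x i else 0)"
      by (simp add: fin_def lookup_sum lookup_scaleR lookup_single when_def if_distrib [of "\<lambda>r. _ * r"] cong: if_cong)
    then show "Poly_Mapping.lookup (fin x) i = x i" using that by (simp add: standard_simplex_iff)
  qed
  have "continuous_on ?D Poly_Mapping.lookup"
    by (rule continuous_on_coordinatewise_then_product) (rule linear_continuous_on [OF bounded_linear_lookup])
  then have "continuous_on ?D (\<lambda>w. F (Poly_Mapping.lookup w))"
    by (rule continuous_on_compose2 [OF F(1)]) auto
  moreover have "contractible ?D"
  proof (rule convex_imp_contractible, rule convexI)
    fix v w and a b :: real assume vw: "v \<in> ?D" "w \<in> ?D" and ab: "0 \<le> a" "0 \<le> b" "a + b = 1"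
    then have "a = 1 - b" by simp
    moreover have "(\<lambda>i. (1 - b) * Poly_Mapping.lookup v i + b * Poly_Mapping.lookup w i) \<in> standard_simplex p"
      using vw ab by (intro convex_standard_simplex) auto
    ultimately show "a *\<^sub>R v + b *\<^sub>R w \<in> ?D" by (simp add: lookup_add [abs_def] lookup_scaleR)
  qed
  moreover have "F (Poly_Mapping.lookup w) \<noteq> 0" if "w \<in> ?D" for w
    using F(2) [of "Poly_Mapping.lookup w"] that by auto
  ultimately obtain h where h: "continuous_on ?D h" "\<And>w. w \<in> ?D \<Longrightarrow> F (Poly_Mapping.lookup w) = exp (h w)"
    by (rule continuous_logarithm_on_contractible) (assumption, rule that)
  have "continuous_on (standard_simplex p) fin"
    unfolding fin_def
    by (intro continuous_on_sum continuous_on_scaleR continuous_on_coordinate [OF continuous_on_id] continuous_on_const)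
  then have "continuous_on (standard_simplex p) (\<lambda>x. h (fin x))"
    by (rule continuous_on_compose2 [OF h(1)]) (auto simp: lookup_fin)
  moreover have "F x = exp (h (fin x))" if "x \<in> standard_simplex p" for x
    using h(2) [of "fin x"] lookup_fin [OF that] that by simp
  ultimately show ?thesis by (rule that)
qed

lemma lift_to_angle:
  fixes F :: "(nat \<Rightarrow> real) \<Rightarrow> complex"
  assumes F: "continuous_on (standard_simplex p) F" "\<And>x. x \<in> standard_simplex p \<Longrightarrow> cmod (F x) = 1"
  obtains g where "continuous_on (standard_simplex p) g" "\<And>x. x \<in> standard_simplex p \<Longrightarrow> F x = cis (2 * pi * g x)"
proof -
  have "F x \<noteq> 0" if "x \<in> standard_simplex p" for x using F(2) [OF that] by auto
  then obtain h where h: "continuous_on (standard_simplex p) h" "\<And>x. x \<in> standard_simplex p \<Longrightarrow> F x = exp (h x)"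
    using continuous_logarithm_on_simplex [OF F(1)] by blast
  define g where "g = (\<lambda>x. Im (h x) / (2 * pi))"
  have "continuous_on (standard_simplex p) g"
    unfolding g_def using h(1) by (intro continuous_intros) auto
  moreover have "F x = cis (2 * pi * g x)" if x: "x \<in> standard_simplex p" for x
  proof -
    have "Re (h x) = 0" using F(2) [OF x] h(2) [OF x] by simp
    then show ?thesis using h(2) [OF x] by (simp add: exp_eq_polar g_def)
  qed
  ultimately show ?thesis by (rule that)
qed

lemma lift_into_circles:
  assumes q: "continuous_map (top_of_set (standard_simplex p)) (circles k) q"
  obtains j g where "j < k" "continuous_on (standard_simplex p) g"
    "\<And>x. x \<in> standard_simplex p \<Longrightarrow> q x = (j, circle_point (g x))"
proof -
  let ?S = "standard_simplex p"
  have q_in: "q x \<in> topspace (circles k)" if "x \<in> ?S" for x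
    using continuous_map_funspace [OF q] that by auto
  have "(\<lambda>x. real (fst (q x))) constant_on ?S"
    using continuous_map_compose [OF q continuous_map_fst_circles]
    by (intro continuous_on_Ints_imp_constant connected_standard_simplex) (auto simp: o_def)
  then obtain c where c: "\<And>x. x \<in> ?S \<Longrightarrow> real (fst (q x)) = c" by (auto simp: constant_on_def)
  obtain x0 where x0: "x0 \<in> ?S" using nonempty_standard_simplex by blast
  have j: "fst (q x) = fst (q x0)" if "x \<in> ?S" for x using c [OF that] c [OF x0] by simp
  define F where "F = (\<lambda>x. Complex (snd (q x) 0) (snd (q x) 1))"
  have "continuous_map (top_of_set ?S) (nsphere 1) (\<lambda>x. snd (q x))"
    using continuous_map_compose [OF q continuous_map_snd_circles] by (simp add: o_def)
  then have "continuous_on ?S (\<lambda>x. snd (q x) i)" for i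
    using continuous_map_compose [OF _ continuous_map_nsphere_projection [of 1 i]] by (force simp: o_def)
  then have "continuous_on ?S F" unfolding F_def by (intro continuous_on_Complex) auto
  moreover have "cmod (F x) = 1" if "x \<in> ?S" for x
    using q_in [OF that] by (auto simp: topspace_circles topspace_nsphere_1 F_def cmod_def simp del: One_nat_def)
  ultimately obtain g where g: "continuous_on ?S g" "\<And>x. x \<in> ?S \<Longrightarrow> F x = cis (2 * pi * g x)"
    using lift_to_angle by blast
  have "q x = (fst (q x0), circle_point (g x))" if x: "x \<in> ?S" for x
  proof -
    have "snd (q x) i = 0" if "i > 1" for i
      using q_in [OF x] that by (auto simp: topspace_circles topspace_nsphere_1 simp del: One_nat_def)
    moreover have "snd (q x) 0 = cos (2 * pi * g x)" "snd (q x) 1 = sin (2 * pi * g x)"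
      using g(2) [OF x] by (simp_all add: F_def complex_eq_iff)
    ultimately have "snd (q x) = circle_point (g x)" by (auto simp: circle_point_def fun_eq_iff)
    then show ?thesis using j [OF x] by (simp add: prod_eq_iff)
  qed
  moreover have "fst (q x0) < k" using q_in [OF x0] by (auto simp: topspace_circles)
  ultimately show ?thesis using g(1) that by blast
qed

context cylinder
begin

lemma continuous_cyl_circle:
  assumes "j < k"
  shows "continuous_map euclideanreal (subtopology cyl (cyl_end k)) (cyl_circle j)"
proof -
  have "continuous_map euclideanreal (circles k) (\<lambda>s. (j, circle_point s))"
    using continuous_map_compose [OF continuous_circle_point
        continuous_map_component_injection [of j "{..<k}" "\<lambda>_. nsphere 1"]] assms
    by (simp add: circles_def o_def)
  then have "continuous_map euclideanreal circles_I (\<lambda>s. ((j, circle_point s), 1))"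
    by (auto simp: continuous_map_pairwise o_def)
  from continuous_map_compose [OF this continuous_cyl_proj]
  have "continuous_map euclideanreal cyl (cyl_circle j)"
    by (simp add: o_def cyl_proj_def cyl_circle_def [abs_def])
  moreover have "cyl_circle j s \<in> cyl_end k" for s
    using continuous_map_funspace [OF continuous_circle_point] assms
    by (auto simp: cyl_circle_def cyl_end_def topspace_circles)
  ultimately show ?thesis by (auto simp: continuous_map_in_subtopology)
qed

lemma cyl_end_eq: "y \<in> cyl_end k \<Longrightarrow> y = Inr (end_point y, 1)"
  by (auto simp: cyl_end_def end_point_def)

sublocale circle_family_retract cyl "cyl_end k" k cyl_circle X Inl "cyl_retract \<gamma>"
proof
  show "(cyl_circle j s = cyl_circle j' t) = (j = j' \<and> s - t \<in> \<int>)" for j j' s t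
    by (simp add: cyl_circle_def circle_point_eq_iff)
  fix p \<sigma> assume "singular_simplex p (subtopology cyl (cyl_end k)) \<sigma>"
  then have \<sigma>: "continuous_map (top_of_set (standard_simplex p)) (subtopology cyl (cyl_end k)) \<sigma>"
    by (simp add: singular_simplex_iff_top_of_set)
  obtain j g where lift: "j < k" "continuous_on (standard_simplex p) g"
    "\<And>x. x \<in> standard_simplex p \<Longrightarrow> (end_point \<circ> \<sigma>) x = (j, circle_point (g x))"
    by (rule lift_into_circles [OF continuous_map_compose [OF \<sigma> continuous_end_point]]) (rule that)
  have "\<sigma> x = cyl_circle j (g x)" if "x \<in> standard_simplex p" for x
  proof -
    have "\<sigma> x \<in> cyl_end k" using continuous_map_funspace [OF \<sigma>] that by auto
    then show ?thesis using cyl_end_eq lift(3) [OF that] by (metis comp_apply cyl_circle_def)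
  qed
  then show "\<exists>j<k. \<exists>g. continuous_on (standard_simplex p) g \<and> (\<forall>x\<in>standard_simplex p. \<sigma> x = cyl_circle j (g x))"
    using lift(1,2) by blast
qed (rule continuous_cyl_circle retraction_maps_cyl homotopic_id_cyl_retract; assumption?)+

end

theorem theoremB:
  fixes X :: "'a topology" and k :: nat and \<gamma> :: "nat \<times> (nat \<Rightarrow> real) \<Rightarrow> 'a"
    and z :: "('a + (nat \<times> (nat \<Rightarrow> real)) \<times> real) ssimplex \<Rightarrow> real"
  assumes "countable_cw_complex X"
    and "continuous_map (circles k) X \<gamma>"
    and "rrelcycle 2 (mapping_cylinder X k \<gamma>) (cyl_end k) z"
  shows "let S = {transported_pairing 2 (mapping_cylinder X k \<gamma>) (cyl_end k) Inl X \<psi> z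
                    / binfnorm 2 X \<psi> | \<psi>. bcocycle 2 X {} \<psi> \<and> \<not> bcohomologous 2 X {} \<psi> (\<lambda>_. 0)}
         in gromov_norm 2 (mapping_cylinder X k \<gamma>) (cyl_end k) z = (if S = {} then 0 else Sup S)"
proof -
  interpret cylinder X k \<gamma> by unfold_locales (rule assms(2))
  show ?thesis unfolding Let_def by (rule gromov_norm_duality [OF assms(3)])
qed

end
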